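(* For every integer $k\geq 3$ and every real $\eta>0$ there exists $n_0$ such that if $n>n_0$ then every $k$-graph $H$ on $n$ vertices with $\delta_{k-1}(H) > \left( \frac{1}{2(k-1)} + \eta\right)n$ contains a loose Hamilton cycle.
   Context: A $k$-uniform hypergraph, or $k$-graph, $H$ consists of a vertex set $V$ and a set of edges, each of which is a set of $k$ vertices. For a set $T\in\binom{V}{k-1}$ of $k-1$ vertices, its neighbourhood is $N_H(T)=\{x\in V:\{x\}\cup T\in H\}$ and its degree is $d_{k-1}(T)=|N_H(T)|$. The minimum degree of $H$ is $\delta_{k-1}(H)=\min\{d_{k-1}(T):T\in\binom{V}{k-1}\}$. A $k$-graph $C$ is a cycle of order $n$ if its vertices can be given a cyclic ordering $v_1,\dots,v_n$ so that every consecutive pair $v_i,v_{i+1}$ (indices modulo $n$) lies in an edge of $C$ and every edge of $C$ consists of $k$ consecutive vertices. (The edges inherit a cyclic order from the cyclic order of the vertices; two edges are adjacent if they are consecutive in this order.) A cycle is loose if every pair of adjacent edges intersects in a single vertex, with the possible exception of one pair of adjacent edges, which may intersect in more than one vertex. (So the order of a loose cycle need not be a multiple of $k-1$.) A Hamilton cycle in a $k$-graph $H$ is a sub-$k$-graph of $H$ which is a cycle containing every vertex of $H$; it is a loose Hamilton cycle if this cycle is loose. *)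

theory Defs
  imports Complex_Main
begin

definition k_graph :: "nat \<Rightarrow> 'a set \<Rightarrow> 'a set set \<Rightarrow> bool" where
  "k_graph k V E \<longleftrightarrow> finite V \<and> (\<forall>e\<in>E. e \<subseteq> V \<and> card e = k)"

definition sub_k_graph :: "nat \<Rightarrow> 'a set \<Rightarrow> 'a set set \<Rightarrow> 'a set \<Rightarrow> 'a set set \<Rightarrow> bool" where
  "sub_k_graph k V' E' V E \<longleftrightarrow> k_graph k V' E' \<and> V' \<subseteq> V \<and> E' \<subseteq> E"

definition neighbourhood :: "'a set \<Rightarrow> 'a set set \<Rightarrow> 'a set \<Rightarrow> 'a set" where
  "neighbourhood V E T = {x \<in> V. {x} \<union> T \<in> E}"

definition degree :: "'a set \<Rightarrow> 'a set set \<Rightarrow> 'a set \<Rightarrow> nat" where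
  "degree V E T = card (neighbourhood V E T)"

text \<open>The minimum over all (k-1)-subsets of V; unspecified if \<open>card V < k - 1\<close>.\<close>

definition min_degree :: "nat \<Rightarrow> 'a set \<Rightarrow> 'a set set \<Rightarrow> nat" where
  "min_degree k V E = Min (degree V E ` {T. T \<subseteq> V \<and> card T = k - 1})"

text \<open>A cyclic ordering of the vertices is a list, with indices read modulo its length.
  \<open>segment k vs i\<close> is the set of the k consecutive vertices starting at position i.\<close>

definition segment :: "nat \<Rightarrow> 'a list \<Rightarrow> nat \<Rightarrow> 'a set" where
  "segment k vs i = {vs ! ((i + j) mod length vs) | j. j < k}"

definition cycle_ordering :: "nat \<Rightarrow> 'a set \<Rightarrow> 'a set set \<Rightarrow> 'a list \<Rightarrow> bool" where
  "cycle_ordering k V E vs \<longleftrightarrow>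
     vs \<noteq> [] \<and> distinct vs \<and> set vs = V \<and>
     (\<forall>i < length vs. \<exists>e\<in>E. {vs ! i, vs ! (Suc i mod length vs)} \<subseteq> e) \<and>
     (\<forall>e\<in>E. \<exists>i < length vs. e = segment k vs i)"

definition is_cycle :: "nat \<Rightarrow> 'a set \<Rightarrow> 'a set set \<Rightarrow> bool" where
  "is_cycle k V E \<longleftrightarrow> k_graph k V E \<and> (\<exists>vs. cycle_ordering k V E vs)"

text \<open>The edges are ordered cyclically by their starting positions: f follows e if it is the
  first edge met when the starting position of e is moved forward. No bound on \<open>d\<close> is needed,
  since after a full turn one meets e itself.\<close>

definition adjacent_edges :: "nat \<Rightarrow> 'a set set \<Rightarrow> 'a list \<Rightarrow> 'a set \<Rightarrow> 'a set \<Rightarrow> bool" where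
  "adjacent_edges k E vs e f \<longleftrightarrow>
     e \<in> E \<and> f \<in> E \<and> e \<noteq> f \<and>
     (\<exists>i d. 0 < d \<and> e = segment k vs i \<and> f = segment k vs (i + d) \<and>
        (\<forall>d'. 0 < d' \<and> d' < d \<longrightarrow> segment k vs (i + d') \<notin> E))"

text \<open>\<open>p\<close> is the one (unordered) pair of adjacent edges that is allowed to be exceptional.\<close>

definition loose_cycle :: "nat \<Rightarrow> 'a set \<Rightarrow> 'a set set \<Rightarrow> bool" where
  "loose_cycle k V E \<longleftrightarrow>
     k_graph k V E \<and>
     (\<exists>vs. cycle_ordering k V E vs \<and>
        (\<exists>p. \<forall>e f. adjacent_edges k E vs e f \<longrightarrow>
           card (e \<inter> f) = 1 \<or> ({e, f} = p \<and> card (e \<inter> f) > 1)))"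

definition hamilton_cycle ::
    "nat \<Rightarrow> 'a set \<Rightarrow> 'a set set \<Rightarrow> 'a set \<Rightarrow> 'a set set \<Rightarrow> bool" where
  "hamilton_cycle k V E V' E' \<longleftrightarrow>
     sub_k_graph k V' E' V E \<and> is_cycle k V' E' \<and> V \<subseteq> V'"

definition loose_hamilton_cycle ::
    "nat \<Rightarrow> 'a set \<Rightarrow> 'a set set \<Rightarrow> 'a set \<Rightarrow> 'a set set \<Rightarrow> bool" where
  "loose_hamilton_cycle k V E V' E' \<longleftrightarrow>
     hamilton_cycle k V E V' E' \<and> loose_cycle k V' E'"

end

theory Submission
  imports Defs "HOL-Library.FuncSet"
begin

text \<open>
  The proof uses the absorbing method. A vertex \<open>s\<close> can take the place of a vertex \<open>v\<close> in an edge,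
  and \<open>v\<close> together with \<open>k - 2\<close> further vertices can be inserted into another edge, which
  thereby becomes two edges. Every set of \<open>k - 1\<close> vertices has a positive proportion of such
  absorbers, so that a random choice of linearly many of them, strung together by connecting paths
  of three edges, is a path able to swallow any small set of vertices of size divisible by \<open>k - 1\<close>.
  Almost all remaining vertices are covered by disjoint loose paths of a large fixed length; only here the constant \<open>1 / (2 (k - 1))\<close> matters. These paths, the absorbing path and a pair of
  edges whose overlap fixes the residue of the order modulo \<open>k - 1\<close> are connected through a small
  random reservoir to a loose cycle, and the absorbing path takes up the vertices left over.
\<close>

section \<open>Loose paths\<close>

text \<open>A path is recorded only as a vertex set with two ends. This suffices because a connector
  depends on a segment through its ends alone: when the absorbing path swallows the leftover
  vertices, its vertex set is exchanged for a larger one with the same ends and the rest of the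
  cycle is untouched. The leftover set is known only after all connectors have been chosen. The
  absorbers must therefore be ready for every small set at once; a union bound over at most
  \<open>n ^ (k - 1)\<close> requirements is affordable because each fails with exponentially small
  probability. Every loose path has order 1 modulo \<open>k - 1\<close>, so the size of the leftover
  set modulo \<open>k - 1\<close> depends only on \<open>n\<close> and on the overlap of the
  exceptional pair. The constants depend on each other in one direction. The degree fixes the
  density of absorbers and hence the number of vertices that can be swallowed. The reservoir and the
  uncovered part have to stay below this number, and the paths of the tiling have to be so long that
  the reservoir can connect all of them.\<close>

inductive lpath :: "nat \<Rightarrow> 'a set set \<Rightarrow> 'a \<Rightarrow> 'a set \<Rightarrow> 'a \<Rightarrow> bool" for k E where
  lpath_nil: "lpath k E x {x} x"
| lpath_step: "lpath k E x A y \<Longrightarrow> e \<in> E \<Longrightarrow> card e = k \<Longrightarrow> e \<inter> A = {y} \<Longrightarrow> z \<in> e \<Longrightarrow> z \<noteq> y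
    \<Longrightarrow> lpath k E x (A \<union> e) z"

lemma lpath_ends: "lpath k E x A y \<Longrightarrow> x \<in> A \<and> y \<in> A"
  by (induction rule: lpath.induct) auto

lemma lpath_finite: "lpath k E x A y \<Longrightarrow> k > 0 \<Longrightarrow> finite A"
  by (induction rule: lpath.induct) (auto intro: card_ge_0_finite)

text \<open>Each edge brings \<open>k - 1\<close> new vertices. The congruence makes the number of
  leftover vertices divisible by \<open>k - 1\<close> at the end.\<close>

lemma lpath_card:
  assumes "lpath k E x A y" "k > 0"
  shows "\<exists>q. card A = q * (k - 1) + 1"
  using assms
proof (induction rule: lpath.induct)
  case (lpath_nil x)
  show ?case by (intro exI[of _ 0]) simp
next
  case (lpath_step x A y e z)
  then obtain q where q: "card A = q * (k - 1) + 1" by auto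
  have fin: "finite A" "finite e"
    using lpath_step lpath_finite by (auto intro: card_ge_0_finite)
  have "card A + card e = card (A \<union> e) + card (A \<inter> e)" by (rule card_Un_Int[OF fin])
  moreover have "A \<inter> e = {y}" using lpath_step by auto
  ultimately have "card (A \<union> e) = Suc q * (k - 1) + 1" using q lpath_step by simp
  then show ?case by blast
qed

text \<open>The second path is the first assumption because the induction runs over it: its edges
  are appended one by one to the first path, and \<open>A \<inter> B = {y}\<close> keeps them off
  the vertices already used.\<close>

lemma lpath_trans:
  assumes "lpath k E y B z" "lpath k E x A y" "A \<inter> B = {y}"
  shows "lpath k E x (A \<union> B) z"
  using assms
proof (induction rule: lpath.induct)
  case (lpath_nil y)
  then show ?case by (simp add: insert_absorb lpath_ends)
next
  case (lpath_step y B w e z)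
  have w: "w \<in> B" "y \<in> B" using lpath_step lpath_ends by fast+
  have "A \<inter> B = {y}" using lpath_step.prems w by blast
  then have 1: "lpath k E x (A \<union> B) w" using lpath_step by blast
  have "e \<inter> (A \<union> B) = {w}"
    using lpath_step.prems lpath_step.hyps w by blast
  then have "lpath k E x ((A \<union> B) \<union> e) z"
    using lpath.lpath_step[OF 1] lpath_step.hyps by blast
  then show ?case by (simp add: Un_assoc)
qed

lemma lpath_edge:
  assumes "e \<in> E" "card e = k" "x \<in> e" "y \<in> e" "x \<noteq> y"
  shows "lpath k E x e y"
proof -
  have "lpath k E x ({x} \<union> e) y"
    by (rule lpath_step[OF lpath_nil]) (use assms in auto)
  then show ?thesis using assms by (simp add: insert_absorb)
qed

lemma lpath_two_edges:
  assumes "e \<in> E" "card e = k" "f \<in> E" "card f = k" "e \<inter> f = {z}"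
    "x \<in> e" "x \<noteq> z" "y \<in> f" "y \<noteq> z"
  shows "lpath k E x (e \<union> f) y"
  using lpath_trans[OF lpath_edge[of f E k z y] lpath_edge[of e E k x z]] assms by blast

text \<open>Recovers a linear order, which a cyclic ordering requires: edge \<open>i\<close>
  occupies the \<open>k\<close> positions from \<open>i * (k - 1)\<close> on. Inside an edge only
  the two joints have a prescribed place.\<close>

lemma lpath_list:
  assumes "lpath k E x A y" "k \<ge> 2"
  shows "\<exists>p q. distinct p \<and> set p = A \<and> length p = q * (k - 1) + 1 \<and> hd p = x \<and> last p = y \<and>
    (\<forall>i<q. set (take k (drop (i * (k - 1)) p)) \<in> E)"
  using assms
proof (induction rule: lpath.induct)
  case (lpath_nil x)
  show ?case by (rule exI[of _ "[x]"], rule exI[of _ 0]) simp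
next
  case (lpath_step x A y e z)
  then obtain p q where p: "distinct p" "set p = A" "length p = q * (k - 1) + 1" "hd p = x"
    "last p = y" "\<And>i. i < q \<Longrightarrow> set (take k (drop (i * (k - 1)) p)) \<in> E" by blast
  have fe: "finite e" using lpath_step by (intro card_ge_0_finite) auto
  then obtain es where es: "set es = e - {y, z}" "distinct es"
    using finite_distinct_list[of "e - {y, z}"] by auto
  have yz: "y \<in> e" "z \<in> e" "y \<noteq> z" using lpath_step by auto
  have zA: "z \<notin> A" using lpath_step by auto
  have les: "length es = k - 2"
    using es lpath_step yz fe distinct_card[of es] by (simp add: card_Diff_subset)
  let ?p = "p @ es @ [z]"
  have pne: "p \<noteq> []" using p(3) by auto
  \<comment> \<open>The new edge shares its first position with the old end of the list.\<close>
  have d: "drop (q * (k - 1)) p = [y]"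
  proof -
    have "drop (q * (k - 1)) p = drop (length p - 1) p" using p(3) by simp
    also have "\<dots> = [last p]" using pne
      by (metis append_butlast_last_id append_eq_conv_conj length_butlast)
    finally show ?thesis using p(5) by simp
  qed
  have "distinct ?p" using p(1,2) es zA lpath_step by auto
  moreover have "set ?p = A \<union> e" using p(2) es yz lpath_ends[OF lpath_step(1)] by auto
  moreover have "length ?p = Suc q * (k - 1) + 1" using p(3) les \<open>k \<ge> 2\<close> by simp
  moreover have "hd ?p = x" using p(4) pne by simp
  moreover have "last ?p = z" by simp
  moreover have "set (take k (drop (i * (k - 1)) ?p)) \<in> E" if "i < Suc q" for i
  proof (cases "i = q")
    case True
    have "drop (i * (k - 1)) ?p = y # es @ [z]" using d True p(3) by simp
    moreover have "length (y # es @ [z]) = k" using les \<open>k \<ge> 2\<close> by simp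
    ultimately have "set (take k (drop (i * (k - 1)) ?p)) = e" using es yz by auto
    then show ?thesis using lpath_step by simp
  next
    case False
    then have iq: "i < q" using that by simp
    then have "Suc i * (k - 1) \<le> q * (k - 1)" by (intro mult_le_mono1) simp
    then have "i * (k - 1) + k \<le> length p" using p(3) \<open>k \<ge> 2\<close> by simp
    then have "take k (drop (i * (k - 1)) ?p) = take k (drop (i * (k - 1)) p)" by simp
    then show ?thesis using p(6)[OF iq] by (simp only:)
  qed
  ultimately show ?case by blast
qed

section \<open>Segments of a cyclic ordering\<close>

lemma segment_mod:
  assumes "vs \<noteq> []" shows "segment k vs (i mod length vs) = segment k vs i"
  unfolding segment_def by (simp add: mod_add_left_eq)

lemma segment_image: "segment k vs i = (\<lambda>j. vs ! ((i + j) mod length vs)) ` {..<k}"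
  unfolding segment_def by auto

lemma mem_segment_iff:
  assumes "distinct vs" "a < length vs" "vs \<noteq> []"
  shows "vs ! a \<in> segment k vs i \<longleftrightarrow> (\<exists>j<k. a = (i + j) mod length vs)"
  using assms unfolding segment_def by (auto simp: nth_eq_iff_index_eq)

lemma add_mod_less:
  fixes i j n :: nat
  assumes "j < n"
  shows "(i + j) mod n = (if i mod n + j < n then i mod n + j else i mod n + j - n)"
proof -
  have "(i + j) mod n = (i mod n + j) mod n" by (simp add: mod_add_left_eq)
  moreover have "i mod n < n" using assms by simp
  ultimately show ?thesis using assms by (cases "i mod n + j < n") (simp_all add: le_mod_geq)
qed

lemma card_segment:
  assumes "distinct vs" "k \<le> length vs" "vs \<noteq> []"
  shows "card (segment k vs i) = k"
proof -
  have "inj_on (\<lambda>j. vs ! ((i + j) mod length vs)) {..<k}"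
  proof (rule inj_onI)
    fix a b assume ab: "a \<in> {..<k}" "b \<in> {..<k}" "vs ! ((i + a) mod length vs) = vs ! ((i + b) mod length vs)"
    then have "(i + a) mod length vs = (i + b) mod length vs"
      using assms by (simp add: nth_eq_iff_index_eq)
    then show "a = b" using ab(1,2) assms(2) add_mod_less[of a "length vs" i] add_mod_less[of b "length vs" i]
      by (auto split: if_splits)
  qed
  then show ?thesis unfolding segment_image by (simp add: card_image)
qed

text \<open>Each start lies in the other segment, at forward distances \<open>a\<close> and
  \<open>b\<close> below \<open>k\<close>. Their sum is a multiple of the length and smaller than
  \<open>2 * k\<close>, hence 0.\<close>

lemma segment_inj:
  assumes "distinct vs" "2 * k \<le> length vs" "k > 0" "segment k vs i = segment k vs j"
    "i < length vs" "j < length vs"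
  shows "i = j"
proof -
  have "vs \<noteq> []" using assms by auto
  let ?n = "length vs"
  have "vs ! i \<in> segment k vs i" "vs ! j \<in> segment k vs j"
    using assms unfolding segment_def by fastforce+
  then have "vs ! i \<in> segment k vs j" "vs ! j \<in> segment k vs i"
    using assms(4) by simp_all
  then obtain a b where ab: "a < k" "i = (j + a) mod ?n" "b < k" "j = (i + b) mod ?n"
    unfolding mem_segment_iff[OF assms(1,5) \<open>vs \<noteq> []\<close>] mem_segment_iff[OF assms(1,6) \<open>vs \<noteq> []\<close>]
    by blast
  have 1: "i = j + a \<or> i + ?n = j + a"
    using ab(1,2) assms(2,5,6) \<open>vs \<noteq> []\<close> by (auto simp add: mod_if split: if_splits)
  have 2: "j = i + b \<or> j + ?n = i + b"
    using ab(3,4) assms(2,5,6) \<open>vs \<noteq> []\<close> by (auto simp add: mod_if split: if_splits)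
  show ?thesis using 1 2 ab(1,3) assms(2,5,6) by linarith
qed

section \<open>Closing a loose path\<close>

text \<open>The edges start at the multiples of \<open>k - 1\<close>. The last one runs
  \<open>r\<close> places past the end of the list and so ends at position \<open>r\<close>; it and
  the first edge form the exceptional pair. With \<open>m \<ge> 4\<close> the list is long enough
  for \<open>segment_inj\<close>.\<close>

lemma loose_hamilton_cycleI:
  fixes vs :: "'a list" and m r :: nat
  assumes k: "k \<ge> 3" and vs: "distinct vs" "set vs = V"
    and len: "length vs + r = m * (k - 1)" and r: "r \<le> k - 2" and m: "m \<ge> 4"
    and seg: "\<And>i. i < m \<Longrightarrow> segment k vs (i * (k - 1)) \<in> E"
  shows "loose_hamilton_cycle k V E V ((\<lambda>i. segment k vs (i * (k - 1))) ` {..<m})"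
proof -
  define M where "M = k - 1"
  define n where "n = length vs"
  define S where "S i = segment k vs (i * M)" for i
  define C where "C = S ` {..<m}"
  have M: "k = Suc M" "M \<ge> 2" using k by (auto simp: M_def)
  have nr: "n + r = m * M" "r < M" using len r M by (auto simp: n_def)
  have "4 * M \<le> m * M" using m by (rule mult_le_mono1)
  then have n3: "3 * M < n" using nr by linarith
  have n2: "2 * k \<le> n" using n3 M by linarith
  have ne: "vs \<noteq> []" using n3 by (auto simp: n_def)
  have start: "a * M < n" if "a < m" for a
  proof -
    have "Suc a * M \<le> m * M" using that by (intro mult_le_mono1) simp
    then show ?thesis using nr by simp
  qed
  have inj: "i = j" if "segment k vs i = segment k vs j" "i < n" "j < n" for i j
    using segment_inj[OF vs(1) _ _ that(1)] that n2 k by (simp add: n_def)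
  have segV: "segment k vs i \<subseteq> V" for i
    unfolding segment_def using vs ne by (auto intro!: nth_mem)
  have card_seg: "card (segment k vs i) = k" for i
    using card_segment[OF vs(1) _ ne] n2 by (simp add: n_def)
  have fin: "finite V" using vs by auto
  have kg: "k_graph k V C"
    unfolding k_graph_def C_def S_def using fin segV card_seg by auto
  have ord: "cycle_ordering k V C vs"
    unfolding cycle_ordering_def
  proof (intro conjI allI impI ballI)
    fix i assume i: "i < length vs"
    define a where "a = i div M"
    define j where "j = i mod M"
    have ij: "i = a * M + j" "j < M" using M by (auto simp: a_def j_def)
    have "a < m"
    proof (rule ccontr)
      assume "\<not> a < m"
      then have "m * M \<le> a * M" by simp
      then show False using ij i nr unfolding n_def by linarith
    qed
    have "vs ! i \<in> S a" unfolding S_def segment_def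
      using ij i M by (auto intro!: exI[of _ j])
    moreover have "vs ! (Suc i mod length vs) \<in> S a" unfolding S_def segment_def
      using ij M by (auto intro!: exI[of _ "Suc j"])
    ultimately show "\<exists>e\<in>C. {vs ! i, vs ! (Suc i mod length vs)} \<subseteq> e"
      unfolding C_def using \<open>a < m\<close> by auto
  next
    fix e assume "e \<in> C"
    then obtain a where "a < m" "e = S a" unfolding C_def by auto
    then show "\<exists>i<length vs. e = segment k vs i"
      using start[of a] unfolding S_def n_def by auto
  qed (use vs ne in auto)
  have adj: "card (e \<inter> f) = 1 \<or> ({e, f} = {S (m - 1), S 0} \<and> card (e \<inter> f) > 1)"
    if ad: "adjacent_edges k C vs e f" for e f
  proof -
    from ad obtain i d where ef: "e \<in> C" "f \<in> C" and d: "0 < d"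
      and ei: "e = segment k vs i" and fi: "f = segment k vs (i + d)"
      and nd: "\<And>d'. 0 < d' \<Longrightarrow> d' < d \<Longrightarrow> segment k vs (i + d') \<notin> C"
      unfolding adjacent_edges_def by blast
    obtain a where a: "a < m" "e = S a" using ef unfolding C_def by auto
    obtain b where b: "b < m" "f = S b" using ef unfolding C_def by auto
    have "segment k vs (i mod n) = segment k vs (a * M)"
      using ei a segment_mod[OF ne] unfolding S_def n_def by simp
    then have im: "i mod n = a * M" using inj start[OF a(1)] n3 by simp
    \<comment> \<open>The position \<open>i\<close> that witnesses adjacency is an arbitrary natural
      number; only its residue \<open>a * M\<close> is known.\<close>
    have shift: "segment k vs (i + t) = segment k vs (a * M + t)" for t
    proof -
      have "segment k vs (i + t) = segment k vs ((i mod n + t) mod n)"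
        using segment_mod[OF ne, of k "i + t"] by (simp add: n_def mod_add_left_eq)
      also have "\<dots> = segment k vs (a * M + t)" using im segment_mod[OF ne, of k "a * M + t"]
        by (simp add: n_def)
      finally show ?thesis .
    qed
    show ?thesis
    proof (cases "Suc a < m")
      case True
      \<comment> \<open>\<open>S (Suc a)\<close> starts \<open>M\<close> places after
        \<open>e\<close>, so the next edge comes no later; and no start lies strictly between
        consecutive multiples of \<open>M\<close>.\<close>
      have "d \<le> M"
      proof (rule ccontr)
        assume "\<not> d \<le> M"
        then have "segment k vs (a * M + M) \<notin> C" using nd[of M] M shift by simp
        moreover have "segment k vs (a * M + M) = S (Suc a)" unfolding S_def by (simp add: add.commute)
        ultimately show False using True unfolding C_def by blast
      qed
      have lt: "a * M + M < n" using start[OF True] by simp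
      have "segment k vs (a * M + d) = segment k vs (b * M)" using fi shift b unfolding S_def by simp
      then have "a * M + d = b * M" using inj[of "a * M + d" "b * M"] start[OF b(1)] lt \<open>d \<le> M\<close> by simp
      then have "a * M < b * M" "b * M \<le> Suc a * M" using d \<open>d \<le> M\<close> unfolding mult_Suc by linarith+
      then have "a < b" "b \<le> Suc a" using M by (simp_all only: mult_less_cancel2 mult_le_cancel2)
      then have bS: "b = Suc a" by simp
      have "e \<inter> f \<subseteq> {vs ! (Suc a * M)}"
      proof
        fix x assume x: "x \<in> e \<inter> f"
        obtain j where j: "j < k" "x = vs ! ((a * M + j) mod n)"
          using x a unfolding S_def segment_def n_def by auto
        obtain l where l: "l < k" "x = vs ! ((Suc a * M + l) mod n)"
          using x b bS unfolding S_def segment_def n_def by auto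
        have p1: "(a * M + j) mod n = a * M + j" using lt j M by simp
        have "(Suc a * M + l) mod n < n" using n3 by simp
        then have e1: "a * M + j = (Suc a * M + l) mod n"
          using j l vs(1) p1 lt M by (auto simp: n_def nth_eq_iff_index_eq)
        show "x \<in> {vs ! (Suc a * M)}"
        proof (cases "Suc a * M + l < n")
          case True
          then have "a * M + j = Suc a * M + l" using e1 by simp
          then have "a * M + j = Suc a * M" using j M by simp
          then show ?thesis using j p1 by (simp add: add.commute)
        next
          case False
          \<comment> \<open>Here \<open>f\<close> runs past the end of the list and a common vertex
            would lie at a position at most \<open>r < M\<close>. This forces \<open>a = 0\<close>,
            but then \<open>f\<close> ends at \<open>2 * M < n\<close>.\<close>
          have "Suc (Suc a) * M \<le> m * M" using \<open>Suc a < m\<close> by (intro mult_le_mono1) simp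
          then have u: "Suc a * M + M \<le> n + r" using nr by simp
          have "(Suc a * M + l) mod n = Suc a * M + l - n"
            using False u nr l M n3 by (simp add: le_mod_geq)
          then have "a * M + j \<le> r" using e1 u l M by linarith
          then have "a * M < M" using nr by linarith
          then have "a = 0" by (cases a) auto
          then show ?thesis using False l M n3 by simp
        qed
      qed
      moreover have "vs ! (Suc a * M) \<in> e \<inter> f"
      proof -
        have "vs ! (Suc a * M) \<in> e" unfolding a S_def segment_def
          using lt M by (auto intro!: exI[of _ M] simp: n_def add.commute)
        moreover have "vs ! (Suc a * M) \<in> f" unfolding b bS S_def segment_def
          using lt M by (auto intro!: exI[of _ 0] simp: n_def add.commute)
        ultimately show ?thesis by simp
      qed
      ultimately have "e \<inter> f = {vs ! (Suc a * M)}" by blast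
      then show ?thesis by simp
    next
      case False
      then have am: "m = Suc a" using a by simp
      then have nr': "n + r = a * M + M" using nr by simp
      have S0: "segment k vs n = S 0" unfolding S_def using segment_mod[OF ne, of k n] by (simp add: n_def)
      \<comment> \<open>After the last edge the next start is position \<open>n\<close>, which is
        position 0 again.\<close>
      have "d \<le> n - a * M"
      proof (rule ccontr)
        assume "\<not> d \<le> n - a * M"
        then have "segment k vs (i + (n - a * M)) \<notin> C" using nd[of "n - a * M"] nr' nr(2) by linarith
        moreover have "a * M + (n - a * M) = n" using nr' nr(2) by linarith
        ultimately have "segment k vs n \<notin> C" using shift[of "n - a * M"] by simp
        then show False using S0 m unfolding C_def by auto
      qed
      have "a * M + d = n"
      proof (rule ccontr)
        assume "a * M + d \<noteq> n"
        then have lt: "a * M + d < n" using \<open>d \<le> n - a * M\<close> nr' nr(2) by linarith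
        have "segment k vs (a * M + d) = segment k vs (b * M)" using fi shift b unfolding S_def by simp
        then have "a * M + d = b * M" using inj[of "a * M + d" "b * M"] start[OF b(1)] lt by simp
        moreover have "b * M \<le> a * M" using b am by (intro mult_le_mono1) simp
        ultimately show False using d by simp
      qed
      then have f0: "f = S 0" using fi shift S0 by simp
      have "vs ! 0 \<in> e"
      proof -
        have "(a * M + (M - r)) mod n = 0" using nr' nr(2) by (metis Nat.add_diff_assoc diff_add_inverse2 less_imp_le mod_self)
        then show ?thesis unfolding a S_def segment_def n_def[symmetric]
          using M by (auto intro!: exI[of _ "M - r"])
      qed
      moreover have "vs ! 0 \<in> f" unfolding f0 S_def segment_def
        using M ne by (auto intro!: exI[of _ 0])
      moreover have "finite (e \<inter> f)" using segV ei fin by (metis finite_Int rev_finite_subset)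
      ultimately have "card (e \<inter> f) \<ge> 1" by (metis Int_iff One_nat_def Suc_leI card_gt_0_iff empty_iff)
      moreover have "{e, f} = {S (m - 1), S 0}" using a f0 am by simp
      ultimately show ?thesis by linarith
    qed
  qed
  have CE: "C \<subseteq> E" unfolding C_def S_def using seg by (auto simp: M_def)
  have "loose_hamilton_cycle k V E V C"
    unfolding loose_hamilton_cycle_def hamilton_cycle_def sub_k_graph_def is_cycle_def loose_cycle_def
    using kg ord adj CE by blast
  then show ?thesis unfolding C_def S_def M_def .
qed

text \<open>The order of a loose cycle is corrected modulo \<open>k - 1\<close> by the overlap \<open>X\<close> of the two edges
  \<open>e\<close> and \<open>f\<close>; this is the exceptional pair.\<close>

lemma lpath_close:
  fixes V :: "'a set"
  assumes k: "k \<ge> 3" and V: "finite V" "card V \<ge> 4 * k"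
    and f: "f \<in> E" "card f = k" "f \<subseteq> V" and e: "e \<in> E" "card e = k" "e \<subseteq> V"
    and ef: "e \<inter> f \<noteq> {}" and x: "x \<in> f - e" and y: "y \<in> e - f"
    and p: "lpath k E x A y" "A = V - (e \<union> f) \<union> {x, y}"
  shows "\<exists>C. loose_hamilton_cycle k V E V C"
proof -
  define X where "X = e \<inter> f"
  have fin: "finite e" "finite f" using V f e finite_subset by auto
  have "\<exists>xs. set xs = B \<and> distinct xs" if "B \<subseteq> V" for B
    using finite_distinct_list finite_subset[OF that V(1)] by blast
  note ex = this
  obtain xs where xs: "set xs = X" "distinct xs" using ex[of X] f by (auto simp: X_def)
  obtain fs where fs: "set fs = f - X - {x}" "distinct fs" using ex[of "f - X - {x}"] f by auto
  obtain es where es: "set es = e - X - {y}" "distinct es" using ex[of "e - X - {y}"] e by auto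
  obtain ps q where ps: "distinct ps" "set ps = A" "length ps = q * (k - 1) + 1" "hd ps = x" "last ps = y"
    "\<And>i. i < q \<Longrightarrow> set (take k (drop (i * (k - 1)) ps)) \<in> E"
    using lpath_list[OF p(1)] k by auto
  define s where "s = length xs"
  have s: "s = card X" using xs distinct_card unfolding s_def by metis
  have s0: "s > 0" using ef fin unfolding s X_def by (simp add: card_gt_0_iff)
  have lf: "length fs + s + 1 = k"
  proof -
    have "length fs = card (f - X - {x})" using fs distinct_card by metis
    also have "f - X - {x} = f - insert x X" by auto
    also have "card \<dots> = card f - card (insert x X)"
      using fin x by (intro card_Diff_subset) (auto simp: X_def)
    also have "card (insert x X) = Suc s" using x fin unfolding s by (subst card_insert_disjoint) (auto simp: X_def)
    finally have "length fs = k - Suc s" using f by simp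
    moreover have "card (insert x X) \<le> card f" using fin x by (intro card_mono) (auto simp: X_def)
    ultimately show ?thesis using \<open>card (insert x X) = Suc s\<close> f by simp
  qed
  have le: "length es + s + 1 = k"
  proof -
    have "length es = card (e - X - {y})" using es distinct_card by metis
    also have "e - X - {y} = e - insert y X" by auto
    also have "card \<dots> = card e - card (insert y X)"
      using fin y by (intro card_Diff_subset) (auto simp: X_def)
    also have "card (insert y X) = Suc s" using y fin unfolding s by (subst card_insert_disjoint) (auto simp: X_def)
    finally have "length es = k - Suc s" using e by simp
    moreover have "card (insert y X) \<le> card e" using fin y by (intro card_mono) (auto simp: X_def)
    ultimately show ?thesis using \<open>card (insert y X) = Suc s\<close> e by simp
  qed
  \<comment> \<open>The overlap \<open>X\<close> comes first, then the rest of \<open>f\<close>, the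
    path from \<open>x\<close> to \<open>y\<close>, and the rest of \<open>e\<close>. Thus
    \<open>f\<close> is the initial segment, and \<open>e\<close> starts at \<open>y\<close> and
    wraps around to \<open>X\<close>.\<close>
  define vs where "vs = (xs @ fs) @ ps @ es"
  have psne: "ps \<noteq> []" using ps(3) by auto
  have sf: "set (xs @ fs) = f - {x}" "set es = e - f - {y}"
    using xs(1) fs(1) es(1) x by (auto simp: X_def)
  have "distinct (xs @ fs)" using xs fs by auto
  moreover have "distinct (ps @ es)"
  proof -
    have "set ps \<inter> set es = {}" using x unfolding ps(2) sf(2) p(2) by blast
    then show ?thesis using ps(1) es(2) by simp
  qed
  moreover have "set (xs @ fs) \<inter> set (ps @ es) = {}"
    using sf ps(2) y unfolding p(2) set_append[of ps] by blast
  ultimately have dv: "distinct vs" unfolding vs_def distinct_append by blast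
  have sv: "set vs = V"
    unfolding vs_def set_append[of "xs @ fs"] set_append[of ps] sf ps(2) p(2)
    using x y f(3) e(3) by blast
  define n where "n = length vs"
  have la: "length (xs @ fs) = k - 1" using lf by (simp add: s_def)
  have n: "n = (k - 1) + (q * (k - 1) + 1) + (k - 1 - s)"
    unfolding n_def vs_def using la ps(3) le by simp
  have n4: "n \<ge> 4 * k" using V sv dv distinct_card unfolding n_def by fastforce
  \<comment> \<open>The edges are the \<open>q\<close> edges of the path together with
    \<open>f\<close> and \<open>e\<close>.\<close>
  have "4 \<le> q + 2"
  proof (rule ccontr)
    assume "\<not> 4 \<le> q + 2"
    then have "q * (k - 1) \<le> 1 * (k - 1)" by (intro mult_le_mono1) simp
    then show False using n n4 k by linarith
  qed
  have segE: "segment k vs (i * (k - 1)) \<in> E" if "i < q + 2" for i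
  proof -
    have "i = 0 \<or> i \<noteq> 0 \<and> i < q + 1 \<or> i = q + 1" using that by arith
    then consider "i = 0" | "i \<noteq> 0" "i < q + 1" | "i = q + 1" by blast
    then show ?thesis
    proof cases
      case 1
      have "segment k vs 0 = (!) vs ` {..<k}"
        using n4 k unfolding segment_image n_def by (intro image_cong) auto
      also have "\<dots> = set (take k vs)"
        using n4 nth_image[of k vs] unfolding n_def by (simp add: lessThan_atLeast0)
      finally have "segment k vs 0 = set (take k vs)" .
      also have "take k vs = (xs @ fs) @ [hd ps]"
        using la k psne unfolding vs_def by (cases ps) (auto simp: take_Cons')
      also have "set \<dots> = f" using xs fs ps(4) x by (auto simp: X_def)
      finally show ?thesis using f 1 by simp
    next
      case 2
      then obtain j where j: "i = Suc j" "j < q" by (cases i) auto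
      have "Suc j * (k - 1) \<le> q * (k - 1)" using j by (intro mult_le_mono1) simp
      then have b: "j * (k - 1) + k \<le> length ps" using ps(3) k by simp
      have "segment k vs (i * (k - 1)) = set (take k (drop (j * (k - 1)) ps))"
      proof -
        have "vs ! ((i * (k - 1) + t) mod length vs) = take k (drop (j * (k - 1)) ps) ! t" if "t < k" for t
        proof -
          have "i * (k - 1) + t < length vs" using b that la ps(3) j unfolding vs_def by simp
          moreover have "vs ! (i * (k - 1) + t) = ps ! (j * (k - 1) + t)"
          proof -
            have "i * (k - 1) + t = length (xs @ fs) + (j * (k - 1) + t)" using la j by simp
            then have "vs ! (i * (k - 1) + t) = (ps @ es) ! (j * (k - 1) + t)"
              unfolding vs_def by (simp only: nth_append_length_plus)
            then show ?thesis using b that by (simp add: nth_append)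
          qed
          ultimately show ?thesis using b that by simp
        qed
        then have "segment k vs (i * (k - 1)) = (!) (take k (drop (j * (k - 1)) ps)) ` {..<k}"
          unfolding segment_image by (intro image_cong) auto
        also have "\<dots> = set (take k (drop (j * (k - 1)) ps))" using b nth_image[of k "take k (drop (j * (k - 1)) ps)"]
          by (simp add: lessThan_atLeast0)
        finally show ?thesis .
      qed
      then show ?thesis using ps(6) j by simp
    next
      case 3
      have i: "i * (k - 1) + 1 = (k - 1) + length ps" using 3 ps(3) by simp
      \<comment> \<open>The last edge reads \<open>y\<close>, then \<open>es\<close>, and after
        wrapping around the \<open>s\<close> entries of \<open>xs\<close>.\<close>
      have "vs ! ((i * (k - 1) + t) mod length vs) = (y # es @ xs) ! t" if "t < k" for t
      proof -
        consider "t = 0" | "0 < t" "t < k - s" | "k - s \<le> t" "t < k" using \<open>t < k\<close> by linarith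
        then show ?thesis
        proof cases
          case 1
          have "vs ! (i * (k - 1)) = ps ! (length ps - 1)"
          proof -
            have "i * (k - 1) = length (xs @ fs) + (length ps - 1)" using la i ps(3) by linarith
            then have "vs ! (i * (k - 1)) = (ps @ es) ! (length ps - 1)"
              unfolding vs_def by (simp only: nth_append_length_plus)
            then show ?thesis using psne by (simp add: nth_append)
          qed
          moreover have "i * (k - 1) < length vs" using i n ps(3) unfolding n_def by linarith
          ultimately show ?thesis using 1 ps(5) psne by (simp add: last_conv_nth)
        next
          case 2
          have "i * (k - 1) + t < length vs" using i n ps(3) 2 lf unfolding n_def by linarith
          moreover have "vs ! (i * (k - 1) + t) = es ! (t - 1)"
          proof -
            have "i * (k - 1) + t = length (xs @ fs) + (length ps + (t - 1))" using i la 2 by linarith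
            then show ?thesis unfolding vs_def by (simp only: nth_append_length_plus)
          qed
          moreover have "t - 1 < length es" using 2 le by linarith
          ultimately show ?thesis using 2 by (simp add: nth_append nth_Cons')
        next
          case 3
          have "i * (k - 1) + t = length vs + (t - (k - s))" using i n ps(3) 3 lf unfolding n_def by linarith
          then have "(i * (k - 1) + t) mod length vs = t - (k - s)"
          proof -
            have "t - (k - s) < length vs" using 3 n4 k lf unfolding n_def by linarith
            then show ?thesis using \<open>i * (k - 1) + t = _\<close> by (simp only: mod_add_self1 mod_less)
          qed
          moreover have "vs ! (t - (k - s)) = xs ! (t - (k - s))"
          proof -
            have "t - (k - s) < length xs" using 3 lf unfolding s_def by linarith
            then show ?thesis unfolding vs_def by (simp add: nth_append)
          qed
          moreover have "(y # es @ xs) ! t = xs ! (t - (k - s))"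
          proof -
            have "t = length (y # es) + (t - (k - s))" using 3 le by simp
            then show ?thesis by (metis append_Cons nth_append_length_plus)
          qed
          ultimately show ?thesis by simp
        qed
      qed
      then have "segment k vs (i * (k - 1)) = (!) (y # es @ xs) ` {..<k}"
        unfolding segment_image by (intro image_cong) auto
      also have "\<dots> = set (y # es @ xs)"
      proof -
        have "length (y # es @ xs) = k" using le by (simp add: s_def)
        then show ?thesis using nth_image[of k "y # es @ xs"] by (simp add: lessThan_atLeast0)
      qed
      also have "\<dots> = e" using es xs y by (auto simp: X_def)
      finally show ?thesis using e by simp
    qed
  qed
  \<comment> \<open>First and last edge share \<open>s\<close> vertices, so the last one runs
    \<open>r = s - 1\<close> places past position 0.\<close>
  have "length vs + (s - 1) = (q + 2) * (k - 1)"
  proof -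
    have "(q + 2) * (k - 1) = q * (k - 1) + (k - 1) + (k - 1)" by simp
    then show ?thesis using n s0 lf unfolding n_def[symmetric] by linarith
  qed
  then show ?thesis
    using loose_hamilton_cycleI[OF k dv sv _ _ \<open>4 \<le> q + 2\<close> segE, of "s - 1"] lf by fastforce
qed

section \<open>Connecting paths\<close>

text \<open>\<open>C\<close> is the interior of the connecting path. The ends \<open>x\<close> and
  \<open>y\<close> may lie outside \<open>R\<close> and inside the forbidden set \<open>Z\<close>,
  as they do when segments built elsewhere are joined; \<open>z\<close> is the budget for forbidden
  vertices.\<close>

definition connects :: "nat \<Rightarrow> 'a set \<Rightarrow> 'a set set \<Rightarrow> 'a set \<Rightarrow> nat \<Rightarrow> bool" where
  "connects k V E R z \<longleftrightarrow>
     (\<forall>x\<in>V. \<forall>y\<in>V. \<forall>Z. x \<noteq> y \<longrightarrow> finite Z \<longrightarrow> card Z \<le> z \<longrightarrow>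
        (\<exists>C. C \<subseteq> R \<and> C \<inter> Z = {} \<and> x \<notin> C \<and> y \<notin> C \<and> card C \<le> 3 * k \<and> lpath k E x (C \<union> {x, y}) y))"

lemma ex_subset_avoid:
  assumes "card Z + j \<le> card R" "finite Z" "finite R"
  shows "\<exists>A. A \<subseteq> R \<and> A \<inter> Z = {} \<and> card A = j"
proof -
  have "card R - card Z \<le> card (R - Z)" using assms by (simp add: diff_card_le_card_Diff)
  then have "j \<le> card (R - Z)" using assms by linarith
  then obtain A where "A \<subseteq> R - Z" "card A = j" by (meson obtain_subset_with_card_n)
  then show ?thesis by blast
qed

lemma neighbourhood_avoid:
  assumes kg: "k_graph k V E" and k: "k > 0"
    and T: "card T = k - 1" and deg: "card Z < card (neighbourhood V E T \<inter> R)" "finite Z"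
  shows "\<exists>v. v \<in> V \<and> v \<in> R \<and> v \<notin> Z \<and> v \<notin> T \<and> insert v T \<in> E \<and> card (insert v T) = k"
proof -
  have "\<not> neighbourhood V E T \<inter> R \<subseteq> Z" using deg card_mono[OF deg(2)] by (meson not_less)
  then obtain v where v: "v \<in> neighbourhood V E T" "v \<in> R" "v \<notin> Z" by blast
  then have 1: "v \<in> V" "insert v T \<in> E" by (auto simp: neighbourhood_def)
  then have 2: "card (insert v T) = k" using kg by (auto simp: k_graph_def)
  then have "v \<notin> T" using T k by (metis insert_absorb diff_less less_irrefl zero_less_one)
  then show ?thesis using v 1 2 by blast
qed

text \<open>Three edges: \<open>x\<close>, \<open>A\<close>, \<open>u\<close>; then
  \<open>u\<close>, \<open>D\<close>, \<open>c\<close>, \<open>w\<close>; then \<open>w\<close>,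
  \<open>B\<close>, \<open>y\<close>. In each of them \<open>k - 1\<close> vertices are fixed and
  the degree into \<open>R\<close> supplies the last one (\<open>u\<close>, \<open>c\<close> and
  \<open>w\<close>). Besides \<open>Z\<close>, fewer than \<open>4 * k\<close> vertices ever have to
  be avoided.\<close>

lemma connectsI:
  fixes V R :: "'a set"
  assumes k: "k \<ge> 3" and kg: "k_graph k V E" and R: "R \<subseteq> V" "t \<le> card R"
    and deg: "\<And>T. T \<subseteq> V \<Longrightarrow> card T = k - 1 \<Longrightarrow> t \<le> card (neighbourhood V E T \<inter> R)"
    and t: "z + 4 * k \<le> t"
  shows "connects k V E R z"
  unfolding connects_def
proof (intro ballI allI impI)
  fix x y :: 'a and Z :: "'a set"
  assume xy: "x \<in> V" "y \<in> V" "x \<noteq> y" and Z: "finite Z" "card Z \<le> z"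
  have finV: "finite V" using kg by (simp add: k_graph_def)
  then have finR: "finite R" using R finite_subset by blast
  have free: "\<exists>A. A \<subseteq> R \<and> A \<inter> (Z \<union> Y) = {} \<and> card A = j"
    if "card Y + j \<le> 4 * k" "finite Y" for Y j
    using that Z R t finR card_Un_le[of Z Y] by (intro ex_subset_avoid) auto
  have ext: "\<exists>v. v \<in> V \<and> v \<in> R \<and> v \<notin> Z \<and> v \<notin> Y \<and> v \<notin> T \<and> insert v T \<in> E \<and> card (insert v T) = k"
    if "card Y < 4 * k" "finite Y" "T \<subseteq> V" "card T = k - 1" for Y T
  proof -
    have "card (Z \<union> Y) < card (neighbourhood V E T \<inter> R)"
      using deg[OF that(3,4)] that(1) card_Un_le[of Z Y] Z(2) t by linarith
    moreover have "finite (Z \<union> Y)" using Z(1) that(2) by simp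
    moreover have "k > 0" using k by simp
    ultimately show ?thesis using neighbourhood_avoid[OF kg _ that(4)] by (metis UnCI)
  qed
  obtain A where A: "A \<subseteq> R" "A \<inter> (Z \<union> {x, y}) = {}" "card A = k - 2"
  proof -
    have "\<exists>A. A \<subseteq> R \<and> A \<inter> (Z \<union> {x, y}) = {} \<and> card A = k - 2"
      by (rule free) (use k card_insert_le_m1[of 2 "{y}" x] in simp_all)
    then show thesis using that by blast
  qed
  have fA: "finite A" using A finR finite_subset by blast
  have cT: "card (insert x A) = k - 1" using A fA k by simp
  obtain u where u: "u \<in> V" "u \<in> R" "u \<notin> Z" "u \<notin> {x, y}" "u \<notin> insert x A"
      "insert u (insert x A) \<in> E" "card (insert u (insert x A)) = k"
  proof -
    have "card {x, y} < 4 * k" using k card_insert_le_m1[of 2 "{y}" x] by simp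
    moreover have "insert x A \<subseteq> V" using A R xy by blast
    moreover have "finite {x, y}" by simp
    ultimately show thesis using ext[of "{x, y}" "insert x A"] cT that by blast
  qed
  have c1: "card ({x, y, u} \<union> A) \<le> k + 1" using card_Un_le[of "{x,y,u}" A] A k card_insert_le_m1[of 3 "{y,u}" x] card_insert_le_m1[of 2 "{u}" y] by simp
  obtain B where B: "B \<subseteq> R" "B \<inter> (Z \<union> ({x, y, u} \<union> A)) = {}" "card B = k - 2"
  proof -
    have "\<exists>B. B \<subseteq> R \<and> B \<inter> (Z \<union> ({x, y, u} \<union> A)) = {} \<and> card B = k - 2"
      by (rule free) (use c1 k fA in simp_all)
    then show thesis using that by blast
  qed
  have fB: "finite B" using B finR finite_subset by blast
  have cT: "card (insert y B) = k - 1" using B fB k by simp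
  obtain w where w: "w \<in> V" "w \<in> R" "w \<notin> Z" "w \<notin> {x, y, u} \<union> A" "w \<notin> insert y B"
      "insert w (insert y B) \<in> E" "card (insert w (insert y B)) = k"
  proof -
    have "card ({x, y, u} \<union> A) < 4 * k" using k c1 by linarith
    moreover have "finite ({x, y, u} \<union> A)" using fA by simp
    moreover have "insert y B \<subseteq> V" using B R xy by blast
    ultimately show thesis using ext[of "{x, y, u} \<union> A" "insert y B"] cT that by blast
  qed
  have c2: "card (insert w ({x, y, u} \<union> A \<union> B)) \<le> 2 * k"
    using card_insert_le_m1[of "2 * k" "{x, y, u} \<union> A \<union> B" w] card_Un_le[of "{x, y, u} \<union> A" B] c1 B k by simp
  \<comment> \<open>The middle edge already contains both joints \<open>u\<close> and
    \<open>w\<close> and still needs \<open>c\<close>, which leaves \<open>k - 3\<close> free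
    vertices.\<close>
  obtain D where D: "D \<subseteq> R" "D \<inter> (Z \<union> (insert w ({x, y, u} \<union> A \<union> B))) = {}" "card D = k - 3"
  proof -
    have "\<exists>D. D \<subseteq> R \<and> D \<inter> (Z \<union> (insert w ({x, y, u} \<union> A \<union> B))) = {} \<and> card D = k - 3"
      by (rule free) (use c2 k fA fB in simp_all)
    then show thesis using that by blast
  qed
  have fD: "finite D" using D finR finite_subset by blast
  have "u \<notin> insert w D" "w \<notin> D" using D(2) w(4) by auto
  then have cT: "card (insert u (insert w D)) = k - 1" using D(3) fD k by simp
  obtain c where c: "c \<in> V" "c \<in> R" "c \<notin> Z" "c \<notin> insert w ({x, y, u} \<union> A \<union> B)" "c \<notin> insert u (insert w D)"
      "insert c (insert u (insert w D)) \<in> E" "card (insert c (insert u (insert w D))) = k"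
  proof -
    have "card (insert w ({x, y, u} \<union> A \<union> B)) < 4 * k" using k c2 by linarith
    moreover have "finite (insert w ({x, y, u} \<union> A \<union> B))" using fA fB by simp
    moreover have "insert u (insert w D) \<subseteq> V" using D R u w by blast
    ultimately show thesis using ext[of "insert w ({x, y, u} \<union> A \<union> B)" "insert u (insert w D)"] cT that
      by blast
  qed
  define C where "C = insert u A \<union> insert c (insert w D) \<union> B"
  have l1: "lpath k E x (insert u (insert x A)) u"
    by (rule lpath_edge) (use u in auto)
  have l2: "lpath k E u (insert c (insert u (insert w D))) w"
    by (rule lpath_edge) (use c w in auto)
  have l3: "lpath k E w (insert w (insert y B)) y"
    by (rule lpath_edge) (use w in auto)
  have i1: "insert u (insert x A) \<inter> insert c (insert u (insert w D)) = {u}"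
    using A(2) u(4,5) w(4,5) D(2) c(4,5) by blast
  have l12: "lpath k E x (insert u (insert x A) \<union> insert c (insert u (insert w D))) w"
    by (rule lpath_trans[OF l2 l1 i1])
  have i2: "(insert u (insert x A) \<union> insert c (insert u (insert w D))) \<inter> insert w (insert y B) = {w}"
    using A(2) u(4,5) w(4,5) D(2) c(4,5) B(2) xy(3) by blast
  have "lpath k E x (insert u (insert x A) \<union> insert c (insert u (insert w D)) \<union> insert w (insert y B)) y"
    by (rule lpath_trans[OF l3 l12 i2])
  moreover have "insert u (insert x A) \<union> insert c (insert u (insert w D)) \<union> insert w (insert y B) = C \<union> {x, y}"
    unfolding C_def by blast
  ultimately have "lpath k E x (C \<union> {x, y}) y" by simp
  moreover have "C \<subseteq> R" unfolding C_def using A(1) B(1) D(1) u(2) w(2) c(2) by blast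
  moreover have "C \<inter> Z = {}" unfolding C_def using A(2) B(2) D(2) u(3) w(3) c(3) by blast
  moreover have "x \<notin> C"
  proof -
    have "x \<notin> A" "x \<notin> B" "x \<notin> D" using A(2) B(2) D(2) by auto
    moreover have "x \<noteq> u" "x \<noteq> w" "x \<noteq> c" using u(4) w(4) c(4) by auto
    ultimately show ?thesis unfolding C_def by simp
  qed
  moreover have "y \<notin> C"
  proof -
    have "y \<notin> A" "y \<notin> B" "y \<notin> D" using A(2) B(2) D(2) by auto
    moreover have "y \<noteq> u" "y \<noteq> w" "y \<noteq> c" using u(4) w(4) c(4) by auto
    ultimately show ?thesis unfolding C_def by simp
  qed
  moreover have "card C \<le> 3 * k"
  proof -
    have "card C \<le> card (insert u A) + card (insert c (insert w D)) + card B"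
      unfolding C_def by (meson card_Un_le add_le_mono order_refl order_trans)
    moreover have "card (insert u A) \<le> k - 1" using card_insert_le_m1[of "k - 1" A u] A k by simp
    moreover have "card (insert c (insert w D)) \<le> k - 1"
      using card_insert_le_m1[of "k - 1" "insert w D" c] card_insert_le_m1[of "k - 2" D w] D k by simp
    ultimately show ?thesis using B by linarith
  qed
  ultimately show "\<exists>C. C \<subseteq> R \<and> C \<inter> Z = {} \<and> x \<notin> C \<and> y \<notin> C \<and> card C \<le> 3 * k \<and> lpath k E x (C \<union> {x, y}) y"
    by blast
qed

text \<open>The connectors do not depend on the segments \<open>A i\<close>, only on their end vertices, so that a
  segment may later be replaced by a larger one with the same ends.\<close>

lemma join_segments:
  fixes x y :: "'i \<Rightarrow> 'a"
  assumes con: "connects k V E R z"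
    and js: "js \<noteq> []" "distinct js"
    and xy: "\<And>i. i \<in> set js \<Longrightarrow> x i \<in> V \<and> y i \<in> V \<and> x i \<in> Z \<and> y i \<in> Z"
    and ne: "\<And>i j. i \<in> set js \<Longrightarrow> j \<in> set js \<Longrightarrow> i \<noteq> j \<Longrightarrow> y i \<noteq> x j"
    and Z: "finite Z" "card Z + 3 * k * length js \<le> z" and R: "finite R"
  shows "\<exists>C. C \<subseteq> R \<and> C \<inter> Z = {} \<and> card C \<le> 3 * k * length js \<and>
    (\<forall>A. (\<forall>i\<in>set js. lpath k E (x i) (A i) (y i) \<and> A i \<inter> C = {}) \<longrightarrow>
         (\<forall>i\<in>set js. \<forall>j\<in>set js. i \<noteq> j \<longrightarrow> A i \<inter> A j = {}) \<longrightarrow>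
         lpath k E (x (hd js)) (C \<union> (\<Union>i\<in>set js. A i)) (y (last js)))"
  using js xy ne Z(2)
proof (induction js rule: rev_nonempty_induct)
  case (single i)
  show ?case by (rule exI[of _ "{}"]) simp
next
  case (snoc j js)
  have "\<exists>C. C \<subseteq> R \<and> C \<inter> Z = {} \<and> card C \<le> 3 * k * length js \<and>
    (\<forall>A. (\<forall>i\<in>set js. lpath k E (x i) (A i) (y i) \<and> A i \<inter> C = {}) \<longrightarrow>
         (\<forall>i\<in>set js. \<forall>j\<in>set js. i \<noteq> j \<longrightarrow> A i \<inter> A j = {}) \<longrightarrow>
         lpath k E (x (hd js)) (C \<union> (\<Union>i\<in>set js. A i)) (y (last js)))"
    by (rule snoc.IH) (use snoc.prems in auto)
  then obtain C where C: "C \<subseteq> R" "C \<inter> Z = {}" "card C \<le> 3 * k * length js"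
    and CA: "\<forall>A. (\<forall>i\<in>set js. lpath k E (x i) (A i) (y i) \<and> A i \<inter> C = {}) \<longrightarrow>
         (\<forall>i\<in>set js. \<forall>j\<in>set js. i \<noteq> j \<longrightarrow> A i \<inter> A j = {}) \<longrightarrow>
         lpath k E (x (hd js)) (C \<union> (\<Union>i\<in>set js. A i)) (y (last js))" by (elim exE conjE)
  have l: "last js \<in> set js" "j \<notin> set js" using snoc by auto
  have "finite C" using C R finite_subset by blast
  \<comment> \<open>Earlier connectors join the forbidden set. The interiors of the segments do not:
    that they avoid the connectors is demanded of \<open>A\<close> later.\<close>
  moreover have "card (Z \<union> C) \<le> z" using card_Un_le[of Z C] C(3) snoc.prems(4) by simp
  moreover have "y (last js) \<noteq> x j" using snoc.prems(3)[of "last js" j] l by auto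
  moreover have "y (last js) \<in> V" "x j \<in> V" using snoc.prems(2) l by auto
  ultimately obtain D where D: "D \<subseteq> R" "D \<inter> (Z \<union> C) = {}" "y (last js) \<notin> D" "x j \<notin> D" "card D \<le> 3 * k"
    "lpath k E (y (last js)) (D \<union> {y (last js), x j}) (x j)"
    using con Z(1) unfolding connects_def by (metis finite_UnI)
  show ?case
  proof (intro exI[of _ "C \<union> D"] conjI allI impI)
    show "C \<union> D \<subseteq> R" "(C \<union> D) \<inter> Z = {}" using C D by auto
    show "card (C \<union> D) \<le> 3 * k * length (js @ [j])" using card_Un_le[of C D] C(3) D(5) by simp
    fix A
    assume A1: "\<forall>i\<in>set (js @ [j]). lpath k E (x i) (A i) (y i) \<and> A i \<inter> (C \<union> D) = {}"
      and A2: "\<forall>i\<in>set (js @ [j]). \<forall>l\<in>set (js @ [j]). i \<noteq> l \<longrightarrow> A i \<inter> A l = {}"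
    define U where "U = (\<Union>i\<in>set js. A i)"
    have 1: "lpath k E (x (hd js)) (C \<union> U) (y (last js))"
      unfolding U_def by (rule CA[rule_format]) (use A1 A2 in auto)
    have e: "y (last js) \<in> A (last js)" "x j \<in> A j" using A1 l lpath_ends by fastforce+
    have yU: "y (last js) \<in> U" unfolding U_def using e l by blast
    have "A i \<inter> D = {}" if "i \<in> set js" for i using A1 that by auto
    moreover have "A i \<inter> A j = {}" if "i \<in> set js" for i using A2 that l by auto
    ultimately have UD: "U \<inter> D = {}" "U \<inter> A j = {}" unfolding U_def by blast+
    have jj: "A j \<inter> (C \<union> D) = {}" "lpath k E (x j) (A j) (y j)" using A1 by auto
    have "x j \<notin> C" using jj e by blast
    then have i1: "(C \<union> U) \<inter> (D \<union> {y (last js), x j}) = {y (last js)}"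
      using UD D(2) yU e by blast
    have 2: "lpath k E (x (hd js)) (C \<union> U \<union> (D \<union> {y (last js), x j})) (x j)"
      by (rule lpath_trans[OF D(6) 1 i1])
    have "y (last js) \<notin> A j" using yU UD by blast
    then have i2: "(C \<union> U \<union> (D \<union> {y (last js), x j})) \<inter> A j = {x j}"
      using UD jj(1) e by blast
    have 3: "lpath k E (x (hd js)) (C \<union> U \<union> (D \<union> {y (last js), x j}) \<union> A j) (y j)"
      by (rule lpath_trans[OF jj(2) 2 i2])
    have "C \<union> U \<union> (D \<union> {y (last js), x j}) \<union> A j = C \<union> D \<union> (\<Union>i\<in>set (js @ [j]). A i)"
      using yU e by (auto simp: U_def)
    then show "lpath k E (x (hd (js @ [j]))) (C \<union> D \<union> (\<Union>i\<in>set (js @ [j]). A i)) (y (last (js @ [j])))"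
      using 3 snoc(1) by simp
  qed
qed

section \<open>Random selection\<close>

text \<open>Independence in counting form: the expectation of a product of independent factors is
  the product of the expectations.\<close>

lemma sum_prod_PiE:
  fixes g :: "'b \<Rightarrow> real"
  assumes "finite I" "finite B"
  shows "(\<Sum>c \<in> PiE I (\<lambda>_. B). \<Prod>i\<in>I. g (c i)) = (\<Sum>b\<in>B. g b) ^ card I"
  using assms(1)
proof (induction I rule: finite_induct)
  case empty
  then show ?case by simp
next
  case (insert i I)
  have "(\<Sum>c \<in> PiE (insert i I) (\<lambda>_. B). \<Prod>j\<in>insert i I. g (c j)) =
    (\<Sum>(y, c) \<in> B \<times> PiE I (\<lambda>_. B). \<Prod>j\<in>insert i I. g ((c(i := y)) j))"
    unfolding PiE_insert_eq
    by (subst sum.reindex) (use insert in \<open>auto intro!: inj_combinator simp: case_prod_beta\<close>)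
  also have "\<dots> = (\<Sum>(y, c) \<in> B \<times> PiE I (\<lambda>_. B). g y * (\<Prod>j\<in>I. g (c j)))"
  proof (rule sum.cong[OF refl], clarify)
    fix y c
    have "(\<Prod>j\<in>I. g ((c(i := y)) j)) = (\<Prod>j\<in>I. g (c j))"
      by (rule prod.cong) (use insert in auto)
    then show "(\<Prod>j\<in>insert i I. g ((c(i := y)) j)) = g y * (\<Prod>j\<in>I. g (c j))" using insert by simp
  qed
  also have "\<dots> = (\<Sum>y\<in>B. g y) * (\<Sum>c \<in> PiE I (\<lambda>_. B). \<Prod>j\<in>I. g (c j))"
    by (simp add: sum_product sum.cartesian_product)
  finally show ?case using insert by simp
qed

lemma card_PiE_fix2:
  assumes "i < N" "j < N" "i \<noteq> j" "a \<in> B" "b \<in> B"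
  shows "card {c \<in> PiE {..<N} (\<lambda>_. B). c i = a \<and> c j = b} = card B ^ (N - 2)"
proof -
  have "{c \<in> PiE {..<N} (\<lambda>_. B). c i = a \<and> c j = b} =
      PiE {..<N} (\<lambda>l. if l = i then {a} else if l = j then {b} else B)"
    using assms by (fastforce simp: PiE_iff split: if_splits)
  also have "card \<dots> = (\<Prod>l<N. card (if l = i then {a} else if l = j then {b} else B))"
    by (rule card_PiE) simp
  also have "\<dots> = (\<Prod>l\<in>{..<N} - {i, j}. card B)"
    by (rule prod.mono_neutral_cong_right) auto
  also have "\<dots> = card B ^ (N - 2)" using assms by (simp add: card_Diff_subset numeral_2_eq_2)
  finally show ?thesis .
qed

text \<open>A lower-tail Chernoff bound in counting form. Weight each hit of \<open>A\<close> by
  1/2. All choices together weigh at most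
  \<open>card \<Omega> ^ N * exp (- (\<gamma> * N / 2))\<close>, whereas a bad choice weighs at
  least \<open>exp (- (\<gamma> * N / 4))\<close>, since \<open>exp (-1) \<le> 1/2\<close>.\<close>

lemma card_few_hits:
  fixes \<gamma> :: real
  assumes fin: "finite \<Omega>" and A: "A \<subseteq> \<Omega>" "real (card A) \<ge> \<gamma> * card \<Omega>"
  shows "real (card {c \<in> PiE {..<N} (\<lambda>_. \<Omega>). real (card {i. i < N \<and> c i \<in> A}) < \<gamma> * N / 4})
    \<le> real (card \<Omega>) ^ N * exp (- (\<gamma> * N / 4))"
proof -
  define w where "w = real (card \<Omega>)"
  let ?P = "PiE {..<N} (\<lambda>_. \<Omega>)"
  let ?B = "{c \<in> ?P. real (card {i. i < N \<and> c i \<in> A}) < \<gamma> * N / 4}"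
  define g :: "'a \<Rightarrow> real" where "g a = (if a \<in> A then 1/2 else 1)" for a
  have finP: "finite ?P" using fin by (simp add: finite_PiE)
  have "(\<Sum>a\<in>\<Omega>. g a) = w - card A / 2"
  proof -
    have "(\<Sum>a\<in>\<Omega>. g a) = (\<Sum>a\<in>\<Omega>. 1 - (if a \<in> A then 1/2 else 0))"
      by (rule sum.cong) (auto simp: g_def)
    also have "\<dots> = w - (\<Sum>a\<in>\<Omega>. if a \<in> A then 1/2 else 0)" by (simp add: sum_subtractf w_def)
    also have "(\<Sum>a\<in>\<Omega>. if a \<in> A then 1/2 else 0) = (\<Sum>a\<in>A. 1/2 :: real)"
      using A fin by (simp add: sum.If_cases Int_absorb1)
    finally show ?thesis by simp
  qed
  also have "\<dots> \<le> w * exp (- (\<gamma> / 2))"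
  proof -
    have "w * (1 - \<gamma> / 2) \<le> w * exp (- (\<gamma> / 2))"
      using exp_ge_add_one_self[of "- (\<gamma> / 2)"] by (intro mult_left_mono) (auto simp: w_def)
    then show ?thesis using A by (simp add: w_def algebra_simps)
  qed
  finally have gs: "(\<Sum>a\<in>\<Omega>. g a) \<le> w * exp (- (\<gamma> / 2))" .
  have "exp (- (\<gamma> * N / 4)) \<le> (\<Prod>i<N. g (c i))" if "c \<in> ?B" for c
  proof -
    have "exp (- (\<gamma> * N / 4)) \<le> exp (- real (card {i. i < N \<and> c i \<in> A}))" using that by simp
    also have "\<dots> = exp (-1) ^ card {i. i < N \<and> c i \<in> A}"
      by (simp flip: exp_of_nat_mult)
    also have "\<dots> \<le> (1/2) ^ card {i. i < N \<and> c i \<in> A}"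
    proof (rule power_mono)
      have "exp (1::real) \<ge> 2" using exp_ge_add_one_self[of 1] by simp
      then show "exp (-1) \<le> (1/2 :: real)" by (simp add: exp_minus field_simps)
    qed simp
    also have "\<dots> = (\<Prod>i\<in>{i. i < N \<and> c i \<in> A}. 1/2)" by simp
    also have "\<dots> = (\<Prod>i<N. g (c i))"
      unfolding g_def by (rule prod.mono_neutral_cong_left) auto
    finally show ?thesis .
  qed
  then have "real (card ?B) * exp (- (\<gamma> * N / 4)) \<le> (\<Sum>c\<in>?B. \<Prod>i<N. g (c i))"
    by (rule sum_bounded_below)
  also have "\<dots> \<le> (\<Sum>c\<in>?P. \<Prod>i<N. g (c i))"
  proof (rule sum_mono2)
    fix c show "0 \<le> (\<Prod>i<N. g (c i))" by (rule prod_nonneg) (simp add: g_def)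
  qed (use finP in auto)
  also have "\<dots> = (\<Sum>a\<in>\<Omega>. g a) ^ N" using sum_prod_PiE[of "{..<N}" \<Omega> g] fin by simp
  also have "\<dots> \<le> (w * exp (- (\<gamma> / 2))) ^ N"
    by (rule power_mono[OF gs]) (auto intro!: sum_nonneg simp: g_def)
  also have "\<dots> = w ^ N * exp (- (\<gamma> * N / 4)) * exp (- (\<gamma> * N / 4))"
    by (simp add: power_mult_distrib flip: exp_of_nat_mult exp_add) 
  finally show ?thesis by (simp add: w_def)
qed

text \<open>Choose \<open>N\<close> elements of \<open>\<Omega>\<close> independently at random and delete those in conflict with another
  one.\<close>

lemma random_selection:
  fixes \<gamma> \<delta> :: real and K :: "('b \<times> 'b) set"
  assumes fin: "finite \<Omega>" "\<Omega> \<noteq> {}" and fA: "finite \<A>"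
    and A: "\<And>A. A \<in> \<A> \<Longrightarrow> A \<subseteq> \<Omega> \<and> real (card A) \<ge> \<gamma> * card \<Omega>" and \<gamma>: "\<gamma> > 0"
    and K: "K \<subseteq> \<Omega> \<times> \<Omega>" "Id_on \<Omega> \<subseteq> K" "sym K" "real (card K) \<le> \<delta> * (real (card \<Omega>))\<^sup>2"
    and N: "real N * \<delta> \<le> \<gamma> / 32" "real (card \<A>) * exp (- (\<gamma> * N / 4)) < 1/2" "N > 0"
  shows "\<exists>F. F \<subseteq> \<Omega> \<and> card F \<le> N \<and> (\<forall>a\<in>F. \<forall>b\<in>F. a \<noteq> b \<longrightarrow> (a, b) \<notin> K) \<and>
    (\<forall>A\<in>\<A>. real (card (F \<inter> A)) \<ge> \<gamma> * N / 8)"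
proof -
  define w where "w = real (card \<Omega>)"
  define P where "P = PiE {..<N} (\<lambda>_. \<Omega>)"
  \<comment> \<open>\<open>B1 A\<close> has too few hits of \<open>A\<close>, \<open>B2\<close> too
    many conflicts. Together the \<open>B1 A\<close> have probability below 1/2. The expected number
    of conflicts is at most \<open>N * N * \<delta> \<le> \<gamma> * N / 32\<close>, so by Markov's
    inequality \<open>B2\<close> has probability at most 1/4. Any other choice keeps
    \<open>\<gamma> * N / 4 - \<gamma> * N / 8\<close> hits after deletion.\<close>
  define B1 where "B1 A = {c \<in> P. real (card {i. i < N \<and> c i \<in> A}) < \<gamma> * N / 4}" for A
  define coll where "coll c = {(i, j). i < N \<and> j < N \<and> i \<noteq> j \<and> (c i, c j) \<in> K}" for c
  define B2 where "B2 = {c \<in> P. real (card (coll c)) > \<gamma> * N / 8}"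
  have w0: "w > 0" using fin by (simp add: w_def card_gt_0_iff)
  have finP: "finite P" using fin by (simp add: P_def finite_PiE)
  have cP: "real (card P) = w ^ N" using fin by (simp add: P_def w_def card_PiE)
  have finc: "finite (coll c)" for c
    by (rule finite_subset[of _ "{..<N} \<times> {..<N}"]) (auto simp: coll_def)
  have finK: "finite K" using K fin finite_subset by blast
  have "real (card (\<Union>A\<in>\<A>. B1 A)) \<le> (\<Sum>A\<in>\<A>. real (card (B1 A)))"
    using card_UN_le[OF fA, of B1] by (metis of_nat_le_iff of_nat_sum)
  also have "\<dots> \<le> (\<Sum>A\<in>\<A>. w ^ N * exp (- (\<gamma> * N / 4)))"
    unfolding B1_def P_def w_def using A fin by (intro sum_mono card_few_hits) auto
  also have "\<dots> = w ^ N * (real (card \<A>) * exp (- (\<gamma> * N / 4)))" by simp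
  also have "\<dots> < w ^ N * (1/2)" using N w0 by (intro mult_strict_left_mono) auto
  finally have b1: "real (card (\<Union>A\<in>\<A>. B1 A)) < w ^ N * (1/2)" .
  \<comment> \<open>Two different coordinates are jointly uniform on pairs, so they conflict with
    probability at most \<delta>.\<close>
  have pair: "real (card {c \<in> P. (c i, c j) \<in> K}) \<le> \<delta> * w ^ N" if ij: "i < N" "j < N" "i \<noteq> j" for i j
  proof -
    have N2: "N \<ge> 2" using ij by linarith
    have "{c \<in> P. (c i, c j) \<in> K} = (\<Union>(a, b)\<in>K. {c \<in> P. c i = a \<and> c j = b})" by auto
    then have "real (card {c \<in> P. (c i, c j) \<in> K}) \<le> real (\<Sum>(a, b)\<in>K. card {c \<in> P. c i = a \<and> c j = b})"
      using card_UN_le[OF finK, of "\<lambda>(a, b). {c \<in> P. c i = a \<and> c j = b}"]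
      by (simp add: case_prod_beta flip: of_nat_sum)
    also have "(\<Sum>(a, b)\<in>K. card {c \<in> P. c i = a \<and> c j = b}) = (\<Sum>(a, b)\<in>K. card \<Omega> ^ (N - 2))"
    proof (rule sum.cong[OF refl], clarify)
      fix a b assume "(a, b) \<in> K"
      then have "a \<in> \<Omega>" "b \<in> \<Omega>" using K(1) by auto
      then show "card {c \<in> P. c i = a \<and> c j = b} = card \<Omega> ^ (N - 2)"
        using card_PiE_fix2[OF ij, of a \<Omega> b] unfolding P_def by simp
    qed
    also have "real \<dots> = real (card K) * w ^ (N - 2)" by (simp add: w_def)
    also have "\<dots> \<le> (\<delta> * w\<^sup>2) * w ^ (N - 2)" using K w0 by (intro mult_right_mono) (auto simp: w_def)
    also have "\<dots> = \<delta> * w ^ N"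
    proof -
      have "w\<^sup>2 * w ^ (N - 2) = w ^ N" using N2 by (metis le_add_diff_inverse power_add)
      then show ?thesis by (simp add: mult.assoc)
    qed
    finally show ?thesis .
  qed
  have d0: "\<delta> \<ge> 0"
  proof (rule ccontr)
    assume "\<not> \<delta> \<ge> 0"
    then have "\<delta> * w\<^sup>2 < 0" using w0 by (simp add: mult_neg_pos)
    then show False using K(4) by (simp add: w_def)
  qed
  have "real (card B2) * (\<gamma> * N / 8) \<le> (\<Sum>c\<in>B2. real (card (coll c)))"
    by (rule sum_bounded_below) (auto simp: B2_def)
  also have "\<dots> \<le> (\<Sum>c\<in>P. real (card (coll c)))"
    by (rule sum_mono2) (use finP in \<open>auto simp: B2_def\<close>)
  also have "\<dots> = (\<Sum>c\<in>P. \<Sum>p\<in>{(i, j). i < N \<and> j < N \<and> i \<noteq> j}. if (c (fst p), c (snd p)) \<in> K then 1 else 0)"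
  proof (rule sum.cong[OF refl])
    fix c
    have f: "finite {(i, j). i < N \<and> j < N \<and> i \<noteq> j}"
      by (rule finite_subset[of _ "{..<N} \<times> {..<N}"]) auto
    have "coll c = {(i, j). i < N \<and> j < N \<and> i \<noteq> j} \<inter> {p. (c (fst p), c (snd p)) \<in> K}"
      by (auto simp: coll_def)
    then show "real (card (coll c)) = (\<Sum>p\<in>{(i, j). i < N \<and> j < N \<and> i \<noteq> j}. if (c (fst p), c (snd p)) \<in> K then 1 else 0)"
      using f by (simp add: sum.If_cases)
  qed
  also have "\<dots> = (\<Sum>p\<in>{(i, j). i < N \<and> j < N \<and> i \<noteq> j}. real (card {c \<in> P. (c (fst p), c (snd p)) \<in> K}))"
    by (subst sum.swap) (use finP in \<open>simp add: sum.If_cases Int_def\<close>)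
  also have "\<dots> \<le> real (card {(i, j). i < N \<and> j < N \<and> i \<noteq> j}) * (\<delta> * w ^ N)"
    by (rule sum_bounded_above) (use pair in auto)
  also have "\<dots> \<le> real (N * N) * (\<delta> * w ^ N)"
  proof (rule mult_right_mono)
    have "card {(i, j). i < N \<and> j < N \<and> i \<noteq> j} \<le> card ({..<N} \<times> {..<N})" by (rule card_mono) auto
    then show "real (card {(i, j). i < N \<and> j < N \<and> i \<noteq> j}) \<le> real (N * N)"
      by (simp flip: of_nat_mult)
  qed (use w0 d0 in auto)
  also have "\<dots> = (real N * \<delta>) * (real N * w ^ N)" by simp
  also have "\<dots> \<le> (\<gamma> / 32) * (real N * w ^ N)" using N(1) w0 by (intro mult_right_mono) auto
  finally have "real (card B2) * (\<gamma> * N / 8) \<le> (w ^ N / 4) * (\<gamma> * N / 8)" by (simp add: algebra_simps)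
  then have b2: "real (card B2) \<le> w ^ N / 4" using \<gamma> N(3) by (simp add: mult_le_cancel_right)
  have "\<not> P \<subseteq> (\<Union>A\<in>\<A>. B1 A) \<union> B2"
  proof
    assume a: "P \<subseteq> (\<Union>A\<in>\<A>. B1 A) \<union> B2"
    have "finite ((\<Union>A\<in>\<A>. B1 A) \<union> B2)" using finP fA by (auto simp: B1_def B2_def)
    then have "card P \<le> card (\<Union>A\<in>\<A>. B1 A) + card B2"
      using card_mono[OF _ a] card_Un_le[of "\<Union>A\<in>\<A>. B1 A" B2] by linarith
    then have "w ^ N \<le> real (card (\<Union>A\<in>\<A>. B1 A)) + real (card B2)" using cP by linarith
    moreover have "w ^ N > 0" using w0 by simp
    ultimately show False using b1 b2 by linarith
  qed
  then obtain c where c: "c \<in> P" "\<And>A. A \<in> \<A> \<Longrightarrow> c \<notin> B1 A" "c \<notin> B2" by blast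
  \<comment> \<open>As \<open>Id_on \<Omega>\<close> lies in \<open>K\<close>, repeated choices
    count as conflicts; hence \<open>c\<close> is injective on \<open>G\<close> and hits can be
    counted as elements.\<close>
  define G where "G = {..<N} - fst ` coll c"
  have G: "(c i, c j) \<notin> K" if "i \<in> G" "j \<in> G" "i \<noteq> j" for i j
    using that unfolding G_def coll_def by force
  have cO: "c i \<in> \<Omega>" if "i < N" for i using c(1) that by (auto simp: P_def)
  have inj: "inj_on c G"
  proof (rule inj_onI, rule ccontr)
    fix i j assume ij: "i \<in> G" "j \<in> G" "c i = c j" "i \<noteq> j"
    then have "(c i, c j) \<in> K" using cO[of i] K(2) by (auto simp: G_def)
    then show False using G ij by blast
  qed
  have fc: "card (fst ` coll c) \<le> \<gamma> * N / 8"
    using c(1,3) card_image_le[OF finc, of fst c] by (simp add: B2_def not_less)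
  show ?thesis
  proof (intro exI[of _ "c ` G"] conjI ballI impI)
    show "c ` G \<subseteq> \<Omega>" using cO by (auto simp: G_def)
    have "card (c ` G) \<le> card {..<N}"
      using card_image_le[of G c] card_mono[of "{..<N}" G] by (fastforce simp: G_def)
    then show "card (c ` G) \<le> N" by simp
    fix a b assume "a \<in> c ` G" "b \<in> c ` G" "a \<noteq> b"
    then show "(a, b) \<notin> K" using G by fastforce
  next
    fix A assume "A \<in> \<A>"
    then have "real (card {i. i < N \<and> c i \<in> A}) \<ge> \<gamma> * N / 4" using c by (force simp: B1_def)
    moreover have "card {i. i < N \<and> c i \<in> A} \<le> card {i \<in> G. c i \<in> A} + card (fst ` coll c)"
    proof -
      have "{i. i < N \<and> c i \<in> A} \<subseteq> {i \<in> G. c i \<in> A} \<union> fst ` coll c" by (auto simp: G_def)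
      moreover have "finite ({i \<in> G. c i \<in> A} \<union> fst ` coll c)" using finc by (auto simp: G_def)
      ultimately have "card {i. i < N \<and> c i \<in> A} \<le> card ({i \<in> G. c i \<in> A} \<union> fst ` coll c)"
        by (intro card_mono)
      also have "\<dots> \<le> card {i \<in> G. c i \<in> A} + card (fst ` coll c)" by (rule card_Un_le)
      finally show ?thesis .
    qed
    moreover have "card {i \<in> G. c i \<in> A} = card (c ` G \<inter> A)"
    proof -
      have "c ` G \<inter> A = c ` {i \<in> G. c i \<in> A}" by auto
      moreover have "inj_on c {i \<in> G. c i \<in> A}" using inj by (rule inj_on_subset) auto
      ultimately show ?thesis by (simp add: card_image)
    qed
    ultimately show "\<gamma> * N / 8 \<le> real (card (c ` G \<inter> A))" using fc by linarith
  qed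
qed

section \<open>Absorbers\<close>

lemma card_lists_containing:
  assumes "finite V"
  shows "card {xs. set xs \<subseteq> V \<and> length xs = m \<and> v \<in> set xs} \<le> m * card V ^ (m - 1)"
proof (induction m)
  case 0
  then show ?case by simp
next
  case (Suc m)
  let ?L = "{xs. set xs \<subseteq> V \<and> length xs = m}"
  let ?C = "{xs. set xs \<subseteq> V \<and> length xs = m \<and> v \<in> set xs}"
  have f: "finite ?L" "finite ?C" using finite_lists_length_eq[OF assms, of m] by (auto elim: finite_subset[rotated])
  have "{xs. set xs \<subseteq> V \<and> length xs = Suc m \<and> v \<in> set xs} \<subseteq>
      (\<lambda>xs. v # xs) ` ?L \<union> (\<lambda>(a, xs). a # xs) ` (V \<times> ?C)"
  proof
    fix ys assume "ys \<in> {xs. set xs \<subseteq> V \<and> length xs = Suc m \<and> v \<in> set xs}"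
    then show "ys \<in> (\<lambda>xs. v # xs) ` ?L \<union> (\<lambda>(a, xs). a # xs) ` (V \<times> ?C)"
      by (cases ys) auto
  qed
  then have "card {xs. set xs \<subseteq> V \<and> length xs = Suc m \<and> v \<in> set xs} \<le>
      card ((\<lambda>xs. v # xs) ` ?L \<union> (\<lambda>(a, xs). a # xs) ` (V \<times> ?C))"
    using f assms by (intro card_mono) auto
  also have "\<dots> \<le> card ((\<lambda>xs. v # xs) ` ?L) + card ((\<lambda>(a, xs). a # xs) ` (V \<times> ?C))"
    by (rule card_Un_le)
  also have "\<dots> \<le> card ?L + card (V \<times> ?C)"
    using f assms by (intro add_mono card_image_le) auto
  also have "\<dots> \<le> card V ^ m + card V * (m * card V ^ (m - 1))"
    using Suc by (simp add: card_lists_length_eq[OF assms] card_cartesian_product)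
  also have "card V * (m * card V ^ (m - 1)) = m * card V ^ m" by (cases m) (auto simp: algebra_simps)
  finally show ?case by simp
qed

text \<open>\<open>C xs\<close> holds the values allowed after the choices \<open>xs\<close>. The
  newest choice is put in front, so \<open>last\<close> returns the earliest one.\<close>

primrec choices :: "('a list \<Rightarrow> 'a set) \<Rightarrow> nat \<Rightarrow> 'a list set" where
  "choices C 0 = {[]}"
| "choices C (Suc m) = (\<lambda>(xs, x). x # xs) ` (SIGMA xs:choices C m. C xs)"

lemma card_choices:
  fixes c :: real
  assumes "\<And>i xs. i < m \<Longrightarrow> xs \<in> choices C i \<Longrightarrow> finite (C xs) \<and> c \<le> card (C xs)" and "c \<ge> 0"
  shows "finite (choices C m) \<and> c ^ m \<le> card (choices C m)"
  using assms(1)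
proof (induction m)
  case 0
  then show ?case by simp
next
  case (Suc m)
  have "finite (choices C m) \<and> c ^ m \<le> card (choices C m)"
    by (rule Suc.IH) (use Suc.prems less_SucI in blast)
  then have IH: "finite (choices C m)" "c ^ m \<le> card (choices C m)" by auto
  have C: "finite (C xs)" "c \<le> card (C xs)" if "xs \<in> choices C m" for xs using Suc.prems that by blast+
  have inj: "inj_on (\<lambda>(xs, x). x # xs) (SIGMA xs:choices C m. C xs)" by (auto intro!: inj_onI)
  have "c ^ Suc m \<le> c * card (choices C m)" using IH assms(2) by (simp add: mult_left_mono)
  also have "\<dots> = (\<Sum>xs\<in>choices C m. c)" by simp
  also have "\<dots> \<le> (\<Sum>xs\<in>choices C m. real (card (C xs)))" using C by (intro sum_mono) auto
  also have "\<dots> = card (SIGMA xs:choices C m. C xs)" using IH C by simp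
  also have "\<dots> = card (choices C (Suc m))" using card_image[OF inj] by simp
  finally show ?case using IH C by auto
qed

text \<open>The side condition sits on the last entry because \<open>choices\<close> picks that
  entry before all others. With \<open>B\<close> the neighbourhood of \<open>insert b S\<close>,
  this entry becomes the vertex \<open>last T\<close> of an absorber.\<close>

definition link_lists :: "nat \<Rightarrow> 'a set \<Rightarrow> 'a set set \<Rightarrow> 'a \<Rightarrow> 'a set \<Rightarrow> 'a set \<Rightarrow> 'a list set" where
  "link_lists k V E u X B = {xs. length xs = k - 1 \<and> distinct xs \<and> set xs \<subseteq> V \<and> u \<notin> set xs \<and>
     set xs \<inter> X = {} \<and> last xs \<in> B \<and> insert u (set xs) \<in> E}"

lemma card_diff_ge:
  fixes D :: real
  assumes "D \<le> card B" "finite X" "card X \<le> m" "real m \<le> D / 2"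
  shows "D / 2 \<le> card (B - X)"
proof -
  have "card B - card X \<le> card (B - X)" by (rule diff_card_le_card_Diff[OF assms(2)])
  then show ?thesis using assms by linarith
qed

text \<open>The entries are chosen one at a time: the earliest from \<open>B\<close>, the next
  \<open>k - 3\<close> from \<open>V\<close>, the final one from the neighbourhood of the
  \<open>k - 1\<close> vertices present. Each pool has at least \<open>D\<close> elements and loses
  at most \<open>4 * k \<le> D / 2\<close> of them to \<open>X\<close>, \<open>u\<close> and earlier
  choices.\<close>

lemma card_link_lists:
  fixes D :: real
  assumes k: "k \<ge> 3" and kg: "k_graph k V E"
    and deg: "\<And>T. T \<subseteq> V \<Longrightarrow> card T = k - 1 \<Longrightarrow> D \<le> card (neighbourhood V E T)"
    and D: "8 * real k \<le> D" "D \<le> card V" and u: "u \<in> V" and X: "finite X" "card X \<le> 2 * k"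
    and B: "B \<subseteq> V" "D \<le> card B"
  shows "finite (link_lists k V E u X B)" "(D / 2) ^ (k - 1) \<le> card (link_lists k V E u X B)"
proof -
  have finV: "finite V" using kg by (simp add: k_graph_def)
  have "link_lists k V E u X B \<subseteq> {xs. set xs \<subseteq> V \<and> length xs = k - 1}"
    by (auto simp: link_lists_def)
  then show fin: "finite (link_lists k V E u X B)"
    using finite_lists_length_eq[OF finV, of "k - 1"] finite_subset by blast
  define C where "C xs = (if xs = [] then B else if length xs < k - 2 then V
      else neighbourhood V E (insert u (set xs))) - (insert u (set xs) \<union> X)" for xs
  have inv: "length xs = i \<and> distinct xs \<and> set xs \<subseteq> V \<and> u \<notin> set xs \<and> set xs \<inter> X = {} \<and>
      (xs \<noteq> [] \<longrightarrow> last xs \<in> B) \<and> (i = k - 1 \<longrightarrow> insert u (set xs) \<in> E)"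
    if "i \<le> k - 1" "xs \<in> choices C i" for i xs
    using that
  proof (induction i arbitrary: xs)
    case 0
    then show ?case using k by auto
  next
    case (Suc i)
    then obtain ys y where xs: "xs = y # ys" "ys \<in> choices C i" "y \<in> C ys" by auto
    have IH: "length ys = i" "distinct ys" "set ys \<subseteq> V" "u \<notin> set ys" "set ys \<inter> X = {}"
      "ys \<noteq> [] \<longrightarrow> last ys \<in> B" using Suc.IH[OF _ xs(2)] Suc.prems(1) by auto
    have y: "y \<in> V" "y \<notin> insert u (set ys)" "y \<notin> X" "ys = [] \<Longrightarrow> y \<in> B"
      using xs(3) B by (auto simp: C_def neighbourhood_def split: if_splits)
    have "insert u (set xs) \<in> E" if "Suc i = k - 1"
    proof -
      have "ys \<noteq> []" "\<not> length ys < k - 2" using that IH(1) k by auto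
      then show ?thesis using xs(1,3) by (auto simp: C_def neighbourhood_def insert_commute)
    qed
    then show ?case using IH y xs(1) by auto
  qed
  have "finite (choices C (k - 1)) \<and> (D / 2) ^ (k - 1) \<le> card (choices C (k - 1))"
  proof (rule card_choices)
    fix i xs assume i: "i < k - 1" "xs \<in> choices C i"
    have I: "length xs = i" "distinct xs" "set xs \<subseteq> V" "u \<notin> set xs" using inv[OF _ i(2)] i(1) by auto
    let ?Y = "if xs = [] then B else if length xs < k - 2 then V else neighbourhood V E (insert u (set xs))"
    have "D \<le> card ?Y"
    proof -
      have "D \<le> card (neighbourhood V E (insert u (set xs)))" if "\<not> length xs < k - 2" "xs \<noteq> []"
      proof (rule deg)
        show "insert u (set xs) \<subseteq> V" using I u by auto
        have "card (insert u (set xs)) = Suc i" using I distinct_card[of xs] by simp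
        then show "card (insert u (set xs)) = k - 1" using that I i by simp
      qed
      then show ?thesis using B D by auto
    qed
    moreover have "card (insert u (set xs) \<union> X) \<le> 4 * k"
    proof -
      have "card (insert u (set xs)) \<le> k"
        by (rule card_insert_le_m1) (use k card_length[of xs] I(1) i(1) in auto)
      then show ?thesis using card_Un_le[of "insert u (set xs)" X] X(2) by linarith
    qed
    ultimately have "D / 2 \<le> card (?Y - (insert u (set xs) \<union> X))"
      using D X by (intro card_diff_ge[where m = "4 * k"]) auto
    moreover have "C xs \<subseteq> V" using B unfolding C_def neighbourhood_def by auto
    moreover have "finite (C xs)" using \<open>C xs \<subseteq> V\<close> finV by (rule finite_subset)
    ultimately show "finite (C xs) \<and> D / 2 \<le> card (C xs)" by (simp only: C_def)
  qed (use D in simp)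
  moreover have "choices C (k - 1) \<subseteq> link_lists k V E u X B"
  proof
    fix xs assume "xs \<in> choices C (k - 1)"
    then show "xs \<in> link_lists k V E u X B" using inv[of "k - 1" xs] k by (auto simp: link_lists_def)
  qed
  then have "card (choices C (k - 1)) \<le> card (link_lists k V E u X B)" using fin by (rule card_mono[rotated])
  ultimately show "(D / 2) ^ (k - 1) \<le> card (link_lists k V E u X B)" by linarith
qed

text \<open>An absorber for \<open>insert s S\<close> consists of two disjoint edges \<open>insert v (set R)\<close> and
  \<open>insert b (set T)\<close>. To absorb, \<open>s\<close> takes the place of \<open>v\<close> in the first edge, and the second edge
  is replaced by the path formed by \<open>insert (last T) (insert b S)\<close> and \<open>insert v (set T)\<close>.\<close>

definition absorber :: "nat \<Rightarrow> 'a set \<Rightarrow> 'a set set \<Rightarrow> 'a \<Rightarrow> 'a set \<Rightarrow> 'a list \<Rightarrow> 'a \<Rightarrow> 'a \<Rightarrow> 'a list \<Rightarrow> bool" where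
  "absorber k V E s S R v b T \<longleftrightarrow>
     length R = k - 1 \<and> length T = k - 1 \<and> distinct (R @ v # b # T) \<and> set (R @ v # b # T) \<subseteq> V \<and>
     insert v (set R) \<in> E \<and> insert s (set R) \<in> E \<and> insert b (set T) \<in> E \<and> insert v (set T) \<in> E \<and>
     insert (last T) (insert b S) \<in> E"

text \<open>Convexity: the ordered pairs number the sum of \<open>g * (g - 1)\<close> over the
  degrees \<open>g\<close> of the elements of \<open>I\<close>. For the average
  \<open>a = card G / N\<close> this is at least \<open>a * card G - card G\<close>, and
  \<open>a \<ge> 2\<close> leaves half of the main term.\<close>

lemma card_pairs_common:
  fixes G :: "('b \<times> 'c) set"
  assumes "finite I" "finite Y" "G \<subseteq> Y \<times> I" "real (card I) \<le> N" "N > 0" "2 * N \<le> card G"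
  shows "real (card G) ^ 2 / (2 * N) \<le> card {(v, b, t). (v, t) \<in> G \<and> (b, t) \<in> G \<and> v \<noteq> b}"
proof -
  define Gt where "Gt t = {v. (v, t) \<in> G}" for t
  define a where "a = real (card G) / N"
  have finGt: "finite (Gt t)" for t
    by (rule finite_subset[of _ Y]) (use assms in \<open>auto simp: Gt_def\<close>)
  have cG: "real (card G) = (\<Sum>t\<in>I. real (card (Gt t)))"
  proof -
    have "G = (\<lambda>(t, v). (v, t)) ` (SIGMA t:I. Gt t)" using assms(3) by (auto simp: Gt_def image_iff)
    moreover have "inj_on (\<lambda>(t, v). (v, t)) (SIGMA t:I. Gt t)" by (auto intro: inj_onI)
    ultimately have "card G = card (SIGMA t:I. Gt t)" by (metis card_image)
    then show ?thesis using assms(1) finGt by simp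
  qed
  have eq: "{(v, b, t). (v, t) \<in> G \<and> (b, t) \<in> G \<and> v \<noteq> b} =
      (\<lambda>(t, v, b). (v, b, t)) ` (SIGMA t:I. SIGMA v:Gt t. Gt t - {v})"
    using assms(3) by (auto simp: Gt_def image_iff)
  have inj: "inj_on (\<lambda>(t, v, b). (v, b, t)) (SIGMA t:I. SIGMA v:Gt t. Gt t - {v})"
    by (auto intro!: inj_onI)
  have "card {(v, b, t). (v, t) \<in> G \<and> (b, t) \<in> G \<and> v \<noteq> b} = (\<Sum>t\<in>I. \<Sum>v\<in>Gt t. card (Gt t - {v}))"
    unfolding eq card_image[OF inj] using assms(1) finGt by simp
  also have "\<dots> = (\<Sum>t\<in>I. card (Gt t) * (card (Gt t) - 1))" by (rule sum.cong) (auto simp: card_Diff_singleton)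
  finally have c: "real (card {(v, b, t). (v, t) \<in> G \<and> (b, t) \<in> G \<and> v \<noteq> b}) =
      (\<Sum>t\<in>I. real (card (Gt t)) * (real (card (Gt t)) - 1))"
    by (simp add: of_nat_diff_if algebra_simps)
  \<comment> \<open>The square is bounded below by its tangent at \<open>a\<close>.\<close>
  have "(\<Sum>t\<in>I. 2 * a * real (card (Gt t)) - a\<^sup>2 - real (card (Gt t))) \<le>
      (\<Sum>t\<in>I. real (card (Gt t)) * (real (card (Gt t)) - 1))"
  proof (rule sum_mono)
    fix t
    have "(real (card (Gt t)) - a)\<^sup>2 \<ge> 0" by simp
    then show "2 * a * real (card (Gt t)) - a\<^sup>2 - real (card (Gt t)) \<le>
      real (card (Gt t)) * (real (card (Gt t)) - 1)" by (simp add: power2_eq_square algebra_simps)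
  qed
  moreover have "(\<Sum>t\<in>I. 2 * a * real (card (Gt t)) - a\<^sup>2 - real (card (Gt t))) =
      2 * a * card G - a\<^sup>2 * card I - card G"
    by (simp add: sum_subtractf cG sum_distrib_left)
  moreover have "a\<^sup>2 * card I \<le> a\<^sup>2 * N" using assms by (intro mult_left_mono) auto
  moreover have "a\<^sup>2 * N = a * card G" using assms by (simp add: a_def power2_eq_square)
  moreover have "a \<ge> 2" using assms by (simp add: a_def field_simps)
  then have "2 * real (card G) \<le> a * card G" by (intro mult_right_mono) auto
  moreover have "real (card G) ^ 2 / (2 * N) = a * card G / 2" by (simp add: a_def power2_eq_square)
  ultimately show ?thesis unfolding c by linarith
qed

text \<open>One \<open>T\<close> has to complete both \<open>v\<close> and \<open>b\<close>, which
  the degree condition does not promise for two given vertices. So for each \<open>R\<close> one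
  counts pairs of a vertex completing \<open>R\<close> and a list completing that vertex, and
  \<open>card_pairs_common\<close> yields many pairs of vertices with a common list. The result is a
  positive proportion of all \<open>n ^ (2 * k)\<close> lists.\<close>

lemma card_absorbers:
  fixes d :: real
  assumes k: "k \<ge> 3" and kg: "k_graph k V E" and n: "n = card V"
    and deg: "\<And>T. T \<subseteq> V \<Longrightarrow> card T = k - 1 \<Longrightarrow> d * n \<le> card (neighbourhood V E T)"
    and d: "d > 0" "d \<le> 1" and big: "8 * real k \<le> d * n" "2 \<le> (d / 2) ^ k * n"
    and S: "s \<in> V" "S \<subseteq> V" "card S = k - 2" "s \<notin> S"
  shows "(d / 2) ^ (3 * k - 1) / 2 * real n ^ (2 * k) \<le>
    card {xs. \<exists>R v b T. xs = R @ v # b # T \<and> absorber k V E s S R v b T}"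
proof -
  have finV: "finite V" using kg by (simp add: k_graph_def)
  have finS: "finite S" using S finV finite_subset by blast
  define D where "D = d * n"
  have n0: "real n > 0" using big(1) k by (cases "n = 0") auto
  have DV: "D \<le> card V" using d n by (simp add: D_def mult_left_le_one_le)
  have k8: "8 * real k \<le> D" using big by (simp add: D_def)
  have degD: "D \<le> card (neighbourhood V E T)" if "T \<subseteq> V" "card T = k - 1" for T
    using deg[OF that] by (simp add: D_def)
  have edge: "card e = k" if "e \<in> E" for e using kg that by (auto simp: k_graph_def)
  have notin: "x \<notin> set R" if "length R = k - 1" "insert x (set R) \<in> E" for x and R :: "'a list"
  proof
    assume "x \<in> set R"
    then have "card (set R) = k" using edge[OF that(2)] by (simp add: insert_absorb)
    then show False using card_length[of R] that(1) k by simp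
  qed
  define LR where "LR = link_lists k V E s {} V"
  have LR: "finite LR" "(D / 2) ^ (k - 1) \<le> card LR"
    unfolding LR_def by (rule card_link_lists[OF k kg degD k8 DV S(1)]; use DV in simp)+
  define I where "I = {xs. set xs \<subseteq> V \<and> length xs = k - 1}"
  have I: "finite I" "card I = n ^ (k - 1)"
    using finite_lists_length_eq[OF finV] card_lists_length_eq[OF finV] n by (auto simp: I_def)
  define T where "T R b = link_lists k V E b (set R) (neighbourhood V E (insert b S))" for R b
  define G where "G R = {(b, t). b \<in> neighbourhood V E (set R) - S \<and> t \<in> T R b}" for R
  define M where "M R = {(v, b, t). (v, t) \<in> G R \<and> (b, t) \<in> G R \<and> v \<noteq> b}" for R
  have G: "(D / 2) ^ k \<le> card (G R)" "G R \<subseteq> V \<times> I" if R: "R \<in> LR" for R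
  proof -
    have R': "length R = k - 1" "distinct R" "set R \<subseteq> V" using R by (auto simp: LR_def link_lists_def)
    have cR: "card (set R) = k - 1" using R' distinct_card by metis
    have "D / 2 \<le> card (neighbourhood V E (set R) - S)"
      by (rule card_diff_ge[where m = k]) (use degD[OF R'(3) cR] finS S k8 in auto)
    moreover have T: "finite (T R b)" "(D / 2) ^ (k - 1) \<le> card (T R b)"
      if "b \<in> neighbourhood V E (set R) - S" for b
    proof -
      have bV: "b \<in> V" using that by (auto simp: neighbourhood_def)
      have "card (insert b S) = k - 1" using that S(3) finS k by simp
      then have "D \<le> card (neighbourhood V E (insert b S))" using degD bV S(2) by simp
      moreover have "neighbourhood V E (insert b S) \<subseteq> V" by (auto simp: neighbourhood_def)
      ultimately show "finite (T R b)" "(D / 2) ^ (k - 1) \<le> card (T R b)"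
        unfolding T_def using card_link_lists[OF k kg degD k8 DV bV, of "set R"] cR by auto
    qed
    have eq: "G R = (SIGMA b:neighbourhood V E (set R) - S. T R b)" by (auto simp: G_def)
    have finN: "finite (neighbourhood V E (set R) - S)" using finV by (simp add: neighbourhood_def)
    have "card (G R) = (\<Sum>b\<in>neighbourhood V E (set R) - S. card (T R b))"
      unfolding eq using finN T by simp
    then have "real (card (G R)) = (\<Sum>b\<in>neighbourhood V E (set R) - S. real (card (T R b)))" by simp
    moreover have "\<dots> \<ge> real (card (neighbourhood V E (set R) - S)) * (D / 2) ^ (k - 1)"
      using T by (intro sum_bounded_below) auto
    ultimately have "real (card (neighbourhood V E (set R) - S)) * (D / 2) ^ (k - 1) \<le> card (G R)" by simp
    moreover have "(D / 2) * (D / 2) ^ (k - 1) \<le> real (card (neighbourhood V E (set R) - S)) * (D / 2) ^ (k - 1)"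
      using \<open>D / 2 \<le> _\<close> k8 by (intro mult_right_mono) auto
    moreover have "(D / 2) * (D / 2) ^ (k - 1) = (D / 2) ^ k" using k by (simp flip: power_Suc)
    ultimately show "(D / 2) ^ k \<le> card (G R)" by linarith
    show "G R \<subseteq> V \<times> I" by (auto simp: G_def T_def I_def link_lists_def neighbourhood_def)
  qed
  define N where "N = real n ^ (k - 1)"
  have N0: "N > 0" using n0 by (simp add: N_def)
  have DN: "(D / 2) ^ k = ((d / 2) ^ k * n) * N"
  proof -
    have "(D / 2) ^ k = (d / 2) ^ k * real n ^ k" by (simp add: D_def flip: power_mult_distrib)
    also have "real n ^ k = real n * N" using k by (simp add: N_def flip: power_Suc)
    finally show ?thesis by simp
  qed
  have M: "((D / 2) ^ k)\<^sup>2 / (2 * N) \<le> card (M R)" if "R \<in> LR" for R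
  proof -
    have "2 * N \<le> (D / 2) ^ k" unfolding DN using big(2) N0 by (intro mult_right_mono) auto
    then have "2 * N \<le> card (G R)" using G(1)[OF that] by linarith
    then have "real (card (G R)) ^ 2 / (2 * N) \<le> card (M R)"
      unfolding M_def using I N0 finV G(2)[OF that] by (intro card_pairs_common[of I V]) (auto simp: N_def)
    moreover have "((D / 2) ^ k)\<^sup>2 / (2 * N) \<le> real (card (G R)) ^ 2 / (2 * N)"
      using G(1)[OF that] N0 k8 by (intro divide_right_mono power_mono) auto
    ultimately show ?thesis by linarith
  qed
  define A where "A = {xs. \<exists>R v b T. xs = R @ v # b # T \<and> absorber k V E s S R v b T}"
  have finM: "finite (M R)" if "R \<in> LR" for R
    by (rule finite_subset[of _ "V \<times> V \<times> I"]) (use G(2)[OF that] finV I in \<open>auto simp: M_def\<close>)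
  have "(D / 2) ^ (k - 1) * (((D / 2) ^ k)\<^sup>2 / (2 * N)) \<le> real (card LR) * (((D / 2) ^ k)\<^sup>2 / (2 * N))"
    using LR N0 by (intro mult_right_mono) auto
  also have "\<dots> \<le> (\<Sum>R\<in>LR. real (card (M R)))" using M by (intro sum_bounded_below) auto
  also have "\<dots> = card (SIGMA R:LR. M R)" using LR finM by simp
  also have "\<dots> \<le> card A"
  proof -
    let ?f = "\<lambda>(R, v, b, T). R @ v # b # T"
    have "inj_on ?f (SIGMA R:LR. M R)"
      by (rule inj_onI) (auto simp: LR_def link_lists_def)
    moreover have "?f ` (SIGMA R:LR. M R) \<subseteq> A"
    proof
      fix xs assume "xs \<in> ?f ` (SIGMA R:LR. M R)"
      then obtain R v b t where xs: "xs = R @ v # b # t" and R: "R \<in> LR"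
        and vt: "(v, t) \<in> G R" and bt: "(b, t) \<in> G R" and vb: "v \<noteq> b" by (auto simp: M_def)
      have R': "length R = k - 1" "distinct R" "set R \<subseteq> V" "insert s (set R) \<in> E"
        using R by (auto simp: LR_def link_lists_def)
      have v: "v \<in> V" "insert v (set R) \<in> E" "v \<notin> set t" "insert v (set t) \<in> E"
        and b: "b \<in> V" "insert b (set R) \<in> E" "b \<notin> set t" "insert b (set t) \<in> E"
        and t: "length t = k - 1" "distinct t" "set t \<subseteq> V" "set t \<inter> set R = {}"
          "insert (last t) (insert b S) \<in> E"
        using vt bt by (auto simp: G_def T_def link_lists_def neighbourhood_def insert_commute)
      have "absorber k V E s S R v b t"
        unfolding absorber_def using R' v b t vb notin[OF R'(1) v(2)] notin[OF R'(1) b(2)] by auto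
      then show "xs \<in> A" unfolding A_def xs by blast
    qed
    moreover have "finite A"
    proof (rule finite_subset)
      show "A \<subseteq> {xs. set xs \<subseteq> V \<and> length xs = k - 1 + (2 + (k - 1))}"
        by (auto simp: A_def absorber_def)
      show "finite {xs. set xs \<subseteq> V \<and> length xs = k - 1 + (2 + (k - 1))}"
        by (rule finite_lists_length_eq[OF finV])
    qed
    ultimately show ?thesis using card_inj_on_le by (metis of_nat_le_iff)
  qed
  \<comment> \<open>The exponent \<open>3 * k - 1\<close> is \<open>k - 1\<close> from the choice of
    \<open>R\<close> and \<open>2 * k\<close> from the square; the powers of \<open>n\<close>
    belonging to \<open>R\<close> cancel against \<open>N\<close>.\<close>
  also have "(D / 2) ^ (k - 1) * (((D / 2) ^ k)\<^sup>2 / (2 * N)) = (d / 2) ^ (3 * k - 1) / 2 * real n ^ (2 * k)"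
  proof -
    have "(D / 2) ^ (k - 1) = (d / 2) ^ (k - 1) * N" by (simp add: D_def N_def flip: power_mult_distrib)
    then have "(D / 2) ^ (k - 1) * (((D / 2) ^ k)\<^sup>2 / (2 * N)) = (d / 2) ^ (k - 1) * ((D / 2) ^ k)\<^sup>2 / 2"
      using N0 by simp
    also have "\<dots> = (d / 2) ^ (k - 1) * (d / 2) ^ (2 * k) / 2 * real n ^ (2 * k)"
      by (simp add: D_def power_mult_distrib power_divide mult.commute flip: power_mult)
    also have "(d / 2) ^ (k - 1) * (d / 2) ^ (2 * k) = (d / 2) ^ (3 * k - 1)"
      using k by (simp flip: power_add)
    finally show ?thesis .
  qed
  finally show ?thesis unfolding A_def .
qed

text \<open>Each path and its replacement have the same ends: \<open>hd R\<close> and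
  \<open>last R\<close> are not affected by the exchange of \<open>v\<close> for \<open>s\<close>,
  while \<open>b\<close> and \<open>hd T\<close> lie in different edges of the longer path and away
  from its joint \<open>last T\<close>.\<close>

lemma lpath_absorber:
  assumes ab: "absorber k V E s S R v b T" and k: "k \<ge> 3" and kg: "k_graph k V E"
  shows "lpath k E (hd R) (insert v (set R)) (last R)" "lpath k E b (insert b (set T)) (hd T)"
    and "lpath k E (hd R) (insert s (set R)) (last R)"
    and "S \<inter> set (R @ v # b # T) = {} \<Longrightarrow> lpath k E b (insert v (insert b (set T)) \<union> S) (hd T)"
proof -
  have edge: "card e = k" if "e \<in> E" for e using kg that by (auto simp: k_graph_def)
  have ne: "hd xs \<noteq> last xs" "hd xs \<in> set xs" "last xs \<in> set xs" if "length xs = k - 1" "distinct xs" for xs :: "'a list"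
  proof -
    have "2 \<le> length xs" using that(1) k by simp
    then obtain x y ys where "xs = x # y # ys" by (cases xs; cases "tl xs") auto
    then show "hd xs \<noteq> last xs" "hd xs \<in> set xs" "last xs \<in> set xs" using that(2) by auto
  qed
  have R: "length R = k - 1" "distinct R" and T: "length T = k - 1" "distinct T"
    using ab by (auto simp: absorber_def)
  have E: "insert v (set R) \<in> E" "insert s (set R) \<in> E" "insert b (set T) \<in> E" "insert v (set T) \<in> E"
      "insert (last T) (insert b S) \<in> E"
    using ab by (auto simp: absorber_def)
  have nb: "b \<notin> set T" "v \<notin> set T" "b \<noteq> v" using ab by (auto simp: absorber_def)
  have bT: "hd T \<noteq> b" "last T \<noteq> b" using ne[OF T] nb by auto
  show "lpath k E (hd R) (insert v (set R)) (last R)"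
    by (rule lpath_edge) (use E edge ne[OF R] in auto)
  show "lpath k E b (insert b (set T)) (hd T)"
    by (rule lpath_edge) (use E edge ne[OF T] bT in auto)
  show "lpath k E (hd R) (insert s (set R)) (last R)"
    by (rule lpath_edge) (use E edge ne[OF R] in auto)
  assume S: "S \<inter> set (R @ v # b # T) = {}"
  have "insert (last T) (insert b S) \<inter> insert v (set T) = {last T}"
    using S nb ne[OF T] by auto
  then have "lpath k E b (insert (last T) (insert b S) \<union> insert v (set T)) (hd T)"
    by (rule lpath_two_edges[rotated 4]) (use E edge ne[OF T] bT in auto)
  moreover have "insert (last T) (insert b S) \<union> insert v (set T) = insert v (insert b (set T)) \<union> S"
    using ne[OF T] by auto
  ultimately show "lpath k E b (insert v (insert b (set T)) \<union> S) (hd T)" by simp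
qed

text \<open>\<open>W\<close> is cut into \<open>t\<close> groups of \<open>k - 1\<close> vertices. A
  group has at least \<open>m \<ge> t\<close> candidates, and fewer than \<open>t\<close> are taken
  by the other groups, so one is always free.\<close>

lemma greedy_assignment:
  fixes P :: "'i \<Rightarrow> 'a \<Rightarrow> 'a set \<Rightarrow> bool"
  assumes F: "finite F" and k: "k \<ge> 2"
    and P: "\<And>s S. s \<in> V \<Longrightarrow> S \<subseteq> V \<Longrightarrow> card S = k - 2 \<Longrightarrow> s \<notin> S \<Longrightarrow> m \<le> card {w \<in> F. P w s S}"
    and W: "W \<subseteq> V" "finite W" "card W = t * (k - 1)" "t \<le> m"
  shows "\<exists>H s S. H \<subseteq> F \<and> card H = t \<and> (\<forall>w\<in>H. P w (s w) (S w)) \<and>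
    (\<forall>w\<in>H. \<forall>w'\<in>H. w \<noteq> w' \<longrightarrow> insert (s w) (S w) \<inter> insert (s w') (S w') = {}) \<and>
    W = (\<Union>w\<in>H. insert (s w) (S w))"
  using W
proof (induction t arbitrary: W)
  case 0
  then show ?case by (intro exI[of _ "{}"]) auto
next
  case (Suc t)
  have "k - 1 \<le> card W" using Suc.prems by simp
  then obtain U where U: "U \<subseteq> W" "card U = k - 1" by (meson obtain_subset_with_card_n)
  have "U \<noteq> {}" using U k by auto
  then obtain x where x: "x \<in> U" by blast
  define Y where "Y = U - {x}"
  have finU: "finite U" using U Suc.prems finite_subset by blast
  have Y: "card Y = k - 2" "x \<notin> Y" "insert x Y = U" using U x finU by (auto simp: Y_def)
  have "card (W - U) = t * (k - 1)" using Suc.prems U finU by (simp add: card_Diff_subset)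
  then have "\<exists>H s S. H \<subseteq> F \<and> card H = t \<and> (\<forall>w\<in>H. P w (s w) (S w)) \<and>
    (\<forall>w\<in>H. \<forall>w'\<in>H. w \<noteq> w' \<longrightarrow> insert (s w) (S w) \<inter> insert (s w') (S w') = {}) \<and>
    W - U = (\<Union>w\<in>H. insert (s w) (S w))"
    by (intro Suc.IH) (use Suc.prems in auto)
  then obtain H s S where H: "H \<subseteq> F" "card H = t" "\<forall>w\<in>H. P w (s w) (S w)"
    "\<forall>w\<in>H. \<forall>w'\<in>H. w \<noteq> w' \<longrightarrow> insert (s w) (S w) \<inter> insert (s w') (S w') = {}"
    "W - U = (\<Union>w\<in>H. insert (s w) (S w))"
    by (elim exE conjE)
  have "m \<le> card {w \<in> F. P w x Y}" using P[of x Y] Y U x Suc.prems by auto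
  then have "\<not> {w \<in> F. P w x Y} \<subseteq> H"
    using card_mono[of H] H(1,2) F Suc.prems(4) finite_subset by (metis Suc_n_not_le_n le_trans)
  then obtain w0 where w0: "w0 \<in> F" "P w0 x Y" "w0 \<notin> H" by blast
  let ?s = "s(w0 := x)" and ?S = "S(w0 := Y)"
  have finH: "finite H" using H F finite_subset by blast
  show ?case
  proof (intro exI[of _ "insert w0 H"] exI[of _ ?s] exI[of _ ?S] conjI ballI impI)
    show "insert w0 H \<subseteq> F" "card (insert w0 H) = Suc t" using H w0 finH by auto
    show "P w (?s w) (?S w)" if "w \<in> insert w0 H" for w using that H(3) w0 by auto
    have sub: "insert (s w) (S w) \<inter> U = {}" if "w \<in> H" for w using that H(5) by blast
    show "insert (?s w) (?S w) \<inter> insert (?s w') (?S w') = {}"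
      if ww: "w \<in> insert w0 H" "w' \<in> insert w0 H" "w \<noteq> w'" for w w'
    proof -
      consider "w = w0" "w' \<in> H" "w' \<noteq> w0" | "w' = w0" "w \<in> H" "w \<noteq> w0" | "w \<in> H" "w' \<in> H" "w \<noteq> w0" "w' \<noteq> w0"
        using ww w0 by blast
      then show ?thesis
      proof cases
        case 1 then show ?thesis using sub[of w'] Y(3) by auto
      next
        case 2 then show ?thesis using sub[of w] Y(3) by auto
      next
        case 3 then show ?thesis using H(4) ww(3) by simp
      qed
    qed
    have "(\<Union>w\<in>insert w0 H. insert (?s w) (?S w)) = U \<union> (\<Union>w\<in>H. insert (s w) (S w))"
    proof -
      have "(\<Union>w\<in>H. insert (?s w) (?S w)) = (\<Union>w\<in>H. insert (s w) (S w))"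
        by (rule SUP_cong) (use w0 in auto)
      then show ?thesis using Y(3) by simp
    qed
    also have "\<dots> = W" using H(5) U by blast
    finally show "W = (\<Union>w\<in>insert w0 H. insert (?s w) (?S w))" by simp
  qed
qed

text \<open>An instance of \<open>random_selection\<close> on lists of length \<open>2 * k\<close>:
  two lists conflict when they share a vertex, and every pair \<open>s\<close>, \<open>S\<close> is
  one requirement.\<close>

lemma absorber_family:
  fixes d :: real
  assumes k: "k \<ge> 3" and kg: "k_graph k V E" and n: "n = card V"
    and deg: "\<And>T. T \<subseteq> V \<Longrightarrow> card T = k - 1 \<Longrightarrow> d * n \<le> card (neighbourhood V E T)"
    and d: "d > 0" "d \<le> 1" and big: "8 * real k \<le> d * n" "2 \<le> (d / 2) ^ k * n"
    and \<gamma>: "\<gamma> = (d / 2) ^ (3 * k - 1) / 2"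
    and N: "real N * (4 * k\<^sup>2) \<le> \<gamma> / 32 * n" "real n ^ (k - 1) * exp (- (\<gamma> * N / 4)) < 1/2" "N > 0"
  shows "\<exists>F. finite F \<and> F \<noteq> {} \<and> card F \<le> N \<and>
    (\<forall>xs\<in>F. \<exists>s S R v b T. xs = R @ v # b # T \<and> absorber k V E s S R v b T) \<and>
    (\<forall>xs\<in>F. \<forall>ys\<in>F. xs \<noteq> ys \<longrightarrow> set xs \<inter> set ys = {}) \<and>
    (\<forall>s S. s \<in> V \<longrightarrow> S \<subseteq> V \<longrightarrow> card S = k - 2 \<longrightarrow> s \<notin> S \<longrightarrow>
      \<gamma> * N / 8 \<le> card {xs \<in> F. \<exists>R v b T. xs = R @ v # b # T \<and> absorber k V E s S R v b T})"
proof -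
  have finV: "finite V" using kg by (simp add: k_graph_def)
  have n0: "real n > 0" using big(1) k by (cases "n = 0") auto
  have g0: "\<gamma> > 0" unfolding \<gamma> using d by simp
  define \<Omega> where "\<Omega> = {xs. set xs \<subseteq> V \<and> length xs = 2 * k}"
  have finO: "finite \<Omega>" and cO: "card \<Omega> = n ^ (2 * k)"
    using finite_lists_length_eq[OF finV] card_lists_length_eq[OF finV] n by (auto simp: \<Omega>_def)
  have neO: "\<Omega> \<noteq> {}" using cO n0 by (metis card.empty of_nat_0 less_irrefl power_not_zero)
  define Ab where "Ab s S = {xs. \<exists>R v b T. xs = R @ v # b # T \<and> absorber k V E s S R v b T}" for s S
  \<comment> \<open>Tuples index the requirements, with \<open>s\<close> as head and
    \<open>S\<close> as tail. There are at most \<open>n ^ (k - 1)\<close> of them.\<close>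
  define \<I> where "\<I> = {xs. set xs \<subseteq> V \<and> length xs = k - 1 \<and> distinct xs}"
  define \<A> where "\<A> = (\<lambda>xs. Ab (hd xs) (set (tl xs))) ` \<I>"
  have finI: "finite \<I>" and cI: "card \<I> \<le> n ^ (k - 1)"
  proof -
    have "\<I> \<subseteq> {xs. set xs \<subseteq> V \<and> length xs = k - 1}" by (auto simp: \<I>_def)
    moreover have "finite {xs. set xs \<subseteq> V \<and> length xs = k - 1}" by (rule finite_lists_length_eq[OF finV])
    ultimately show "finite \<I>" "card \<I> \<le> n ^ (k - 1)"
      using card_lists_length_eq[OF finV, of "k - 1"] n
        card_mono[of "{xs. set xs \<subseteq> V \<and> length xs = k - 1}" \<I>]
      by (simp_all only: finite_subset)
  qed
  have Ab: "Ab s S \<subseteq> \<Omega> \<and> \<gamma> * card \<Omega> \<le> card (Ab s S)"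
    if "s \<in> V" "S \<subseteq> V" "card S = k - 2" "s \<notin> S" for s S
  proof
    show "Ab s S \<subseteq> \<Omega>" using k by (auto simp: Ab_def \<Omega>_def absorber_def)
    show "\<gamma> * card \<Omega> \<le> card (Ab s S)"
      using card_absorbers[OF k kg n deg d big that] by (simp add: Ab_def \<gamma> cO)
  qed
  define K where "K = {(xs, ys). xs \<in> \<Omega> \<and> ys \<in> \<Omega> \<and> set xs \<inter> set ys \<noteq> {}}"
  \<comment> \<open>One of the \<open>2 * k\<close> entries of the first list has to occur at one of
    the \<open>2 * k\<close> positions of the second.\<close>
  have cK: "real (card K) \<le> (4 * k\<^sup>2 / n) * (real (card \<Omega>))\<^sup>2"
  proof -
    let ?B = "\<lambda>v. {ys. set ys \<subseteq> V \<and> length ys = 2 * k \<and> v \<in> set ys}"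
    have sub: "K \<subseteq> (SIGMA xs:\<Omega>. \<Union>v\<in>set xs. ?B v)" by (auto simp: K_def \<Omega>_def)
    have finB: "finite (?B v)" for v
      by (rule finite_subset[OF _ finite_lists_length_eq[OF finV, of "2 * k"]]) auto
    have "card K \<le> card (SIGMA xs:\<Omega>. \<Union>v\<in>set xs. ?B v)"
      by (rule card_mono[OF _ sub]) (use finO finB in auto)
    also have "\<dots> = (\<Sum>xs\<in>\<Omega>. card (\<Union>v\<in>set xs. ?B v))" using finO finB by simp
    also have "\<dots> \<le> (\<Sum>xs\<in>\<Omega>. 4 * k\<^sup>2 * n ^ (2 * k - 1))"
    proof (rule sum_mono)
      fix xs assume "xs \<in> \<Omega>"
      then have l: "card (set xs) \<le> 2 * k" using card_length[of xs] by (simp add: \<Omega>_def)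
      have "card (\<Union>v\<in>set xs. ?B v) \<le> (\<Sum>v\<in>set xs. card (?B v))" by (rule card_UN_le) simp
      also have "\<dots> \<le> card (set xs) * (2 * k * n ^ (2 * k - 1))"
        using sum_bounded_above[of "set xs" "\<lambda>v. card (?B v)" "2 * k * n ^ (2 * k - 1)"]
          card_lists_containing[OF finV, of "2 * k"] n by simp
      also have "\<dots> \<le> 2 * k * (2 * k * n ^ (2 * k - 1))" using l by (rule mult_le_mono1)
      finally show "card (\<Union>v\<in>set xs. ?B v) \<le> 4 * k\<^sup>2 * n ^ (2 * k - 1)" by (simp add: power2_eq_square)
    qed
    also have "\<dots> = card \<Omega> * (4 * k\<^sup>2 * n ^ (2 * k - 1))" by simp
    finally have "real (card K) \<le> real (card \<Omega> * (4 * k\<^sup>2 * n ^ (2 * k - 1)))" by (simp only: of_nat_le_iff)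
    also have "\<dots> = real (card \<Omega>) * (4 * k\<^sup>2 * real n ^ (2 * k - 1))" by simp
    also have "real n ^ (2 * k - 1) = real (card \<Omega>) / n"
      using n0 k by (simp add: cO field_simps flip: power_Suc)
    finally show ?thesis by (simp add: power2_eq_square field_simps)
  qed
  have "\<exists>F. F \<subseteq> \<Omega> \<and> card F \<le> N \<and> (\<forall>a\<in>F. \<forall>b\<in>F. a \<noteq> b \<longrightarrow> (a, b) \<notin> K) \<and>
    (\<forall>A\<in>\<A>. real (card (F \<inter> A)) \<ge> \<gamma> * N / 8)"
  proof (rule random_selection[OF finO neO _ _ g0 _ _ _ cK])
    show "finite \<A>" using finI by (simp add: \<A>_def)
    show "A \<subseteq> \<Omega> \<and> \<gamma> * card \<Omega> \<le> card A" if A: "A \<in> \<A>" for A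
    proof -
      obtain xs where xs: "xs \<in> \<I>" "A = Ab (hd xs) (set (tl xs))" using A by (auto simp: \<A>_def)
      obtain s ys where "xs = s # ys" using xs k by (cases xs) (auto simp: \<I>_def)
      then have s: "s \<in> V" "set ys \<subseteq> V" "s \<notin> set ys" "distinct ys" "Suc (length ys) = k - 1" "A = Ab s (set ys)"
        using xs by (auto simp: \<I>_def)
      then have "card (set ys) = k - 2" using distinct_card[of ys] by simp
      then show ?thesis using Ab[OF s(1,2) _ s(3)] s(6) by simp
    qed
    show "K \<subseteq> \<Omega> \<times> \<Omega>" "sym K" by (auto simp: K_def sym_def)
    show "Id_on \<Omega> \<subseteq> K" using k by (auto simp: K_def \<Omega>_def)
    show "real N * (4 * k\<^sup>2 / n) \<le> \<gamma> / 32" using N(1) n0 by (simp add: field_simps)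
    have "real (card \<A>) \<le> real n ^ (k - 1)"
    proof -
      have "card \<A> \<le> n ^ (k - 1)"
        using card_image_le[OF finI, of "\<lambda>xs. Ab (hd xs) (set (tl xs))"] cI unfolding \<A>_def by linarith
      then show ?thesis by (simp flip: of_nat_power)
    qed
    then have "real (card \<A>) * exp (- (\<gamma> * N / 4)) \<le> real n ^ (k - 1) * exp (- (\<gamma> * N / 4))"
      by (rule mult_right_mono) simp
    then show "real (card \<A>) * exp (- (\<gamma> * N / 4)) < 1/2" using N(2) by linarith
    show "N > 0" by (rule N(3))
  qed
  then obtain F where F: "F \<subseteq> \<Omega>" "card F \<le> N" "\<And>a b. a \<in> F \<Longrightarrow> b \<in> F \<Longrightarrow> a \<noteq> b \<Longrightarrow> (a, b) \<notin> K"
    "\<And>A. A \<in> \<A> \<Longrightarrow> \<gamma> * N / 8 \<le> card (F \<inter> A)" by blast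
  have AbA: "Ab s S \<in> \<A>" if s: "s \<in> V" "S \<subseteq> V" "card S = k - 2" "s \<notin> S" for s S
  proof -
    obtain ys where ys: "set ys = S" "distinct ys"
      using finite_distinct_list finite_subset[OF s(2) finV] by blast
    then have "length ys = k - 2" using s distinct_card by metis
    then have "s # ys \<in> \<I>" using s ys k by (auto simp: \<I>_def)
    then show ?thesis unfolding \<A>_def using ys by force
  qed
  have finF: "finite F" using F finO finite_subset by blast
  \<comment> \<open>Selected lists that absorb nothing are discarded; the counts for the
    requirements do not change.\<close>
  define F' where "F' = F \<inter> \<Union>\<A>"
  have sub: "F \<inter> A = F' \<inter> A" if "A \<in> \<A>" for A using that by (auto simp: F'_def)
  have "\<exists>A. A \<in> \<A>"
  proof -
    have "k - 1 \<le> card V"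
    proof -
      have "8 * real k \<le> d * n" by (rule big(1))
      also have "\<dots> \<le> n" using d by (simp add: mult_left_le_one_le)
      finally show ?thesis using n by linarith
    qed
    then obtain U where U: "U \<subseteq> V" "card U = k - 1" by (meson obtain_subset_with_card_n)
    then obtain ys where "set ys = U" "distinct ys" using finite_distinct_list finite_subset[OF _ finV] by metis
    moreover from this have "length ys = k - 1" using U distinct_card by metis
    ultimately have "ys \<in> \<I>" using U by (auto simp: \<I>_def)
    then show ?thesis unfolding \<A>_def by blast
  qed
  then obtain A0 where A0: "A0 \<in> \<A>" by blast
  have "0 < \<gamma> * N / 8" using g0 N(3) by simp
  then have "0 < real (card (F \<inter> A0))" using F(4)[OF A0] by linarith
  then have "F \<inter> A0 \<noteq> {}" by (metis card.empty of_nat_0 less_irrefl)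
  then have ne: "F' \<noteq> {}" using A0 by (auto simp: F'_def)
  show ?thesis
  proof (intro exI[of _ F'] conjI allI impI ballI)
    show "finite F'" "F' \<noteq> {}" using finF ne by (auto simp: F'_def)
    show "card F' \<le> N" using card_mono[OF finF, of F'] F(2) by (auto simp: F'_def)
    show "\<exists>s S R v b T. xs = R @ v # b # T \<and> absorber k V E s S R v b T" if "xs \<in> F'" for xs
      using that by (fastforce simp: F'_def \<A>_def Ab_def)
    show "set xs \<inter> set ys = {}" if "xs \<in> F'" "ys \<in> F'" "xs \<noteq> ys" for xs ys
      using F(3)[of xs ys] F(1) that unfolding F'_def K_def by blast
    show "\<gamma> * N / 8 \<le> card {xs \<in> F'. \<exists>R v b T. xs = R @ v # b # T \<and> absorber k V E s S R v b T}"
      if "s \<in> V" "S \<subseteq> V" "card S = k - 2" "s \<notin> S" for s S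
    proof -
      have "{xs \<in> F'. \<exists>R v b T. xs = R @ v # b # T \<and> absorber k V E s S R v b T} = F' \<inter> Ab s S"
        unfolding Ab_def by blast
      also have "\<dots> = F \<inter> Ab s S" by (rule sub[OF AbA[OF that], symmetric])
      finally show ?thesis using F(4)[OF AbA[OF that]] by (simp only:)
    qed
  qed
qed

section \<open>The absorbing path\<close>

text \<open>Every absorber gives two segments of one edge each. \<open>join_segments\<close> fixes
  the connectors once, and absorption only exchanges segments. The bound \<open>8 * k * N\<close>
  consists of \<open>2 * k * N\<close> for the absorbers and \<open>3 * k\<close> for each of at
  most \<open>2 * N\<close> connectors.\<close>

lemma absorbing_path_exists:
  fixes d :: real and V :: "'a set"
  assumes k: "k \<ge> 3" and kg: "k_graph k V E" and n: "n = card V"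
    and deg: "\<And>T. T \<subseteq> V \<Longrightarrow> card T = k - 1 \<Longrightarrow> d * n \<le> card (neighbourhood V E T)"
    and d: "d > 0" "d \<le> 1" and big: "8 * real k \<le> d * n" "2 \<le> (d / 2) ^ k * n"
    and \<gamma>: "\<gamma> = (d / 2) ^ (3 * k - 1) / 2"
    and N: "real N * real (4 * k\<^sup>2) \<le> \<gamma> / 32 * n" "real n ^ (k - 1) * exp (- (\<gamma> * N / 4)) < 1/2" "N > 0"
    and con: "real (8 * k * N + 4 * k) \<le> d * n"
  shows "\<exists>A x y. A \<subseteq> V \<and> card A \<le> 8 * k * N \<and>
    (\<forall>W t. W \<subseteq> V - A \<longrightarrow> card W = t * (k - 1) \<longrightarrow> t \<le> \<gamma> * N / 8 \<longrightarrow> lpath k E x (A \<union> W) y)"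
proof -
  have finV: "finite V" using kg by (simp add: k_graph_def)
  define ab where "ab s S xs \<longleftrightarrow> (\<exists>R v b T. xs = R @ v # b # T \<and> absorber k V E s S R v b T)" for s S xs
  have "\<exists>F. finite F \<and> F \<noteq> {} \<and> card F \<le> N \<and> (\<forall>xs\<in>F. \<exists>s S. ab s S xs) \<and>
    (\<forall>xs\<in>F. \<forall>ys\<in>F. xs \<noteq> ys \<longrightarrow> set xs \<inter> set ys = {}) \<and>
    (\<forall>s S. s \<in> V \<longrightarrow> S \<subseteq> V \<longrightarrow> card S = k - 2 \<longrightarrow> s \<notin> S \<longrightarrow>
      \<gamma> * N / 8 \<le> card {xs \<in> F. ab s S xs})"
    unfolding ab_def
    by (rule absorber_family[OF k kg n deg d big \<gamma> N])
  then obtain F where F: "finite F" "F \<noteq> {}" "card F \<le> N" "\<forall>xs\<in>F. \<exists>s S. ab s S xs"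
    "\<forall>xs\<in>F. \<forall>ys\<in>F. xs \<noteq> ys \<longrightarrow> set xs \<inter> set ys = {}"
    "\<forall>s S. s \<in> V \<longrightarrow> S \<subseteq> V \<longrightarrow> card S = k - 2 \<longrightarrow> s \<notin> S \<longrightarrow>
      \<gamma> * N / 8 \<le> card {xs \<in> F. ab s S xs}" by (elim exE conjE)
  \<comment> \<open>The parts are read off by position, so they do not depend on the absorbed set;
    one list may be an absorber for many sets.\<close>
  define R where "R xs = take (k - 1) xs" for xs :: "'a list"
  define v where "v xs = xs ! (k - 1)" for xs :: "'a list"
  define b where "b xs = xs ! k" for xs :: "'a list"
  define T where "T xs = drop (k + 1) xs" for xs :: "'a list"
  have dec: "absorber k V E s S (R xs) (v xs) (b xs) (T xs) \<and> xs = R xs @ v xs # b xs # T xs" if "ab s S xs" for s S xs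
  proof -
    obtain R' v' b' T' where xs: "xs = R' @ v' # b' # T'" and a: "absorber k V E s S R' v' b' T'"
      using \<open>ab s S xs\<close> by (auto simp: ab_def)
    have l: "length R' = k - 1" using a by (simp add: absorber_def)
    have "R xs = R'" "v xs = v'" using l by (simp_all add: R_def v_def xs nth_append)
    moreover have "b xs = b'"
    proof -
      have "xs ! (length R' + 1) = b'" unfolding xs by (simp only: nth_append_length_plus) simp
      then show ?thesis using l k by (simp add: b_def)
    qed
    moreover have "T xs = T'" using l k by (simp add: T_def xs)
    ultimately show ?thesis using a xs by simp
  qed
  \<comment> \<open>\<open>True\<close> marks the edge of \<open>v\<close> and \<open>R\<close>,
    \<open>False\<close> the edge of \<open>b\<close> and \<open>T\<close>.\<close>
  define B where "B p = (if snd p then insert (v (fst p)) (set (R (fst p))) else insert (b (fst p)) (set (T (fst p))))"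
    for p :: "'a list \<times> bool"
  define X where "X p = (if snd p then hd (R (fst p)) else b (fst p))" for p :: "'a list \<times> bool"
  define Y where "Y p = (if snd p then last (R (fst p)) else hd (T (fst p)))" for p :: "'a list \<times> bool"
  have sx: "set xs = B (xs, True) \<union> B (xs, False)" "set xs \<subseteq> V" "B (xs, True) \<inter> B (xs, False) = {}"
    "length xs = 2 * k" "v xs \<notin> set (R xs)" "v xs \<notin> B (xs, False)" "v xs \<in> B (xs, True)" if "xs \<in> F" for xs
  proof -
    obtain s S where "ab s S xs" using F(4) \<open>xs \<in> F\<close> by blast
    then have a: "absorber k V E s S (R xs) (v xs) (b xs) (T xs)" and xs: "xs = R xs @ v xs # b xs # T xs" using dec by blast+
    have a': "length (R xs) = k - 1" "length (T xs) = k - 1" "distinct (R xs @ v xs # b xs # T xs)"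
        "set (R xs @ v xs # b xs # T xs) \<subseteq> V" using a by (auto simp: absorber_def)
    have "set xs = set (R xs @ v xs # b xs # T xs)" using xs by (rule arg_cong)
    then show "set xs = B (xs, True) \<union> B (xs, False)" "set xs \<subseteq> V" using a'(4) by (auto simp: B_def)
    show "B (xs, True) \<inter> B (xs, False) = {}" "v xs \<notin> set (R xs)" "v xs \<notin> B (xs, False)" "v xs \<in> B (xs, True)"
      using a'(3) by (auto simp: B_def)
    have "length xs = length (R xs @ v xs # b xs # T xs)" using xs by (rule arg_cong)
    then show "length xs = 2 * k" using a'(1,2) k by simp
  qed
  have lB: "lpath k E (X p) (B p) (Y p)" if "fst p \<in> F" for p
  proof -
    obtain s S where "ab s S (fst p)" using F(4) \<open>fst p \<in> F\<close> by blast
    then have "absorber k V E s S (R (fst p)) (v (fst p)) (b (fst p)) (T (fst p))" using dec by blast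
    from lpath_absorber(1,2)[OF this k kg] show ?thesis by (simp add: X_def Y_def B_def)
  qed
  define Z where "Z = (\<Union>xs\<in>F. set xs)"
  have BZ: "B p \<subseteq> Z" if "fst p \<in> F" for p
    using sx(1)[OF that] that unfolding Z_def by (cases p; cases "snd p") auto
  have finZ: "finite Z" using F(1) by (simp add: Z_def)
  have cZ: "card Z \<le> 2 * k * N"
  proof -
    have "card Z \<le> (\<Sum>xs\<in>F. card (set xs))" unfolding Z_def by (rule card_UN_le[OF F(1)])
    also have "\<dots> \<le> card F * (2 * k)"
      using sum_bounded_above[of F "\<lambda>xs. card (set xs)" "2 * k"] sx(4) card_length by (metis mult.commute of_nat_id)
    also have "\<dots> \<le> N * (2 * k)" using F(3) by (rule mult_le_mono1)
    finally show ?thesis by (simp add: mult.commute)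
  qed
  have "finite (F \<times> (UNIV :: bool set))" using F(1) by simp
  then obtain js where js: "set js = F \<times> (UNIV :: bool set)" "distinct js" using finite_distinct_list by blast
  have ljs: "length js \<le> 2 * N"
  proof -
    have "length js = card (F \<times> (UNIV :: bool set))" using js distinct_card by metis
    then show ?thesis using F(3) by (simp add: card_cartesian_product)
  qed
  have "F \<times> (UNIV :: bool set) \<noteq> {}" using F(2) by simp
  then have jne: "js \<noteq> []" unfolding js(1)[symmetric] by simp
  have BS: "B p \<subseteq> set (fst p)" if "fst p \<in> F" for p
    using sx(1)[OF that] by (cases p; cases "snd p") auto
  have disB: "B p \<inter> B q = {}" if "fst p \<in> F" "fst q \<in> F" "p \<noteq> q" for p q
  proof (cases "fst p = fst q")
    case True
    then have "snd p \<noteq> snd q" using that by (simp add: prod_eq_iff)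
    then show ?thesis using True sx(3)[OF that(1)] by (cases p; cases q; cases "snd p") auto
  next
    case False
    have "B p \<subseteq> set (fst p)" "B q \<subseteq> set (fst q)" 
      using BS that by blast+
    then show ?thesis using F(5) False that by blast
  qed
  have conn: "connects k V E V (8 * k * N)"
  proof (rule connectsI[OF k kg])
    show "8 * k * N + 4 * k \<le> card V"
    proof -
      have "d * n \<le> n" using d by (simp add: mult_left_le_one_le)
      then show ?thesis using con n by linarith
    qed
    fix T assume "T \<subseteq> V" "card T = k - 1"
    then have "d * n \<le> card (neighbourhood V E T)" by (rule deg)
    moreover have "neighbourhood V E T \<inter> V = neighbourhood V E T" by (auto simp: neighbourhood_def)
    ultimately have "d * n \<le> card (neighbourhood V E T \<inter> V)" by (simp only:)
    then show "8 * k * N + 4 * k \<le> card (neighbourhood V E T \<inter> V)" using con by linarith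
  qed auto
  have XY: "X p \<in> B p" "Y p \<in> B p" if "fst p \<in> F" for p using lpath_ends[OF lB[OF that]] by auto
  have "\<exists>C. C \<subseteq> V \<and> C \<inter> Z = {} \<and> card C \<le> 3 * k * length js \<and>
    (\<forall>A. (\<forall>i\<in>set js. lpath k E (X i) (A i) (Y i) \<and> A i \<inter> C = {}) \<longrightarrow>
         (\<forall>i\<in>set js. \<forall>j\<in>set js. i \<noteq> j \<longrightarrow> A i \<inter> A j = {}) \<longrightarrow>
         lpath k E (X (hd js)) (C \<union> (\<Union>i\<in>set js. A i)) (Y (last js)))"
  proof (rule join_segments[OF conn jne js(2) _ _ finZ _ finV])
    have ZV: "Z \<subseteq> V" using sx(2) by (auto simp: Z_def)
    fix i assume "i \<in> set js"
    then have "fst i \<in> F" using js(1) by (simp add: mem_Times_iff)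
    then show "X i \<in> V \<and> Y i \<in> V \<and> X i \<in> Z \<and> Y i \<in> Z" using XY BZ ZV by blast
  next
    fix i j assume "i \<in> set js" "j \<in> set js" "i \<noteq> j"
    then have "fst i \<in> F" "fst j \<in> F" using js(1) by (simp_all add: mem_Times_iff)
    then have "fst i \<in> F" "fst j \<in> F" "B i \<inter> B j = {}" using disB[of i j] \<open>i \<noteq> j\<close> by blast+
    then show "Y i \<noteq> X j" using XY(2)[of i] XY(1)[of j] by (metis disjoint_iff)
  next
    have "3 * k * length js \<le> 3 * k * (2 * N)" using ljs by (rule mult_le_mono2)
    then show "card Z + 3 * k * length js \<le> 8 * k * N" using cZ by linarith
  qed
  then obtain C where C: "C \<subseteq> V" "C \<inter> Z = {}" "card C \<le> 3 * k * length js"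
    and CA: "\<forall>A. (\<forall>i\<in>set js. lpath k E (X i) (A i) (Y i) \<and> A i \<inter> C = {}) \<longrightarrow>
         (\<forall>i\<in>set js. \<forall>j\<in>set js. i \<noteq> j \<longrightarrow> A i \<inter> A j = {}) \<longrightarrow>
         lpath k E (X (hd js)) (C \<union> (\<Union>i\<in>set js. A i)) (Y (last js))" by (elim exE conjE)
  define A where "A = C \<union> Z"
  show ?thesis
  proof (rule exI[of _ A], rule exI[of _ "X (hd js)"], rule exI[of _ "Y (last js)"], intro conjI allI impI)
    show "A \<subseteq> V" using C sx(2) by (auto simp: A_def Z_def)
    have "3 * k * length js \<le> 3 * k * (2 * N)" using ljs by (rule mult_le_mono2)
    then show "card A \<le> 8 * k * N" using card_Un_le[of C Z] C(3) cZ unfolding A_def by linarith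
    fix W t assume W: "W \<subseteq> V - A" "card W = t * (k - 1)" "real t \<le> \<gamma> * N / 8"
    have "\<exists>H s S. H \<subseteq> F \<and> card H = t \<and> (\<forall>w\<in>H. s w \<notin> S w \<and> ab (s w) (S w) w) \<and>
      (\<forall>w\<in>H. \<forall>w'\<in>H. w \<noteq> w' \<longrightarrow> insert (s w) (S w) \<inter> insert (s w') (S w') = {}) \<and>
      W = (\<Union>w\<in>H. insert (s w) (S w))"
    proof (rule greedy_assignment[OF F(1), where V = V and m = t and k = k])
      fix s S assume s: "s \<in> V" "S \<subseteq> V" "card S = k - 2" "s \<notin> S"
      have "\<gamma> * N / 8 \<le> card {xs \<in> F. ab s S xs}" using F(6) s by blast
      then show "t \<le> card {w \<in> F. s \<notin> S \<and> ab s S w}" using W(3) s(4) by simp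
    qed (use k W finV finite_subset in auto)
    then obtain H s S where H: "H \<subseteq> F" "\<forall>w\<in>H. s w \<notin> S w \<and> ab (s w) (S w) w"
      "\<forall>w\<in>H. \<forall>w'\<in>H. w \<noteq> w' \<longrightarrow> insert (s w) (S w) \<inter> insert (s w') (S w') = {}"
      "W = (\<Union>w\<in>H. insert (s w) (S w))" by (elim exE conjE)
    define D where "D w = (if w \<in> H then insert (s w) (S w) else {})" for w
    \<comment> \<open>When \<open>s\<close> and \<open>S\<close> enter, \<open>v\<close> leaves the
      first segment and joins the second, so the two stay disjoint. The ends do not move.\<close>
    define A' where "A' p = (if fst p \<in> H then
        (if snd p then insert (s (fst p)) (set (R (fst p))) else insert (v (fst p)) (B p) \<union> S (fst p)) else B p)" for p
    have DW: "D w \<subseteq> W" for w using H(4) by (auto simp: D_def)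
    have WA: "W \<inter> C = {}" "W \<inter> Z = {}" using W(1) by (auto simp: A_def)
    have A'D: "A' p \<subseteq> set (fst p) \<union> D (fst p)" if "fst p \<in> F" for p
      using sx(1)[OF that] unfolding A'_def D_def B_def by (cases p; cases "snd p") auto
    have setZ: "set w \<subseteq> Z" if "w \<in> F" for w using that by (auto simp: Z_def)
    have "lpath k E (X (hd js)) (C \<union> (\<Union>i\<in>set js. A' i)) (Y (last js))"
    proof (rule CA[rule_format])
      fix p assume "p \<in> set js"
      then have pF: "fst p \<in> F" using js by auto
      have "A' p \<inter> C = {}" using A'D[OF pF] setZ[OF pF] DW[of "fst p"] WA C(2) by blast
      moreover have "lpath k E (X p) (A' p) (Y p)"
      proof (cases "fst p \<in> H")
        case True
        then have "ab (s (fst p)) (S (fst p)) (fst p)" using H(2) by blast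
        then have a: "absorber k V E (s (fst p)) (S (fst p)) (R (fst p)) (v (fst p)) (b (fst p)) (T (fst p))"
          and e: "fst p = R (fst p) @ v (fst p) # b (fst p) # T (fst p)" using dec by blast+
        have "S (fst p) \<inter> set (fst p) = {}" using DW[of "fst p"] True WA(2) setZ[OF pF] by (auto simp: D_def)
        then have "S (fst p) \<inter> set (R (fst p) @ v (fst p) # b (fst p) # T (fst p)) = {}" using e by simp
        from lpath_absorber(3)[OF a k kg] lpath_absorber(4)[OF a k kg this]
        show ?thesis using True by (simp add: A'_def X_def Y_def B_def)
      next
        case False
        then show ?thesis using lB[OF pF] by (simp add: A'_def)
      qed
      ultimately show "lpath k E (X p) (A' p) (Y p) \<and> A' p \<inter> C = {}" by simp
    next
      fix p q assume pq: "p \<in> set js" "q \<in> set js" "p \<noteq> q"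
      then have F': "fst p \<in> F" "fst q \<in> F" using js(1) by (simp_all add: mem_Times_iff)
      show "A' p \<inter> A' q = {}"
      proof (cases "fst p = fst q")
        case False
        have "D (fst p) \<inter> D (fst q) = {}" using H(3) False by (auto simp: D_def)
        moreover have "set (fst p) \<inter> set (fst q) = {}" using F(5) F' False by blast
        ultimately show ?thesis
          using A'D[OF F'(1)] A'D[OF F'(2)] setZ[OF F'(1)] setZ[OF F'(2)] DW[of "fst p"] DW[of "fst q"] WA(2) by blast
      next
        case True
        have main: "A' (w, True) \<inter> A' (w, False) = {}" if w: "w \<in> F" for w
        proof (cases "w \<in> H")
          case False
          then show ?thesis using sx(3)[OF w] by (simp add: A'_def)
        next
          case True
          have "insert (s w) (S w) \<inter> set w = {}" using DW[of w] True WA(2) setZ[OF w] by (auto simp: D_def)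
          moreover have "s w \<notin> S w" using H(2) True by blast
          moreover have "set (R w) \<subseteq> B (w, True)" by (auto simp: B_def)
          then have "set (R w) \<inter> B (w, False) = {}" "set (R w) \<subseteq> set w" "B (w, False) \<subseteq> set w" "v w \<in> set w"
            using sx(1)[OF w] sx(3)[OF w] sx(7)[OF w] by blast+
          ultimately have "insert (s w) (set (R w)) \<inter> (insert (v w) (B (w, False)) \<union> S w) = {}"
          proof -
            have "set (R w) \<inter> S w = {}" "s w \<notin> B (w, False)" "s w \<noteq> v w"
            proof -
              have 1: "x \<noteq> s w \<and> x \<notin> S w" if "x \<in> set w" for x
                using \<open>insert (s w) (S w) \<inter> set w = {}\<close> that by (meson disjoint_iff insert_iff)
              show "set (R w) \<inter> S w = {}" using 1 \<open>set (R w) \<subseteq> set w\<close> by (meson disjoint_iff subsetD)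
              show "s w \<notin> B (w, False)" using 1[of "s w"] \<open>B (w, False) \<subseteq> set w\<close> by blast
              show "s w \<noteq> v w" using 1 \<open>v w \<in> set w\<close> by metis
            qed
            then show ?thesis using \<open>s w \<notin> S w\<close> \<open>set (R w) \<inter> B (w, False) = {}\<close> sx(5)[OF w] by auto
          qed
          then show ?thesis using True by (simp add: A'_def)
        qed
        then have "p = (fst p, True) \<and> q = (fst p, False) \<or> p = (fst p, False) \<and> q = (fst p, True)"
          using True pq(3) by (cases "snd p"; cases "snd q") (simp_all add: prod_eq_iff)
        then show ?thesis using main[OF F'(1)] by (metis Int_commute)
      qed
    qed
    moreover have "C \<union> (\<Union>i\<in>set js. A' i) = A \<union> W"
    proof -
      have "A' (w, True) \<union> A' (w, False) = set w \<union> D w" if "w \<in> F" for w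
        using sx(1)[OF that] unfolding A'_def D_def by (auto simp: B_def)
      then have "(\<Union>w\<in>F. A' (w, True) \<union> A' (w, False)) = (\<Union>w\<in>F. set w \<union> D w)" by (rule SUP_cong[OF refl])
      also have "\<dots> = Z \<union> W" using H(1,4) by (auto simp: Z_def D_def split: if_splits)
      finally have "(\<Union>w\<in>F. A' (w, True) \<union> A' (w, False)) = Z \<union> W" .
      moreover have "(\<Union>i\<in>set js. A' i) = (\<Union>w\<in>F. A' (w, True) \<union> A' (w, False))"
        unfolding js(1) by (auto simp: UNIV_bool)
      ultimately show ?thesis by (auto simp: A_def)
    qed
    ultimately show "lpath k E (X (hd js)) (A \<union> W) (Y (last js))" by (simp only:)
  qed
qed

section \<open>Tiling with loose paths\<close>

text \<open>As the blocks \<open>A j\<close> are disjoint and the \<open>c a\<close> distinct,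
  \<open>Z\<close> meets at most \<open>card Z\<close> of either kind and spoils at most
  \<open>2 * card Z * u\<close> pairs of \<open>G\<close>. More than \<open>u\<close> pairs survive,
  so two of them share the second coordinate.\<close>

lemma ex_cherry:
  fixes A :: "nat \<Rightarrow> 'a set" and c :: "nat \<Rightarrow> 'a" and G :: "(nat \<times> nat) set"
  assumes A: "\<And>i j. i < u \<Longrightarrow> j < u \<Longrightarrow> i \<noteq> j \<Longrightarrow> A i \<inter> A j = {}"
    and c: "inj_on c {..<u}" and G: "G \<subseteq> {..<u} \<times> {..<u}" and Z: "finite Z"
    and big: "(2 * card Z + 1) * u < card G"
  shows "\<exists>j j' a. (j, a) \<in> G \<and> (j', a) \<in> G \<and> j \<noteq> j' \<and> A j \<inter> Z = {} \<and> A j' \<inter> Z = {} \<and> c a \<notin> Z"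
proof -
  define J where "J = {j. j < u \<and> A j \<inter> Z \<noteq> {}}"
  define C where "C = {a. a < u \<and> c a \<in> Z}"
  define G' where "G' = {(j, a) \<in> G. A j \<inter> Z = {} \<and> c a \<notin> Z}"
  have fin: "finite J" "finite C" by (auto simp: J_def C_def)
  have finG: "finite G" using G finite_subset by blast
  have "card J \<le> card Z"
  proof -
    define h where "h j = (SOME z. z \<in> A j \<inter> Z)" for j
    have h: "h j \<in> A j \<inter> Z" if "j \<in> J" for j
      using that unfolding h_def J_def by (auto intro: someI2)
    have "inj_on h J"
    proof (rule inj_onI, rule ccontr)
      fix i j assume ij: "i \<in> J" "j \<in> J" "h i = h j" "i \<noteq> j"
      then have "h i \<in> A i \<inter> A j" using h[of i] h[of j] by simp
      then show False using A[of i j] ij by (auto simp: J_def)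
    qed
    moreover have "h ` J \<subseteq> Z" using h by auto
    ultimately show ?thesis using card_inj_on_le Z by blast
  qed
  moreover have "card C \<le> card Z"
  proof (rule card_inj_on_le[OF _ _ Z])
    show "inj_on c C" using c by (rule inj_on_subset) (auto simp: C_def)
    show "c ` C \<subseteq> Z" by (auto simp: C_def)
  qed
  moreover have "G \<subseteq> G' \<union> (J \<times> {..<u} \<union> {..<u} \<times> C)" using G by (auto simp: G'_def J_def C_def)
  then have "card G \<le> card (G' \<union> (J \<times> {..<u} \<union> {..<u} \<times> C))"
    using fin finG by (intro card_mono) (auto simp: G'_def elim: finite_subset[rotated])
  then have "card G \<le> card G' + (card J * u + u * card C)"
    using card_Un_le[of G' "J \<times> {..<u} \<union> {..<u} \<times> C"] card_Un_le[of "J \<times> {..<u}" "{..<u} \<times> C"]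
    by (simp add: card_cartesian_product)
  moreover have "card J * u + u * card C \<le> card Z * u + u * card Z"
    using calculation(1,2) by (intro add_mono mult_le_mono) auto
  ultimately have "u < card G'" using big by (simp add: algebra_simps)
  have "\<not> inj_on snd G'"
  proof
    assume "inj_on snd G'"
    then have "card G' \<le> card {..<u}" using G by (intro card_inj_on_le) (auto simp: G'_def)
    then show False using \<open>u < card G'\<close> by simp
  qed
  then obtain p q where "p \<in> G'" "q \<in> G'" "snd p = snd q" "p \<noteq> q" by (auto simp: inj_on_def)
  then show ?thesis by (cases p; cases q) (auto simp: G'_def)
qed

text \<open>The joints alternate between vertices \<open>c a\<close> and prescribed vertices
  \<open>s\<close>, so each \<open>s\<close> accounts for two edges. The induction keeps a spare
  block \<open>A j\<close> fitting the current end \<open>c a\<close>: it gives the edge from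
  \<open>c a\<close> to \<open>s\<close>. A fresh cherry then gives the edge from \<open>s\<close>
  to the next end and the next spare block.\<close>

lemma lpath_through:
  fixes A :: "nat \<Rightarrow> 'a set" and c :: "nat \<Rightarrow> 'a" and G :: "(nat \<times> nat) set"
  assumes k: "k \<ge> 3" and kg: "k_graph k V E"
    and A: "\<And>i j. i < u \<Longrightarrow> j < u \<Longrightarrow> i \<noteq> j \<Longrightarrow> A i \<inter> A j = {}"
      "\<And>j. j < u \<Longrightarrow> card (A j) = k - 2" "\<And>j a. j < u \<Longrightarrow> a < u \<Longrightarrow> c a \<notin> A j"
    and c: "inj_on c {..<u}" and G: "G \<subseteq> {..<u} \<times> {..<u}" and Z: "finite Z"
    and ss: "distinct ss" "set ss \<subseteq> Z" "length ss \<le> l"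
    and E: "\<And>s j a. s \<in> set ss \<Longrightarrow> (j, a) \<in> G \<Longrightarrow> insert s (insert (c a) (A j)) \<in> E"
    and big: "(2 * (card Z + 2 * l * k + k) + 1) * u < card G"
  shows "\<exists>x B a j. lpath k E x B (c a) \<and> B \<subseteq> set ss \<union> (((\<Union>j<u. A j) \<union> c ` {..<u}) - Z) \<and>
    card B = 2 * length ss * (k - 1) + 1 \<and> (j, a) \<in> G \<and> A j \<inter> (B \<union> Z) = {}"
  using ss E
proof (induction ss)
  case Nil
  have "(2 * card Z + 1) * u \<le> (2 * (card Z + 2 * l * k + k) + 1) * u" by (rule mult_le_mono1) simp
  then have "(2 * card Z + 1) * u < card G" using big by linarith
  then have "\<exists>j j' a. (j, a) \<in> G \<and> (j', a) \<in> G \<and> j \<noteq> j' \<and> A j \<inter> Z = {} \<and> A j' \<inter> Z = {} \<and> c a \<notin> Z"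
    by (intro ex_cherry[of u A c G Z] A(1) c G Z)
  then obtain j a where ja: "(j, a) \<in> G" "A j \<inter> Z = {}" "c a \<notin> Z" by blast
  then have "j < u" "a < u" using G by auto
  then have "A j \<inter> ({c a} \<union> Z) = {}" "{c a} \<subseteq> set [] \<union> (((\<Union>j<u. A j) \<union> c ` {..<u}) - Z)"
    using A(3) ja by auto
  then show ?case using ja lpath_nil[of k E "c a"] by (intro exI[of _ "c a"] exI[of _ "{c a}"] exI[of _ a] exI[of _ j]) simp
next
  case (Cons s ss)
  let ?U = "(\<Union>j<u. A j) \<union> c ` {..<u}"
  have edge: "card e = k" if "e \<in> E" for e using kg that by (auto simp: k_graph_def)
  have "\<exists>x B a j. lpath k E x B (c a) \<and> B \<subseteq> set ss \<union> (?U - Z) \<and>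
    card B = 2 * length ss * (k - 1) + 1 \<and> (j, a) \<in> G \<and> A j \<inter> (B \<union> Z) = {}"
    by (rule Cons.IH) (use Cons.prems in auto)
  then obtain x B a j where B: "lpath k E x B (c a)" "B \<subseteq> set ss \<union> (?U - Z)"
    "card B = 2 * length ss * (k - 1) + 1" "(j, a) \<in> G" "A j \<inter> (B \<union> Z) = {}" by (elim exE conjE)
  have ja: "j < u" "a < u" using B(4) G by auto
  have cB: "c a \<in> B" using lpath_ends[OF B(1)] by simp
  have sB: "s \<notin> B" "s \<in> Z" using B(2) Cons.prems(1,2) by auto
  \<comment> \<open>Otherwise \<open>c a\<close> is itself prescribed, and using it as
    \<open>s\<close> gives an edge with fewer than \<open>k\<close> vertices.\<close>
  have cZ: "c a \<notin> Z"
  proof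
    assume "c a \<in> Z"
    then have "c a \<in> set ss" using cB B(2) by blast
    have "insert (c a) (insert (c a) (A j)) \<in> E"
      by (rule Cons.prems(4)[OF _ B(4)]) (use \<open>c a \<in> set ss\<close> in simp)
    then have "card (insert (c a) (A j)) = k" using edge by simp
    then show False using card_insert_le_m1[of "k - 1" "A j" "c a"] A(2)[OF ja(1)] k
      by (simp add: numeral_2_eq_2)
  qed
  define Y where "Y = Z \<union> B \<union> A j"
  have finB: "finite B" using lpath_finite[OF B(1)] k by simp
  have finA: "finite (A j)" using A(2)[OF ja(1)] k by (intro card_ge_0_finite) simp
  have cY: "card Y \<le> card Z + 2 * l * k + k"
  proof -
    have "card Y \<le> card Z + card B + card (A j)"
      unfolding Y_def using card_Un_le[of "Z \<union> B" "A j"] card_Un_le[of Z B] by linarith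
    moreover have "card B \<le> 2 * l * k + 1"
    proof -
      have "2 * length ss * (k - 1) \<le> 2 * l * k" using Cons.prems(3) by (intro mult_le_mono) auto
      then show ?thesis using B(3) by linarith
    qed
    ultimately show ?thesis using A(2)[OF ja(1)] k by linarith
  qed
  then have "(2 * card Y + 1) * u \<le> (2 * (card Z + 2 * l * k + k) + 1) * u" by (intro mult_le_mono1) simp
  then have bY: "(2 * card Y + 1) * u < card G" using big by linarith
  have finY: "finite Y" using Z finB finA by (simp add: Y_def)
  have "\<exists>j j' a. (j, a) \<in> G \<and> (j', a) \<in> G \<and> j \<noteq> j' \<and> A j \<inter> Y = {} \<and> A j' \<inter> Y = {} \<and> c a \<notin> Y"
    by (intro ex_cherry[of u A c G Y] A(1) c G finY bY)
  then obtain i i' d where i: "(i, d) \<in> G" "(i', d) \<in> G" "i \<noteq> i'" "A i \<inter> Y = {}" "A i' \<inter> Y = {}" "c d \<notin> Y"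
    by blast
  have iu: "i < u" "i' < u" "d < u" using i G by auto
  define e1 where "e1 = insert s (insert (c a) (A j))"
  define e2 where "e2 = insert s (insert (c d) (A i))"
  have e: "e1 \<in> E" "e2 \<in> E" using Cons.prems(4)[of s] B(4) i(1) by (auto simp: e1_def e2_def)
  then have ce: "card e1 = k" "card e2 = k" using edge by blast+
  have AB: "A j \<inter> B = {}" using B(5) by blast
  have i1: "e1 \<inter> B = {c a}" using cB sB AB by (auto simp: e1_def)
  have "c a \<noteq> s" using sB cB by blast
  then have p1: "lpath k E x (B \<union> e1) s"
    using lpath_step[OF B(1) e(1) ce(1) i1, of s] by (auto simp: e1_def)
  have sY: "s \<in> Y" "c a \<in> Y" "B \<subseteq> Y" "A j \<subseteq> Y" using sB cB by (auto simp: Y_def)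
  have e1Y: "e1 \<subseteq> Y" using sY by (auto simp: e1_def)
  have i2: "e2 \<inter> (B \<union> e1) = {s}" using i(4,6) e1Y sY by (auto simp: e1_def e2_def)
  have "c d \<noteq> s" using sY i(6) by blast
  then have p2: "lpath k E x ((B \<union> e1) \<union> e2) (c d)"
    using lpath_step[OF p1 e(2) ce(2) i2, of "c d"] by (auto simp: e2_def)
  have sub: "(B \<union> e1) \<union> e2 \<subseteq> set (s # ss) \<union> (?U - Z)"
  proof -
    have "A j \<subseteq> ?U - Z" using ja B(5) by blast
    moreover have "c a \<in> ?U - Z" using ja cZ by blast
    moreover have "A i \<subseteq> ?U - Z" "c d \<in> ?U - Z" using iu i(4,6) by (auto simp: Y_def)
    ultimately show ?thesis using B(2) by (auto simp: e1_def e2_def)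
  qed
  have cardn: "card ((B \<union> e1) \<union> e2) = 2 * length (s # ss) * (k - 1) + 1"
  proof -
    have fe: "finite e1" "finite e2" using ce k by (auto intro: card_ge_0_finite)
    have "card B + card e1 = card (B \<union> e1) + card (B \<inter> e1)" by (rule card_Un_Int[OF finB fe(1)])
    moreover have "card (B \<union> e1) + card e2 = card ((B \<union> e1) \<union> e2) + card ((B \<union> e1) \<inter> e2)"
      by (rule card_Un_Int) (use finB fe in auto)
    moreover have "B \<inter> e1 = {c a}" "(B \<union> e1) \<inter> e2 = {s}" using i1 i2 by blast+
    ultimately show ?thesis using ce B(3) k by simp
  qed
  have "A i' \<inter> (B \<union> e1 \<union> e2 \<union> Z) = {}"
  proof -
    have "A i' \<inter> e2 = {}" using A(1)[OF iu(2,1)] i(3,5) A(3)[OF iu(2,3)] sY(1) by (auto simp: e2_def)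
    then show ?thesis using i(5) e1Y sY(3) by (auto simp: Y_def)
  qed
  then show ?case using p2 sub cardn i(2) by blast
qed

text \<open>Each path spends \<open>l\<close> vertices of \<open>D\<close>, and finished paths are
  added to the forbidden set. Since \<open>D\<close> lies in \<open>Z\<close>, a path cannot use up
  vertices of \<open>D\<close> beyond those assigned to it.\<close>

lemma disjoint_lpaths:
  fixes A :: "nat \<Rightarrow> 'a set" and c :: "nat \<Rightarrow> 'a" and G :: "(nat \<times> nat) set"
  assumes k: "k \<ge> 3" and kg: "k_graph k V E"
    and A: "\<And>i j. i < u \<Longrightarrow> j < u \<Longrightarrow> i \<noteq> j \<Longrightarrow> A i \<inter> A j = {}"
      "\<And>j. j < u \<Longrightarrow> card (A j) = k - 2" "\<And>j a. j < u \<Longrightarrow> a < u \<Longrightarrow> c a \<notin> A j"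
    and c: "inj_on c {..<u}" and G: "G \<subseteq> {..<u} \<times> {..<u}" and Z: "finite Z"
    and f: "f = 2 * l * (k - 1) + 1"
    and E: "\<And>s j a. s \<in> D \<Longrightarrow> (j, a) \<in> G \<Longrightarrow> insert s (insert (c a) (A j)) \<in> E"
    and D: "D \<subseteq> Z" "q * l \<le> card D"
    and big: "(2 * (card Z + q * f + 2 * l * k + k) + 1) * u < card G"
  shows "\<exists>P. finite P \<and> card P = q \<and> (\<forall>B\<in>P. \<forall>C\<in>P. B \<noteq> C \<longrightarrow> B \<inter> C = {}) \<and>
    (\<forall>B\<in>P. card B = f \<and> (\<exists>x y. lpath k E x B y) \<and> B \<subseteq> D \<union> (((\<Union>j<u. A j) \<union> c ` {..<u}) - Z))"
  using D E big
proof (induction q arbitrary: D)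
  case 0
  then show ?case by (intro exI[of _ "{}"]) simp
next
  case (Suc q)
  let ?U = "(\<Union>j<u. A j) \<union> c ` {..<u}"
  have finD: "finite D" using Suc.prems Z finite_subset by blast
  have "l \<le> card D" using Suc.prems(2) by simp
  then obtain S where S: "S \<subseteq> D" "card S = l" by (meson obtain_subset_with_card_n)
  have finS: "finite S" using S finD finite_subset by blast
  have "(2 * (card Z + q * f + 2 * l * k + k) + 1) * u \<le> (2 * (card Z + Suc q * f + 2 * l * k + k) + 1) * u"
    by (rule mult_le_mono1) simp
  then have bigq: "(2 * (card Z + q * f + 2 * l * k + k) + 1) * u < card G" using Suc.prems(4) by linarith
  have "\<exists>P. finite P \<and> card P = q \<and> (\<forall>B\<in>P. \<forall>C\<in>P. B \<noteq> C \<longrightarrow> B \<inter> C = {}) \<and>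
    (\<forall>B\<in>P. card B = f \<and> (\<exists>x y. lpath k E x B y) \<and> B \<subseteq> (D - S) \<union> (?U - Z))"
  proof (rule Suc.IH)
    show "q * l \<le> card (D - S)" using Suc.prems(2) S finS by (simp add: card_Diff_subset)
    show "D - S \<subseteq> Z" using Suc.prems(1) by blast
    show "(2 * (card Z + q * f + 2 * l * k + k) + 1) * u < card G" by (rule bigq)
    show "insert s (insert (c a) (A j)) \<in> E" if "s \<in> D - S" "(j, a) \<in> G" for s j a
      using Suc.prems(3)[of s j a] that by blast
  qed
  then obtain P where P: "finite P" "card P = q" "\<forall>B\<in>P. \<forall>C\<in>P. B \<noteq> C \<longrightarrow> B \<inter> C = {}"
    "\<forall>B\<in>P. card B = f \<and> (\<exists>x y. lpath k E x B y) \<and> B \<subseteq> (D - S) \<union> (?U - Z)" by (elim exE conjE)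
  obtain ss where ss: "set ss = S" "distinct ss" using finite_distinct_list[OF finS] by blast
  have lss: "length ss = l" using ss S distinct_card by metis
  define Y where "Y = Z \<union> \<Union>P"
  have finP: "finite B" if "B \<in> P" for B using P(4) that f by (intro card_ge_0_finite) simp
  have finY: "finite Y" using Z P(1) finP by (simp add: Y_def)
  have "card (\<Union>P) \<le> q * f"
  proof -
    have "card (\<Union>P) \<le> (\<Sum>B\<in>P. card B)" by (rule card_Union_le_sum_card)
    also have "\<dots> = q * f" using P(2,4) by simp
    finally show ?thesis .
  qed
  then have cY: "card Y \<le> card Z + Suc q * f" using card_Un_le[of Z "\<Union>P"] by (simp add: Y_def)
  then have "(2 * (card Y + 2 * l * k + k) + 1) * u \<le> (2 * (card Z + Suc q * f + 2 * l * k + k) + 1) * u"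
    by (intro mult_le_mono1) simp
  then have bY: "(2 * (card Y + 2 * l * k + k) + 1) * u < card G" using Suc.prems(4) by linarith
  have "\<exists>x B a j. lpath k E x B (c a) \<and> B \<subseteq> set ss \<union> (?U - Y) \<and>
    card B = 2 * length ss * (k - 1) + 1 \<and> (j, a) \<in> G \<and> A j \<inter> (B \<union> Y) = {}"
  proof (rule lpath_through[OF k kg A c G finY ss(2) _ _ _ bY])
    show "set ss \<subseteq> Y" using ss S Suc.prems(1) by (auto simp: Y_def)
    show "length ss \<le> l" using lss by simp
    show "insert s (insert (c a) (A j)) \<in> E" if "s \<in> set ss" "(j, a) \<in> G" for s j a
      using Suc.prems(3)[of s j a] that ss S by blast
  qed
  then obtain x B a where B: "lpath k E x B (c a)" "B \<subseteq> S \<union> (?U - Y)" "card B = f"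
    using ss lss f by (elim exE conjE) simp
  have dis: "B \<inter> C = {}" if "C \<in> P" for C
  proof -
    have "C \<subseteq> (D - S) \<union> (?U - Z)" "C \<subseteq> Y" using P(4) that by (auto simp: Y_def)
    moreover have "S \<subseteq> Z" using S Suc.prems(1) by blast
    ultimately show ?thesis using B(2) by blast
  qed
  have "B \<noteq> {}" using B(3) f by auto
  then have "B \<notin> P" using dis[of B] by blast
  show ?case
  proof (intro exI[of _ "insert B P"] conjI ballI impI)
    show "finite (insert B P)" "card (insert B P) = Suc q" using P(1,2) \<open>B \<notin> P\<close> by auto
    show "X \<inter> Y = {}" if "X \<in> insert B P" "Y \<in> insert B P" "X \<noteq> Y" for X Y
      using that dis P(3) by (metis Int_commute insert_iff)
    show "card X = f" if "X \<in> insert B P" for X using that P(4) B(3) by auto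
    show "\<exists>x y. lpath k E x X y" if "X \<in> insert B P" for X using that P(4) B(1) by auto
    show "X \<subseteq> D \<union> (?U - Z)" if "X \<in> insert B P" for X
    proof (cases "X = B")
      case True
      then show ?thesis using B(2) S by (auto simp: Y_def)
    next
      case False
      then have "X \<subseteq> (D - S) \<union> (?U - Z)" using that P(4) by blast
      then show ?thesis by blast
    qed
  qed
qed

lemma common_rich_blocks:
  fixes N :: "'q \<Rightarrow> 'a set" and \<theta> g :: real
  assumes B: "finite \<B>" "\<And>B. B \<in> \<B> \<Longrightarrow> card B = f" "f > 0"
    and Q: "finite Q" "Q \<noteq> {}" and \<theta>: "\<theta> > 0"
    and rich: "\<And>q. q \<in> Q \<Longrightarrow> \<theta> * card \<B> \<le> card {B \<in> \<B>. g \<le> card (B \<inter> N q)}"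
    and big: "2 * real c \<le> \<theta> * card \<B>"
  shows "\<exists>\<C> G. \<C> \<subseteq> \<B> \<and> card \<C> = c \<and> G \<subseteq> Q \<and> (\<theta> / 2 / 2 ^ f) ^ c * card Q \<le> card G \<and>
    (\<forall>B\<in>\<C>. \<exists>J. J \<subseteq> B \<and> g \<le> card J \<and> (\<forall>q\<in>G. J \<subseteq> N q))"
  using big
proof (induction c)
  case 0
  then show ?case by (intro exI[of _ "{}"] exI[of _ Q]) simp
next
  case (Suc c)
  then have "2 * real c \<le> \<theta> * card \<B>" by simp
  then obtain \<C> G where C: "\<C> \<subseteq> \<B>" "card \<C> = c" "G \<subseteq> Q" "(\<theta> / 2 / 2 ^ f) ^ c * card Q \<le> card G"
    "\<forall>B\<in>\<C>. \<exists>J. J \<subseteq> B \<and> g \<le> card J \<and> (\<forall>q\<in>G. J \<subseteq> N q)" using Suc.IH by blast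
  have finC: "finite \<C>" and finG: "finite G" using C B Q finite_subset by blast+
  have "card Q > 0" using Q by (simp add: card_gt_0_iff)
  then have "(\<theta> / 2 / 2 ^ f) ^ c * card Q > 0" using \<theta> by simp
  then have G0: "real (card G) > 0" using C(4) by linarith
  define m where "m = real (card \<B>)"
  have m0: "m > 0"
  proof -
    have "0 < \<theta> * card \<B>" using Suc.prems by simp
    then show ?thesis using \<theta> by (simp add: m_def zero_less_mult_iff)
  qed
  define X where "X B = {q \<in> G. g \<le> card (B \<inter> N q)}" for B
  have "(\<Sum>B\<in>\<B> - \<C>. real (card (X B))) = (\<Sum>q\<in>G. real (card {B \<in> \<B> - \<C>. g \<le> card (B \<inter> N q)}))"
  proof -
    have "(\<Sum>B\<in>\<B> - \<C>. real (card (X B))) = (\<Sum>B\<in>\<B> - \<C>. \<Sum>q\<in>G. if g \<le> card (B \<inter> N q) then 1 else 0)"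
      using finG by (intro sum.cong) (auto simp: X_def sum.If_cases Int_def)
    also have "\<dots> = (\<Sum>q\<in>G. \<Sum>B\<in>\<B> - \<C>. if g \<le> card (B \<inter> N q) then 1 else 0)" by (rule sum.swap)
    also have "\<dots> = (\<Sum>q\<in>G. real (card {B \<in> \<B> - \<C>. g \<le> card (B \<inter> N q)}))"
      using B(1) by (intro sum.cong) (auto simp: sum.If_cases Int_def)
    finally show ?thesis .
  qed
  \<comment> \<open>Excluding the \<open>c\<close> blocks already used costs at most half of the
    rich blocks of any \<open>q\<close>, because
    \<open>2 * real (Suc c) \<le> \<theta> * card \<B>\<close>.\<close>
  moreover have "real (card G) * (\<theta> * m / 2) \<le> (\<Sum>q\<in>G. real (card {B \<in> \<B> - \<C>. g \<le> card (B \<inter> N q)}))"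
  proof (rule sum_bounded_below)
    fix q assume "q \<in> G"
    then have "\<theta> * m \<le> card {B \<in> \<B>. g \<le> card (B \<inter> N q)}" using rich C(3) by (auto simp: m_def)
    moreover have "card {B \<in> \<B>. g \<le> card (B \<inter> N q)} \<le> card ({B \<in> \<B> - \<C>. g \<le> card (B \<inter> N q)} \<union> \<C>)"
      using B(1) finC by (intro card_mono) auto
    moreover have "\<dots> \<le> card {B \<in> \<B> - \<C>. g \<le> card (B \<inter> N q)} + c" using card_Un_le[of "{B \<in> \<B> - \<C>. g \<le> card (B \<inter> N q)}" \<C>] C(2) by simp
    ultimately show "\<theta> * m / 2 \<le> card {B \<in> \<B> - \<C>. g \<le> card (B \<inter> N q)}"
      using Suc.prems by (simp add: m_def)
  qed
  ultimately have tot: "real (card G) * (\<theta> * m / 2) \<le> (\<Sum>B\<in>\<B> - \<C>. real (card (X B)))" by simp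
  have "\<exists>B\<in>\<B> - \<C>. real (card G) * (\<theta> / 2) \<le> card (X B)"
  proof (rule ccontr)
    assume "\<not> ?thesis"
    then have lt: "\<And>B. B \<in> \<B> - \<C> \<Longrightarrow> real (card (X B)) < real (card G) * (\<theta> / 2)" by (metis not_le)
    have pos: "0 < real (card G) * (\<theta> * m / 2)" using G0 \<theta> m0 by simp
    then have "\<B> - \<C> \<noteq> {}" using tot by (metis not_le sum.empty)
    then have "(\<Sum>B\<in>\<B> - \<C>. real (card (X B))) < (\<Sum>B\<in>\<B> - \<C>. real (card G) * (\<theta> / 2))"
      using lt B(1) by (intro sum_strict_mono) auto
    also have "\<dots> = real (card (\<B> - \<C>)) * (real (card G) * (\<theta> / 2))" by simp
    also have "\<dots> \<le> m * (real (card G) * (\<theta> / 2))"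
      using G0 \<theta> card_mono[OF B(1), of "\<B> - \<C>"] by (intro mult_right_mono) (auto simp: m_def)
    finally show False using tot by (simp add: algebra_simps)
  qed
  then obtain B where B': "B \<in> \<B>" "B \<notin> \<C>" "real (card G) * (\<theta> / 2) \<le> card (X B)" by blast
  have finB: "finite B" using B(2,3) B'(1) by (intro card_ge_0_finite) simp
  have finX: "finite (X B)" using finG by (simp add: X_def)
  \<comment> \<open>Splits the elements for which \<open>B\<close> is rich according to their trace
    on \<open>B\<close>.\<close>
  have cX: "card (X B) = (\<Sum>J\<in>Pow B. card {q \<in> X B. B \<inter> N q = J})"
  proof -
    have "q \<in> (\<Union>J\<in>Pow B. {q \<in> X B. B \<inter> N q = J})" if "q \<in> X B" for q
      by (rule UN_I[of "B \<inter> N q"]) (use that in simp_all)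
    then have "X B = (\<Union>J\<in>Pow B. {q \<in> X B. B \<inter> N q = J})" by blast
    then have "card (X B) = card (\<Union>J\<in>Pow B. {q \<in> X B. B \<inter> N q = J})" by (rule arg_cong)
    also have "\<dots> = (\<Sum>J\<in>Pow B. card {q \<in> X B. B \<inter> N q = J})"
    proof (rule card_UN_disjoint)
      show "finite (Pow B)" using finB by simp
      show "\<forall>J\<in>Pow B. finite {q \<in> X B. B \<inter> N q = J}" using finX by simp
    qed blast
    finally show ?thesis .
  qed
  have "\<exists>J\<in>Pow B. real (card (X B)) / 2 ^ f \<le> card {q \<in> X B. B \<inter> N q = J}"
  proof (rule ccontr)
    assume "\<not> ?thesis"
    then have "real (card {q \<in> X B. B \<inter> N q = J}) < real (card (X B)) / 2 ^ f" if "J \<in> Pow B" for J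
      using that by (metis not_le)
    then have "(\<Sum>J\<in>Pow B. real (card {q \<in> X B. B \<inter> N q = J})) < (\<Sum>J\<in>Pow B. real (card (X B)) / 2 ^ f)"
      using finB by (intro sum_strict_mono) auto
    also have "\<dots> = card (X B)" using finB B(2)[OF B'(1)] by (simp add: card_Pow)
    finally show False using cX by (simp flip: of_nat_sum)
  qed
  then obtain J where J: "J \<subseteq> B" "real (card (X B)) / 2 ^ f \<le> card {q \<in> X B. B \<inter> N q = J}" by blast
  define G' where "G' = {q \<in> X B. B \<inter> N q = J}"
  have XB0: "real (card (X B)) > 0" using B'(3) G0 \<theta> by (smt (verit) divide_pos_pos mult_pos_pos)
  have "real (card (X B)) / 2 ^ f > 0" using XB0 by simp
  then have "real (card G') > 0" using J(2) by (simp add: G'_def)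
  then have "G' \<noteq> {}" by auto
  then obtain q0 where "q0 \<in> G'" by blast
  then have gJ: "g \<le> card J" by (auto simp: G'_def X_def)
  have "(\<theta> / 2 / 2 ^ f) ^ Suc c * card Q = (\<theta> / 2 / 2 ^ f) * ((\<theta> / 2 / 2 ^ f) ^ c * card Q)" by simp
  also have "\<dots> \<le> (\<theta> / 2 / 2 ^ f) * card G" using C(4) \<theta> by (intro mult_left_mono) auto
  also have "\<dots> = (real (card G) * (\<theta> / 2)) / 2 ^ f" by simp
  also have "\<dots> \<le> real (card (X B)) / 2 ^ f" using B'(3) by (intro divide_right_mono) auto
  also have "\<dots> \<le> card G'" using J(2) by (simp add: G'_def)
  finally have cG': "(\<theta> / 2 / 2 ^ f) ^ Suc c * card Q \<le> card G'" .
  show ?case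
  proof (intro exI[of _ "insert B \<C>"] exI[of _ G'] conjI ballI)
    show "insert B \<C> \<subseteq> \<B>" "card (insert B \<C>) = Suc c" using B' C(1,2) finC by auto
    show "G' \<subseteq> Q" using C(3) by (auto simp: G'_def X_def)
    show "(\<theta> / 2 / 2 ^ f) ^ Suc c * card Q \<le> card G'" by (rule cG')
    show "\<exists>J. J \<subseteq> Y \<and> g \<le> card J \<and> (\<forall>q\<in>G'. J \<subseteq> N q)" if "Y \<in> insert B \<C>" for Y
    proof (cases "Y = B")
      case True
      then show ?thesis using J(1) gJ by (intro exI[of _ J]) (auto simp: G'_def)
    next
      case False
      then have "Y \<in> \<C>" using that by simp
      then obtain J' where J': "J' \<subseteq> Y" "g \<le> card J'" "\<forall>q\<in>G. J' \<subseteq> N q" using C(5) by meson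
      have "q \<in> G" if "q \<in> G'" for q using that by (simp add: G'_def X_def)
      then have "\<forall>q\<in>G'. J' \<subseteq> N q" using J'(3) by simp
      then show ?thesis using J'(1,2) by blast
    qed
  qed
qed

lemma disjoint_subsets:
  assumes "finite U" "m * r \<le> card U"
  shows "\<exists>A :: nat \<Rightarrow> 'a set. (\<forall>j<m. A j \<subseteq> U \<and> card (A j) = r) \<and> (\<forall>i<m. \<forall>j<m. i \<noteq> j \<longrightarrow> A i \<inter> A j = {})"
  using assms
proof (induction m arbitrary: U)
  case 0
  then show ?case by simp
next
  case (Suc m)
  have "r \<le> card U" using Suc.prems by simp
  then obtain S where S: "S \<subseteq> U" "card S = r" by (meson obtain_subset_with_card_n)
  have "m * r \<le> card (U - S)"
    using Suc.prems S finite_subset[OF S(1)] by (simp add: card_Diff_subset)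
  then obtain A where A: "\<forall>j<m. A j \<subseteq> U - S \<and> card (A j) = r" "\<forall>i<m. \<forall>j<m. i \<noteq> j \<longrightarrow> A i \<inter> A j = {}"
    using Suc.IH[of "U - S"] Suc.prems by auto
  have dS: "A j \<inter> S = {}" if "j < m" for j using A(1) that by blast
  show ?case
  proof (intro exI[of _ "A(m := S)"] conjI allI impI)
    show "(A(m := S)) j \<subseteq> U" "card ((A(m := S)) j) = r" if "j < Suc m" for j
      using that A(1) S by (auto simp: less_Suc_eq)
    show "(A(m := S)) i \<inter> (A(m := S)) j = {}" if ij: "i < Suc m" "j < Suc m" "i \<noteq> j" for i j
    proof -
      consider "i = m" "j < m" | "j = m" "i < m" | "i < m" "j < m" using ij by linarith
      then show ?thesis
      proof cases
        case 1 then show ?thesis using dS[of j] by (simp add: Int_commute)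
      next
        case 2 then show ?thesis using dS[of i] by simp
      next
        case 3 then show ?thesis using A(2) ij(3) by simp
      qed
    qed
  qed
qed

text \<open>If a largest family of disjoint paths leaves too many vertices \<open>U\<close> uncovered, then some
  \<open>c\<close> blocks have a common dense set of neighbouring \<open>(k - 1)\<close>-subsets of \<open>U\<close>, in more than
  a proportion \<open>1 / (2 (k - 1))\<close> of their vertices. As every second joint of a path may be one of
  these vertices, the rest being taken from \<open>U\<close>, the \<open>c\<close> blocks can be traded for \<open>c + 1\<close> paths.\<close>

lemma almost_tiling:
  fixes V :: "'a set" and \<eta> \<epsilon> :: real
  assumes k: "k \<ge> 3" and kg: "k_graph k V E" and n: "n = card V"
    and deg: "\<And>T. T \<subseteq> V \<Longrightarrow> card T = k - 1 \<Longrightarrow> (1 / (2 * (real k - 1)) + \<eta>) * n \<le> card (neighbourhood V E T)"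
    and \<eta>: "\<eta> > 0" and f: "f = 2 * l * (k - 1) + 1"
    and c: "1 \<le> \<eta> * c" and u: "real (2 * (c * f + (c + 1) * f + 2 * l * k + k) + 1) < (\<eta> / 4 / 2 / 2 ^ f) ^ c * u"
    and big: "real (u * (k - 1)) \<le> \<epsilon> * n" "real f \<le> \<eta> * n / 2" "2 * real c \<le> \<eta> / 4 * (real n / f - 1)"
  shows "\<exists>\<T>. (\<forall>B\<in>\<T>. B \<subseteq> V \<and> card B = f \<and> (\<exists>x y. lpath k E x B y)) \<and>
    (\<forall>B\<in>\<T>. \<forall>C\<in>\<T>. B \<noteq> C \<longrightarrow> B \<inter> C = {}) \<and> card (V - \<Union>\<T>) < \<epsilon> * n"
proof -
  have finV: "finite V" using kg by (simp add: k_graph_def)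
  have f0: "f > 0" using f by simp
  define tl where "tl \<T> \<longleftrightarrow> (\<forall>B\<in>\<T>. B \<subseteq> V \<and> card B = f \<and> (\<exists>x y. lpath k E x B y)) \<and>
    (\<forall>B\<in>\<T>. \<forall>C\<in>\<T>. B \<noteq> C \<longrightarrow> B \<inter> C = {})" for \<T>
  have "\<exists>\<T>. tl \<T> \<and> (\<forall>\<T>'. tl \<T>' \<longrightarrow> card \<T>' \<le> card \<T>)"
  proof -
    have "tl {}" by (simp add: tl_def)
    moreover have "card \<T> \<le> card (Pow V)" if "tl \<T>" for \<T>
      by (rule card_mono) (use that finV in \<open>auto simp: tl_def\<close>)
    ultimately have "\<exists>m. (\<exists>\<T>. tl \<T> \<and> card \<T> = m) \<and> (\<forall>m'. (\<exists>\<T>. tl \<T> \<and> card \<T> = m') \<longrightarrow> m' \<le> m)"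
      by (intro Nat.ex_has_greatest_nat[of _ "card {}" "card (Pow V)"]) auto
    then show ?thesis by metis
  qed
  then obtain \<T> where T: "tl \<T>" "\<And>\<T>'. tl \<T>' \<Longrightarrow> card \<T>' \<le> card \<T>" by blast
  have Tsub: "B \<subseteq> V" "card B = f" if "B \<in> \<T>" for B using T(1) that by (auto simp: tl_def)
  have Tdis: "B \<inter> C = {}" if "B \<in> \<T>" "C \<in> \<T>" "B \<noteq> C" for B C using T(1) that by (simp add: tl_def)
  define U where "U = V - \<Union>\<T>"
  have finU: "finite U" using finV by (simp add: U_def)
  have "card U < \<epsilon> * n"
  proof (rule ccontr)
    assume "\<not> ?thesis"
    then have "real (u * (k - 1)) \<le> card U" using big(1) by linarith
    then have Uu: "u * (k - 1) \<le> card U" by linarith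
    have "(card U div f) * f \<le> card U" by simp
    from disjoint_subsets[OF finU this] obtain D where D: "\<forall>j<card U div f. D j \<subseteq> U \<and> card (D j) = f"
      "\<forall>i<card U div f. \<forall>j<card U div f. i \<noteq> j \<longrightarrow> D i \<inter> D j = {}"
      by (elim exE conjE)
    define \<D> where "\<D> = D ` {..<card U div f}"
    have Dsub: "B \<subseteq> U" "card B = f" if "B \<in> \<D>" for B using D(1) that by (auto simp: \<D>_def)
    have Ddis: "B \<inter> C = {}" if bc: "B \<in> \<D>" "C \<in> \<D>" "B \<noteq> C" for B C
    proof -
      obtain i j where ij: "i < card U div f" "j < card U div f" "B = D i" "C = D j"
        using bc(1,2) by (auto simp: \<D>_def)
      then have "i \<noteq> j" using bc(3) by blast
      then show ?thesis using D(2) ij by simp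
    qed
    \<comment> \<open>Neighbours may lie in \<open>U\<close> itself, so \<open>U\<close> is cut into
      blocks as well and \<B> misses fewer than \<open>f\<close> vertices. Blocks from \<D> need not
      be paths; trading them away costs no path at all.\<close>
    define \<B> where "\<B> = \<T> \<union> \<D>"
    have Bsub: "B \<subseteq> V" "card B = f" if "B \<in> \<B>" for B
      using that Tsub[of B] Dsub[of B] by (auto simp: \<B>_def U_def)
    have Bdis: "B \<inter> C = {}" if "B \<in> \<B>" "C \<in> \<B>" "B \<noteq> C" for B C
    proof -
      have TD: "X \<inter> Y = {}" if "X \<in> \<T>" "Y \<in> \<D>" for X Y using Dsub(1)[OF that(2)] that(1) by (auto simp: U_def)
      show ?thesis
        using that Tdis[of B C] Ddis[of B C] TD[of B C] TD[of C B] by (auto simp: \<B>_def Int_commute)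
    qed
    have finB: "finite \<B>" by (rule finite_subset[of _ "Pow V"]) (use Bsub finV in auto)
    have rest: "card (V - \<Union>\<B>) < f"
    proof -
      have "card (\<Union>\<D>) = card U div f * f"
      proof -
        have "card (\<Union>j<card U div f. D j) = (\<Sum>j<card U div f. card (D j))"
          by (rule card_UN_disjoint) (use D f0 in \<open>auto intro!: card_ge_0_finite\<close>)
        then show ?thesis using D(1) by (simp add: \<D>_def)
      qed
      moreover have "\<Union>\<D> \<subseteq> U" using Dsub by blast
      moreover have "V - \<Union>\<B> = U - \<Union>\<D>" by (auto simp: \<B>_def U_def)
      ultimately have "card (V - \<Union>\<B>) = card U - card U div f * f"
        using finite_subset[OF _ finU] by (simp add: card_Diff_subset)
      also have "\<dots> = card U mod f" by (simp add: minus_div_mult_eq_mod)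
      also have "\<dots> < f" using f0 by simp
      finally show ?thesis .
    qed
    define m where "m = card \<B>"
    have cU: "card (\<Union>\<B>) = m * f"
    proof -
      have "card (\<Union>\<B>) = (\<Sum>B\<in>\<B>. card B)"
      proof (rule card_Union_disjoint)
        show "pairwise disjnt \<B>" using Bdis by (auto simp: pairwise_def disjnt_def)
        show "finite B" if "B \<in> \<B>" for B using Bsub(1)[OF that] finV by (rule finite_subset)
      qed
      then show ?thesis using Bsub(2) by (simp add: m_def)
    qed
    have "\<Union>\<B> \<subseteq> V" using Bsub(1) by blast
    then have "card (V - \<Union>\<B>) = n - m * f" "m * f \<le> n"
      using cU n card_mono[OF finV, of "\<Union>\<B>"] finite_subset[OF _ finV] by (auto simp: card_Diff_subset)
    then have mf: "m * f \<le> n" "n < m * f + f" using rest by linarith+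
    have "real n < (real m + 1) * f"
    proof -
      have "real n < real (m * f + f)" using mf(2) by (simp only: of_nat_less_iff)
      then show ?thesis by (simp add: algebra_simps)
    qed
    then have "real n / f - 1 < m" using f0 by (simp add: field_simps)
    then have "\<eta> / 4 * (real n / f - 1) \<le> \<eta> / 4 * m" using \<eta> by (intro mult_left_mono) auto
    then have mc: "2 * real c \<le> \<eta> / 4 * m" using big(3) by linarith
    \<comment> \<open>\<open>U\<close> has room for \<open>u\<close> single vertices
      \<open>h a\<close> and \<open>u\<close> disjoint blocks \<open>A j\<close> of size
      \<open>k - 2\<close>. Each pair forms a \<open>(k - 1)\<close>-set, and these pairs are the
      set \<open>Q\<close> of the pigeonhole argument.\<close>
    have "k - 1 = Suc (k - 2)" using k by simp
    then have "u * 1 + u * (k - 2) = u * (k - 1)" by simp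
    then have uU: "u + u * (k - 2) \<le> card U" using Uu by simp
    then have "u \<le> card U" by simp
    then obtain U1 where U1: "U1 \<subseteq> U" "card U1 = u" by (meson obtain_subset_with_card_n)
    have finU1: "finite U1" using U1 finU finite_subset by blast
    obtain h where h: "bij_betw h {0..<u} U1" using ex_bij_betw_nat_finite[OF finU1] U1(2) by blast
    then have hi: "inj_on h {..<u}" "h ` {..<u} = U1" by (simp_all add: bij_betw_def lessThan_atLeast0)
    have "u * (k - 2) \<le> card (U - U1)" using uU U1 finU1 by (simp add: card_Diff_subset)
    from disjoint_subsets[OF _ this] obtain A where A: "\<forall>j<u. A j \<subseteq> U - U1 \<and> card (A j) = k - 2"
      "\<forall>i<u. \<forall>j<u. i \<noteq> j \<longrightarrow> A i \<inter> A j = {}"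
      using finU by (elim exE conjE meta_impE) auto
    have hU: "h a \<in> U1" if "a < u" for a using hi(2) that by auto
    have hA: "h a \<notin> A j" if "j < u" "a < u" for a j using A(1) hU that by blast
    define q where "q = 1 / (2 * (real k - 1))"
    define N where "N p = neighbourhood V E (insert (h (snd p)) (A (fst p)))" for p
    define Q where "Q = {..<u} \<times> {..<u}"
    have u0: "u > 0"
    proof (rule ccontr)
      assume "\<not> u > 0"
      then have "real (2 * (c * f + (c + 1) * f + 2 * l * k + k) + 1) < 0" using u by simp
      then show False by linarith
    qed
    \<comment> \<open>Averaging: of the degree \<open>(q + \<eta>) * n\<close>, at most
      \<open>\<eta> * n / 2\<close> lies outside the blocks, and a block that is not rich
      contributes at most \<open>(q + \<eta> / 4) * f\<close>. The missing
      \<open>\<eta> / 4 * m * f\<close> comes from rich blocks, each giving at most \<open>f\<close>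
      more.\<close>
    have rich: "\<eta> / 4 * card \<B> \<le> card {B \<in> \<B>. (q + \<eta> / 4) * f \<le> card (B \<inter> N p)}" if p: "p \<in> Q" for p
    proof -
      let ?R = "{B \<in> \<B>. (q + \<eta> / 4) * f \<le> card (B \<inter> N p)}"
      have pu: "fst p < u" "snd p < u" using p by (auto simp: Q_def)
      have Ap: "A (fst p) \<subseteq> U" "card (A (fst p)) = k - 2" using A(1) pu by auto
      have "card (insert (h (snd p)) (A (fst p))) = k - 1"
        using hA[OF pu] Ap finite_subset[OF Ap(1) finU] k by simp
      moreover have "insert (h (snd p)) (A (fst p)) \<subseteq> V" using Ap hU[OF pu(2)] U1(1) by (auto simp: U_def)
      ultimately have dN: "(q + \<eta>) * n \<le> card (N p)" using deg by (simp add: N_def q_def)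
      have NV: "N p \<subseteq> V" by (auto simp: N_def neighbourhood_def)
      have "card (N p) \<le> card ((\<Union>B\<in>\<B>. B \<inter> N p) \<union> (V - \<Union>\<B>))"
        by (rule card_mono) (use NV finV in \<open>auto intro: finite_subset[of _ V]\<close>)
      also have "\<dots> \<le> card (\<Union>B\<in>\<B>. B \<inter> N p) + card (V - \<Union>\<B>)" by (rule card_Un_le)
      also have "\<dots> \<le> (\<Sum>B\<in>\<B>. card (B \<inter> N p)) + f" using card_UN_le[OF finB, of "\<lambda>B. B \<inter> N p"] rest by linarith
      finally have "real (card (N p)) \<le> (\<Sum>B\<in>\<B>. real (card (B \<inter> N p))) + f" by (simp flip: of_nat_sum of_nat_add)
      moreover have "(\<Sum>B\<in>\<B>. real (card (B \<inter> N p))) \<le> (\<Sum>B\<in>\<B>. (q + \<eta> / 4) * f + (if B \<in> ?R then real f else 0))"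
      proof (rule sum_mono)
        fix B assume B: "B \<in> \<B>"
        have "card (B \<inter> N p) \<le> f" using Bsub[OF B] finV finite_subset card_mono[of B "B \<inter> N p"] by auto
        moreover have "(q + \<eta> / 4) * f \<ge> 0" using \<eta> k by (simp add: q_def)
        ultimately show "real (card (B \<inter> N p)) \<le> (q + \<eta> / 4) * f + (if B \<in> ?R then real f else 0)"
          using B by auto
      qed
      moreover have "(\<Sum>B\<in>\<B>. (q + \<eta> / 4) * f + (if B \<in> ?R then real f else 0)) = m * ((q + \<eta> / 4) * f) + card ?R * f"
        using finB by (simp add: sum.distrib sum.If_cases m_def Int_def conj_ac)
      moreover have "(q + \<eta>) * n - f \<ge> (q + \<eta> / 2) * (m * f)"
      proof -
        have "(q + \<eta> / 2) * (m * f) \<le> (q + \<eta> / 2) * n"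
          using mf(1) \<eta> k by (intro mult_left_mono) (auto simp: q_def simp flip: of_nat_mult)
        also have "\<dots> = (q + \<eta>) * n - \<eta> * n / 2" by (simp add: algebra_simps)
        finally show ?thesis using big(2) by linarith
      qed
      ultimately have "(q + \<eta> / 2) * (m * f) \<le> m * ((q + \<eta> / 4) * f) + card ?R * f" using dN by linarith
      then have "(\<eta> / 4 * m) * f \<le> card ?R * f" by (simp add: algebra_simps)
      then show ?thesis using f0 by (simp add: m_def)
    qed
    have Qf: "finite Q" "Q \<noteq> {}" "card Q = u * u" using u0 by (auto simp: Q_def)
    have "\<exists>\<C> G. \<C> \<subseteq> \<B> \<and> card \<C> = c \<and> G \<subseteq> Q \<and> (\<eta> / 4 / 2 / 2 ^ f) ^ c * card Q \<le> card G \<and>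
      (\<forall>B\<in>\<C>. \<exists>J. J \<subseteq> B \<and> (q + \<eta> / 4) * f \<le> card J \<and> (\<forall>p\<in>G. J \<subseteq> N p))"
      by (rule common_rich_blocks[OF finB Bsub(2) f0 Qf(1,2) _ rich]) (use \<eta> mc in \<open>auto simp: m_def\<close>)
    then obtain \<C> G where C: "\<C> \<subseteq> \<B>" "card \<C> = c" "G \<subseteq> Q" "(\<eta> / 4 / 2 / 2 ^ f) ^ c * card Q \<le> card G"
      "\<forall>B\<in>\<C>. \<exists>J. J \<subseteq> B \<and> (q + \<eta> / 4) * f \<le> card J \<and> (\<forall>p\<in>G. J \<subseteq> N p)" by (elim exE conjE)
    from C(5) obtain J where J: "\<forall>B\<in>\<C>. J B \<subseteq> B \<and> (q + \<eta> / 4) * f \<le> card (J B) \<and> (\<forall>p\<in>G. J B \<subseteq> N p)"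
      by metis
    have finC: "finite \<C>" using C(1) finB finite_subset by blast
    define S where "S = (\<Union>B\<in>\<C>. J B)"
    define Z where "Z = \<Union>\<C>"
    have SZ: "S \<subseteq> Z" unfolding S_def Z_def using J by blast
    have ZV: "Z \<subseteq> V" using C(1) Bsub(1) by (auto simp: Z_def)
    have finZ: "finite Z" using ZV finV finite_subset by blast
    have cZ: "card Z \<le> c * f"
    proof -
      have "card Z \<le> (\<Sum>B\<in>\<C>. card B)" unfolding Z_def by (rule card_Union_le_sum_card)
      also have "\<dots> = c * f" using C(1,2) Bsub(2) by (simp add: subset_iff)
      finally show ?thesis .
    qed
    \<comment> \<open>A path of \<open>f = 2 * l * (k - 1) + 1\<close> vertices needs only
      \<open>l\<close> of them from \<open>S\<close>, and \<open>q * f \<ge> l\<close>: this is the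
      origin of the constant \<open>1 / (2 * (k - 1))\<close>. The excess
      \<open>\<eta> / 4 * f \<ge> \<eta> * l\<close> of each block, taken over
      \<open>c \<ge> 1 / \<eta>\<close> blocks, pays for one path more.\<close>
    have cS: "(c + 1) * l \<le> card S"
    proof -
      have finJ: "finite (J B)" if "B \<in> \<C>" for B
      proof (rule finite_subset[OF _ finZ])
        have "J B \<subseteq> B" using J that by blast
        then show "J B \<subseteq> Z" using that by (auto simp: Z_def)
      qed
      have "card S = (\<Sum>B\<in>\<C>. card (J B))"
        unfolding S_def
      proof (rule card_UN_disjoint[OF finC])
        show "\<forall>B\<in>\<C>. finite (J B)" using finJ by blast
        show "\<forall>B\<in>\<C>. \<forall>B'\<in>\<C>. B \<noteq> B' \<longrightarrow> J B \<inter> J B' = {}"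
        proof (intro ballI impI)
          fix B B' assume b: "B \<in> \<C>" "B' \<in> \<C>" "B \<noteq> B'"
          then have "B \<inter> B' = {}" using Bdis C(1) by blast
          then show "J B \<inter> J B' = {}" using J b by blast
        qed
      qed
      then have "real (card S) = (\<Sum>B\<in>\<C>. real (card (J B)))" by simp
      moreover have "\<dots> \<ge> real (card \<C>) * ((q + \<eta> / 4) * f)" by (rule sum_bounded_below) (use J in auto)
      ultimately have "real c * ((q + \<eta> / 4) * f) \<le> card S" using C(2) by simp
      moreover have "real l * (1 + \<eta>) \<le> (q + \<eta> / 4) * f"
      proof -
        have k1: "real k - 1 \<ge> 2" using k by simp
        have fr: "real f = 2 * l * (real k - 1) + 1" using f k by (simp add: of_nat_diff)
        have "q * f = l + q" using k1 by (simp add: q_def fr field_simps)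
        then have "q * f \<ge> l" using k1 by (simp add: q_def)
        moreover have "\<eta> / 4 * f \<ge> \<eta> * l"
        proof -
          have "real l * 2 \<le> real l * (real k - 1)" using k1 by (intro mult_left_mono) auto
          then have "4 * real l \<le> f" unfolding fr by linarith
          then have "\<eta> / 4 * (4 * real l) \<le> \<eta> / 4 * f" using \<eta> by (intro mult_left_mono) auto
          then show ?thesis by simp
        qed
        ultimately show ?thesis by (simp add: algebra_simps)
      qed
      then have "real c * (real l * (1 + \<eta>)) \<le> real c * ((q + \<eta> / 4) * f)" by (rule mult_left_mono) simp
      moreover have "real ((c + 1) * l) \<le> real c * (real l * (1 + \<eta>))"
      proof -
        have "1 * real l \<le> (\<eta> * c) * l" using c by (rule mult_right_mono) simp
        then show ?thesis by (simp add: algebra_simps)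
      qed
      ultimately have "real ((c + 1) * l) \<le> card S" by linarith
      then show ?thesis by linarith
    qed
    \<comment> \<open>\<open>G\<close> contains a fixed proportion of the \<open>u * u\<close>
      pairs, while the forbidden vertices spoil a number only linear in \<open>u\<close>.\<close>
    have "(2 * (card Z + (c + 1) * f + 2 * l * k + k) + 1) * u < card G"
    proof -
      have "real (2 * (card Z + (c + 1) * f + 2 * l * k + k) + 1) \<le> real (2 * (c * f + (c + 1) * f + 2 * l * k + k) + 1)"
        using cZ by (simp only: of_nat_le_iff) simp
      then have "real (2 * (card Z + (c + 1) * f + 2 * l * k + k) + 1) < (\<eta> / 4 / 2 / 2 ^ f) ^ c * u" using u by linarith
      then have "real (2 * (card Z + (c + 1) * f + 2 * l * k + k) + 1) * u < ((\<eta> / 4 / 2 / 2 ^ f) ^ c * u) * u"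
        using u0 by (intro mult_strict_right_mono) auto
      also have "\<dots> \<le> card G" using C(4) Qf(3) by (simp add: mult.assoc)
      finally show ?thesis by (simp only: of_nat_less_iff flip: of_nat_mult)
    qed
    note bigG = this
    have "\<exists>P. finite P \<and> card P = c + 1 \<and> (\<forall>B\<in>P. \<forall>C\<in>P. B \<noteq> C \<longrightarrow> B \<inter> C = {}) \<and>
      (\<forall>B\<in>P. card B = f \<and> (\<exists>x y. lpath k E x B y) \<and> B \<subseteq> S \<union> (((\<Union>j<u. A j) \<union> h ` {..<u}) - Z))"
    proof (rule disjoint_lpaths[OF k kg _ _ _ hi(1) _ finZ f _ SZ cS bigG])
      show "A i \<inter> A j = {}" if "i < u" "j < u" "i \<noteq> j" for i j using A(2) that by blast
      show "card (A j) = k - 2" if "j < u" for j using A(1) that by blast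
      show "h a \<notin> A j" if "j < u" "a < u" for j a using hA that by blast
      show "G \<subseteq> {..<u} \<times> {..<u}" using C(3) by (simp add: Q_def)
      show "insert s (insert (h a) (A j)) \<in> E" if sj: "s \<in> S" "(j, a) \<in> G" for s j a
      proof -
        obtain B where "B \<in> \<C>" "s \<in> J B" using sj(1) by (auto simp: S_def)
        then have "s \<in> N (j, a)" using J sj(2) by blast
        then show ?thesis by (simp add: N_def neighbourhood_def insert_commute)
      qed
    qed
    then obtain P where P: "finite P" "card P = c + 1" "\<forall>B\<in>P. \<forall>C\<in>P. B \<noteq> C \<longrightarrow> B \<inter> C = {}"
      "\<forall>B\<in>P. card B = f \<and> (\<exists>x y. lpath k E x B y) \<and> B \<subseteq> S \<union> (((\<Union>j<u. A j) \<union> h ` {..<u}) - Z)"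
      by (elim exE conjE)
    have AU: "(\<Union>j<u. A j) \<union> h ` {..<u} \<subseteq> U" using A(1) hi(2) U1(1) by blast
    have PZ: "B \<subseteq> Z \<union> U" if "B \<in> P" for B using P(4) that SZ AU by blast
    \<comment> \<open>New paths stay within the traded blocks and \<open>U\<close>, so they do not
      meet the paths that are kept.\<close>
    have PT: "B \<inter> C = {}" if pt: "B \<in> P" "C \<in> \<T> - \<C>" for B C
    proof -
      have "X \<inter> C = {}" if "X \<in> \<C>" for X
        by (rule Bdis) (use that pt(2) C(1) in \<open>auto simp: \<B>_def\<close>)
      then have "Z \<inter> C = {}" by (auto simp: Z_def)
      moreover have "U \<inter> C = {}" using pt(2) by (auto simp: U_def)
      ultimately show ?thesis using PZ[OF pt(1)] by blast
    qed
    have "tl ((\<T> - \<C>) \<union> P)"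
      unfolding tl_def
    proof (intro conjI ballI impI)
      fix B assume B: "B \<in> (\<T> - \<C>) \<union> P"
      have "B \<subseteq> V" if "B \<in> P" using PZ[OF that] ZV by (auto simp: U_def)
      then show "B \<subseteq> V" using B Tsub by blast
      show "card B = f" using B Tsub P(4) by blast
      show "\<exists>x y. lpath k E x B y" using B T(1) P(4) by (auto simp: tl_def)
      fix C assume C: "C \<in> (\<T> - \<C>) \<union> P" "B \<noteq> C"
      show "B \<inter> C = {}"
      proof (cases "B \<in> P"; cases "C \<in> P")
        assume "B \<in> P" "C \<in> P" then show ?thesis using P(3) C(2) by blast
      next
        assume "B \<in> P" "C \<notin> P" then show ?thesis using PT[of B C] C(1) by blast
      next
        assume "B \<notin> P" "C \<in> P" then show ?thesis using PT[of C B] B by blast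
      next
        assume "B \<notin> P" "C \<notin> P" then show ?thesis using Tdis[of B C] B C by blast
      qed
    qed
    then have "card ((\<T> - \<C>) \<union> P) \<le> card \<T>" by (rule T(2))
    moreover have "(\<T> - \<C>) \<inter> P = {}"
    proof -
      have "B \<noteq> {}" if "B \<in> P" for B using P(4) that f0 by auto
      then show ?thesis using PT by blast
    qed
    moreover have finT: "finite \<T>" using finB by (simp add: \<B>_def)
    ultimately have "card (\<T> - \<C>) + card P \<le> card \<T>" using P(1) by (simp add: card_Un_disjoint)
    moreover have "card \<T> - card \<C> \<le> card (\<T> - \<C>)" by (rule diff_card_le_card_Diff[OF finC])
    ultimately show False using P(2) C(2) by linarith
  qed
  then show ?thesis using T(1) unfolding tl_def U_def by blast
qed

section \<open>Loose Hamilton cycles\<close>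

lemma lpath_mono: "lpath k E x A y \<Longrightarrow> E \<subseteq> E' \<Longrightarrow> lpath k E' x A y"
proof (induction rule: lpath.induct)
  case (lpath_nil x)
  show ?case by (rule lpath.lpath_nil)
next
  case (lpath_step x A y e z)
  then show ?case using lpath.lpath_step[of k E' x A y e z] by blast
qed

text \<open>A set \<open>T\<close> is completed to \<open>f\<close>; a subset \<open>X\<close> of
  \<open>T\<close> of size \<open>s\<close>, filled up with fresh vertices, is completed to
  \<open>e\<close> by a vertex outside \<open>f\<close>. The completing vertices serve as
  \<open>x\<close> and \<open>y\<close>.\<close>

lemma ex_edges_meeting_in:
  assumes k: "k \<ge> 3" and kg: "k_graph k V E"
    and deg: "\<And>T. T \<subseteq> V \<Longrightarrow> card T = k - 1 \<Longrightarrow> m \<le> card (neighbourhood V E T)" and mV: "m \<le> card V"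
    and A: "finite A" "card A + 4 * k \<le> m" and s: "1 \<le> s" "s \<le> k - 1"
  shows "\<exists>e f x y. e \<in> E \<and> f \<in> E \<and> e \<subseteq> V - A \<and> f \<subseteq> V - A \<and> card e = k \<and> card f = k \<and>
    card (e \<inter> f) = s \<and> x \<in> f - e \<and> y \<in> e - f"
proof -
  have finV: "finite V" using kg by (simp add: k_graph_def)
  have nbV: "neighbourhood V E T \<inter> V = neighbourhood V E T" for T by (auto simp: neighbourhood_def)
  obtain T where T: "T \<subseteq> V" "T \<inter> A = {}" "card T = k - 1"
  proof -
    have "card A + (k - 1) \<le> card V" using A(2) mV by linarith
    then show thesis using that ex_subset_avoid[OF _ A(1) finV] by blast
  qed
  have "card A < card (neighbourhood V E T \<inter> V)" using deg[OF T(1,3)] A k nbV[of T] by simp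
  then obtain v where v: "v \<in> V" "v \<notin> A" "v \<notin> T" "insert v T \<in> E" "card (insert v T) = k"
    using neighbourhood_avoid[OF kg _ T(3) _ A(1)] k by (metis less_le_trans zero_less_numeral)
  define f where "f = insert v T"
  have f: "f \<in> E" "card f = k" "f \<subseteq> V" "f \<inter> A = {}" using v T by (auto simp: f_def)
  have finf: "finite f" using f(3) finV finite_subset by blast
  obtain X where X: "X \<subseteq> T" "card X = s" using s T(3) by (metis obtain_subset_with_card_n)
  have finX: "finite X" using X T finV finite_subset by (metis order_trans)
  have cAf: "card (A \<union> f) \<le> card A + k" using card_Un_le[of A f] f(2) by simp
  then obtain Y where Y: "Y \<subseteq> V" "Y \<inter> (A \<union> f) = {}" "card Y = k - 1 - s"
  proof -
    have "card (A \<union> f) + (k - 1 - s) \<le> card V" using cAf A(2) mV by linarith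
    moreover have "finite (A \<union> f)" using A(1) finf by simp
    ultimately have "\<exists>Y. Y \<subseteq> V \<and> Y \<inter> (A \<union> f) = {} \<and> card Y = k - 1 - s"
      by (intro ex_subset_avoid finV)
    then show thesis using that by blast
  qed
  have finY: "finite Y" using Y finV finite_subset by blast
  have "X \<inter> Y = {}" using X Y(2) by (auto simp: f_def)
  then have cT: "card (X \<union> Y) = k - 1" using X Y finX finY s by (simp add: card_Un_disjoint)
  have XYV: "X \<union> Y \<subseteq> V" using X T Y by blast
  have "card (A \<union> f) < card (neighbourhood V E (X \<union> Y) \<inter> V)"
    using deg[OF XYV cT] A k nbV[of "X \<union> Y"] cAf by simp
  moreover have "finite (A \<union> f)" using A finf by simp
  ultimately obtain w where w: "w \<in> V" "w \<notin> A \<union> f" "w \<notin> X \<union> Y" "insert w (X \<union> Y) \<in> E" "card (insert w (X \<union> Y)) = k"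
    using neighbourhood_avoid[OF kg _ cT] k by (metis less_le_trans zero_less_numeral)
  define e where "e = insert w (X \<union> Y)"
  have ef: "e \<inter> f = X" using X(1) Y(2) w(2) by (auto simp: e_def f_def)
  have "X \<inter> A = {}" using X T by blast
  then have "e \<subseteq> V - A" using w Y XYV by (auto simp: e_def)
  moreover have "v \<in> f - e" using v(3) ef X(1) by (auto simp: f_def)
  moreover have "w \<in> e - f" using w by (auto simp: e_def)
  ultimately show ?thesis using ef X(2) f w(4,5) by (fold e_def) blast
qed

text \<open>An instance of \<open>random_selection\<close> on vertices, with equality as the only
  conflict. Removing \<open>B\<close> costs at most half of the guaranteed degree, hence the density
  \<open>d / 2\<close> and the bound \<open>(d / 2) * M / 8\<close>.\<close>

lemma ex_reservoir:
  fixes d :: real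
  assumes k: "k \<ge> 3" and kg: "k_graph k V E" and n: "n = card V" and kn: "k \<le> n"
    and deg: "\<And>T. T \<subseteq> V \<Longrightarrow> card T = k - 1 \<Longrightarrow> d * n \<le> card (neighbourhood V E T)"
    and d: "d > 0" and B: "B \<subseteq> V" "real (card B) \<le> d / 2 * n"
    and M: "real M \<le> d / 64 * n" "real n ^ (k - 1) * exp (- (d / 2 * M / 4)) < 1/2" "M > 0"
  shows "\<exists>R. R \<subseteq> V - B \<and> card R \<le> M \<and>
    (\<forall>T. T \<subseteq> V \<longrightarrow> card T = k - 1 \<longrightarrow> d * M / 16 \<le> card (neighbourhood V E T \<inter> R))"
proof -
  have finV: "finite V" using kg by (simp add: k_graph_def)
  have n0: "real n > 0" using k kn by linarith
  define \<I> where "\<I> = {T. T \<subseteq> V \<and> card T = k - 1}"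
  define \<A> where "\<A> = (\<lambda>T. neighbourhood V E T - B) ` \<I>"
  have finI: "finite \<I>" using finV by (simp add: \<I>_def)
  have cI: "card \<I> \<le> n ^ (k - 1)"
    unfolding \<I>_def n_subsets[OF finV] using kn n by (intro order_trans[OF binomial_le_pow]) auto
  have "\<exists>F. F \<subseteq> V \<and> card F \<le> M \<and> (\<forall>a\<in>F. \<forall>b\<in>F. a \<noteq> b \<longrightarrow> (a, b) \<notin> Id_on V) \<and>
    (\<forall>A\<in>\<A>. real (card (F \<inter> A)) \<ge> (d / 2) * M / 8)"
  proof (rule random_selection[where \<delta> = "1 / n"])
    show "V \<noteq> {}" using n n0 by auto
    show "finite \<A>" using finI by (simp add: \<A>_def)
    show "A \<subseteq> V \<and> d / 2 * card V \<le> card A" if A: "A \<in> \<A>" for A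
    proof -
      obtain T where T: "T \<in> \<I>" "A = neighbourhood V E T - B" using A by (auto simp: \<A>_def)
      have "d * n \<le> card (neighbourhood V E T)" using deg T(1) by (simp add: \<I>_def)
      moreover have "card (neighbourhood V E T) - card B \<le> card A"
        unfolding T(2) using B finV finite_subset by (intro diff_card_le_card_Diff) blast
      ultimately have "d / 2 * n \<le> card A" using B(2) by linarith
      then show ?thesis using T(2) n by (auto simp: neighbourhood_def)
    qed
    have "card (Id_on V) = n"
    proof -
      have "Id_on V = (\<lambda>v. (v, v)) ` V" by (auto simp: Id_on_def)
      then show ?thesis using n by (simp add: card_image inj_on_def)
    qed
    then show "real (card (Id_on V)) \<le> 1 / n * (real (card V))\<^sup>2" using n n0 by (simp add: power2_eq_square)
    show "real M * (1 / n) \<le> d / 2 / 32" using M(1) n0 by (simp add: field_simps)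
    have "card \<A> \<le> n ^ (k - 1)" unfolding \<A>_def using card_image_le[OF finI] cI order_trans by blast
    then have "real (card \<A>) \<le> real n ^ (k - 1)" by (simp flip: of_nat_power)
    then have "real (card \<A>) * exp (- (d / 2 * M / 4)) \<le> real n ^ (k - 1) * exp (- (d / 2 * M / 4))"
      by (rule mult_right_mono) simp
    then show "real (card \<A>) * exp (- (d / 2 * M / 4)) < 1/2" using M(2) by linarith
  qed (use finV d M(3) in \<open>auto simp: sym_def\<close>)
  then obtain F where F: "F \<subseteq> V" "card F \<le> M" "\<forall>A\<in>\<A>. real (card (F \<inter> A)) \<ge> (d / 2) * M / 8" by blast
  have finF: "finite F" using F(1) finV finite_subset by blast
  show ?thesis
  proof (intro exI[of _ "F - B"] conjI allI impI)
    show "F - B \<subseteq> V - B" using F(1) by blast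
    show "card (F - B) \<le> M" using F(2) card_mono[OF finF, of "F - B"] by simp
    fix T assume "T \<subseteq> V" "card T = k - 1"
    then have "neighbourhood V E T - B \<in> \<A>" by (auto simp: \<A>_def \<I>_def)
    then have "(d / 2) * M / 8 \<le> card (F \<inter> (neighbourhood V E T - B))" using F(3) by blast
    moreover have "F \<inter> (neighbourhood V E T - B) = neighbourhood V E T \<inter> (F - B)" by blast
    ultimately show "d * M / 16 \<le> card (neighbourhood V E T \<inter> (F - B))" by simp
  qed
qed

text \<open>\<open>s\<close> will be the size of the overlap; \<open>s - 1\<close> is what the order
  lacks to a multiple of \<open>m = k - 1\<close>.\<close>

lemma ex_residue:
  assumes "m > 0" shows "\<exists>s. 1 \<le> s \<and> s \<le> m \<and> m dvd n + s - (1 :: nat)"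
proof -
  \<comment> \<open>This solves the congruence for \<open>n + s\<close>. The witness is therefore
    \<open>Suc s\<close>, or 1 when \<open>Suc s\<close> would exceed \<open>m\<close>.\<close>
  define s where "s = m - n mod m"
  have s: "1 \<le> s" "s \<le> m" using mod_less_divisor[OF assms, of n] unfolding s_def by linarith+
  have "n + s = n div m * m + n mod m + (m - n mod m)" unfolding s_def by (simp only: div_mult_mod_eq)
  also have "\<dots> = n div m * m + m" using mod_less_divisor[OF assms, of n] by linarith
  also have "\<dots> = (n div m + 1) * m" by simp
  finally have ns: "n + s = (n div m + 1) * m" .
  show ?thesis
  proof (cases "s = m")
    case True
    then have "n mod m = 0" using assms mod_less_divisor[of m n] by (simp add: s_def)
    then have "m dvd n + 1 - 1" by auto
    then show ?thesis using assms by (intro exI[of _ 1]) simp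
  next
    case False
    then have "m dvd n + Suc s - 1" using ns by simp
    then show ?thesis using s False by (intro exI[of _ "Suc s"]) simp
  qed
qed

text \<open>All demands on the size of \<open>n\<close> are explicit here. \<open>hN\<close> and the
  last part of \<open>M\<close> bound the vertices set aside by \<open>h * n / 4\<close>, so the
  remainder keeps a surplus \<open>h / 2\<close> for the tiling. \<open>con\<close> lets the
  reservoir serve every connector, and the second part of \<epsilon> makes reservoir and uncovered
  vertices fit the absorbing capacity.\<close>

lemma loose_hamilton_cycle_fixed:
  fixes V :: "'a set" and h d \<gamma> \<epsilon> :: real
  assumes k: "k \<ge> 3" and kg: "k_graph k V E" and n: "n = card V"
    and deg: "\<And>T. T \<subseteq> V \<Longrightarrow> card T = k - 1 \<Longrightarrow> d * n \<le> card (neighbourhood V E T)"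
    and h: "h > 0" "h \<le> 1/4" and d: "d = 1 / (2 * (real k - 1)) + h" and \<gamma>: "\<gamma> = (d / 2) ^ (3 * k - 1) / 2"
    and big: "8 * real k \<le> d * n" "2 \<le> (d / 2) ^ k * n"
    and N: "real N * real (4 * k\<^sup>2) \<le> \<gamma> / 32 * n" "real n ^ (k - 1) * exp (- (\<gamma> * N / 4)) < 1/2" "N > 0"
    and hN: "real (8 * k * N + 6 * k) \<le> h * n / 8"
    and M: "real M \<le> d / 64 * n" "real n ^ (k - 1) * exp (- (d / 2 * M / 4)) < 1/2" "M > 0" "real M \<le> h * n / 8"
    and f: "f = 2 * l * (k - 1) + 1"
    and c: "1 \<le> h / 2 * c" and u: "real (2 * (c * f + (c + 1) * f + 2 * l * k + k) + 1) < (h / 2 / 4 / 2 / 2 ^ f) ^ c * u"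
    and big2: "real (u * (k - 1)) \<le> \<epsilon> * n / 2" "real f \<le> h * n / 8" "2 * real c \<le> h / 2 / 4 * (real n / 2 / f - 1)"
    and con: "(3 * real k + 2) * (real n / f + 3) + 4 * k \<le> d * M / 16"
    and \<epsilon>: "\<epsilon> > 0" "real M + \<epsilon> * n \<le> \<gamma> * N / 8"
  shows "\<exists>C. loose_hamilton_cycle k V E V C"
proof -
  have finV: "finite V" using kg by (simp add: k_graph_def)
  define q where "q = 1 / (2 * (real k - 1))"
  have q: "0 < q" "q \<le> 1/4" using k by (auto simp: q_def field_simps)
  have dq: "d = q + h" using d by (simp add: q_def)
  have d01: "d > 0" "d \<le> 1/2" using q h dq by auto
  have hd: "h * n \<le> d * n" using q dq by (intro mult_right_mono) auto
  have dn: "d * n \<le> n / 2" using mult_right_mono[OF d01(2), of "real n"] by simp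
  have hn: "h * n \<le> n / 4" using mult_right_mono[OF h(2), of "real n"] by simp
  have con1: "real (8 * k * N + 4 * k) \<le> d * n"
  proof -
    have "real (8 * k * N + 4 * k) \<le> real (8 * k * N + 6 * k)" by simp
    then show ?thesis using hN hd by linarith
  qed
  have "d \<le> 1" using d01 by simp
  have "\<exists>A x y. A \<subseteq> V \<and> card A \<le> 8 * k * N \<and>
    (\<forall>W t. W \<subseteq> V - A \<longrightarrow> card W = t * (k - 1) \<longrightarrow> t \<le> \<gamma> * N / 8 \<longrightarrow> lpath k E x (A \<union> W) y)"
    by (rule absorbing_path_exists[OF k kg n deg d01(1) \<open>d \<le> 1\<close> big \<gamma> N con1])
  then obtain A xA yA where A: "A \<subseteq> V" "card A \<le> 8 * k * N"
    "\<forall>W t. W \<subseteq> V - A \<longrightarrow> card W = t * (k - 1) \<longrightarrow> t \<le> \<gamma> * N / 8 \<longrightarrow> lpath k E xA (A \<union> W) yA"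
    by (elim exE conjE)
  have lA: "lpath k E xA A yA" using A(3)[rule_format, of "{}" 0] d01 by (simp add: \<gamma>)
  have finA: "finite A" using A(1) finV finite_subset by blast
  obtain s where s: "1 \<le> s" "s \<le> k - 1" "k - 1 dvd n + s - 1" using ex_residue[of "k - 1" n] k by auto
  define m where "m = 8 * k * N + 4 * k"
  have "\<exists>e f x y. e \<in> E \<and> f \<in> E \<and> e \<subseteq> V - A \<and> f \<subseteq> V - A \<and> card e = k \<and> card f = k \<and>
    card (e \<inter> f) = s \<and> x \<in> f - e \<and> y \<in> e - f"
  proof (rule ex_edges_meeting_in[OF k kg _ _ finA _ s(1,2)])
    show "m \<le> card (neighbourhood V E T)" if "T \<subseteq> V" "card T = k - 1" for T
      using deg[OF that] con1 unfolding m_def by linarith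
    show "m \<le> card V" using con1 dn n unfolding m_def by linarith
    show "card A + 4 * k \<le> m" using A(2) by (simp add: m_def)
  qed
  then obtain e f0 x y where ef: "e \<in> E" "f0 \<in> E" "e \<subseteq> V - A" "f0 \<subseteq> V - A" "card e = k" "card f0 = k"
    "card (e \<inter> f0) = s" "x \<in> f0 - e" "y \<in> e - f0" by (elim exE conjE)
  have finef: "finite e" "finite f0" using ef finV finite_subset by blast+
  define B where "B = A \<union> (e \<union> f0)"
  have BV: "B \<subseteq> V" using A ef by (auto simp: B_def)
  have cB: "card B \<le> 8 * k * N + 2 * k"
    using card_Un_le[of A "e \<union> f0"] card_Un_le[of e f0] A(2) ef unfolding B_def by linarith
  then have "real (card B) \<le> real (8 * k * N + 6 * k)" by linarith
  then have cB': "real (card B) \<le> h * n / 8" using hN by linarith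
  then have cB2: "real (card B) \<le> d / 2 * n" using hd by linarith
  have kn: "k \<le> n" using big(1) dn by linarith
  have "\<exists>R. R \<subseteq> V - B \<and> card R \<le> M \<and>
    (\<forall>T. T \<subseteq> V \<longrightarrow> card T = k - 1 \<longrightarrow> d * M / 16 \<le> card (neighbourhood V E T \<inter> R))"
    by (rule ex_reservoir[OF k kg n kn deg d01(1) BV cB2 M(1-3)])
  then obtain R where R: "R \<subseteq> V - B" "card R \<le> M"
    "\<forall>T. T \<subseteq> V \<longrightarrow> card T = k - 1 \<longrightarrow> d * M / 16 \<le> card (neighbourhood V E T \<inter> R)"
    by (elim exE conjE)
  have finR: "finite R" using R(1) finV finite_subset by blast
  \<comment> \<open>The tiling lives in what is left of \<open>V\<close>. Restricting the edges to
    \<open>V'\<close> keeps its paths off the absorbing path, the exceptional pair and the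
    reservoir.\<close>
  define V' where "V' = V - (B \<union> R)"
  define E' where "E' = {e \<in> E. e \<subseteq> V'}"
  define n' where "n' = card V'"
  have kg': "k_graph k V' E'" using kg finV by (auto simp: k_graph_def V'_def E'_def)
  have V'V: "V' \<subseteq> V" by (auto simp: V'_def)
  have cBR: "real (card (B \<union> R)) \<le> h * n / 4"
  proof -
    have "card (B \<union> R) \<le> card B + card R" by (rule card_Un_le)
    then show ?thesis using cB' R(2) M(4) by linarith
  qed
  have finBR: "finite (B \<union> R)" using BV finR finV finite_subset by blast
  have n'n: "n' \<le> n" unfolding n'_def n using finV V'V by (rule card_mono)
  have "n - card (B \<union> R) \<le> n'"
    unfolding n'_def n V'_def by (rule diff_card_le_card_Diff[OF finBR])
  then have n'2: "real n / 2 \<le> n'" using cBR hn by linarith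
  have deg': "(1 / (2 * (real k - 1)) + h / 2) * n' \<le> card (neighbourhood V' E' T)" if T: "T \<subseteq> V'" "card T = k - 1" for T
  proof -
    have "T \<subseteq> V" using T(1) V'V by blast
    then have "d * n \<le> card (neighbourhood V E T)" using deg T(2) by blast
    moreover have "card (neighbourhood V E T) - card (B \<union> R) \<le> card (neighbourhood V E T - (B \<union> R))"
      by (rule diff_card_le_card_Diff[OF finBR])
    moreover have "neighbourhood V E T - (B \<union> R) = neighbourhood V' E' T"
      using T(1) by (auto simp: neighbourhood_def V'_def E'_def)
    ultimately have "d * n - h * n / 4 \<le> card (neighbourhood V' E' T)" using cBR by simp
    moreover have "(q + h / 2) * n' \<le> (q + h / 2) * n" using n'n q h by (intro mult_left_mono) auto
    moreover have "(q + h / 2) * n \<le> d * n - h * n / 4"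
      using h by (simp add: dq algebra_simps)
    ultimately show ?thesis by (simp add: q_def)
  qed
  have "f > 0" using f by simp
  then have f0: "real f > 0" by simp
  have "\<exists>\<T>. (\<forall>B\<in>\<T>. B \<subseteq> V' \<and> card B = f \<and> (\<exists>x y. lpath k E' x B y)) \<and>
    (\<forall>B\<in>\<T>. \<forall>C\<in>\<T>. B \<noteq> C \<longrightarrow> B \<inter> C = {}) \<and> card (V' - \<Union>\<T>) < \<epsilon> * n'"
  proof (rule almost_tiling[OF k kg' n'_def deg' _ f c u])
    show "h / 2 > 0" using h by simp
    have "\<epsilon> * (real n / 2) \<le> \<epsilon> * n'" using n'2 \<epsilon>(1) by (intro mult_left_mono) auto
    then show "real (u * (k - 1)) \<le> \<epsilon> * n'" using big2(1) by simp
    have "h / 2 * (real n / 2) \<le> h / 2 * n'" using n'2 h by (intro mult_left_mono) auto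
    then show "real f \<le> h / 2 * n' / 2" using big2(2) by simp
    have "real n / 2 / f \<le> n' / f" using n'2 f0 by (intro divide_right_mono) auto
    then have "h / 2 / 4 * (real n / 2 / f - 1) \<le> h / 2 / 4 * (n' / f - 1)" using h by (intro mult_left_mono) auto
    then show "2 * real c \<le> h / 2 / 4 * (real n' / f - 1)" using big2(3) by linarith
  qed
  then obtain \<T> where T: "\<forall>B\<in>\<T>. B \<subseteq> V' \<and> card B = f \<and> (\<exists>x y. lpath k E' x B y)"
    "\<forall>B\<in>\<T>. \<forall>C\<in>\<T>. B \<noteq> C \<longrightarrow> B \<inter> C = {}" "card (V' - \<Union>\<T>) < \<epsilon> * n'" by (elim exE conjE)
  have finV': "finite V'" using V'V finV finite_subset by blast
  have finT: "finite \<T>" by (rule finite_subset[of _ "Pow V'"]) (use T(1) finV' in auto)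
  have cT: "real (card \<T>) \<le> n / f"
  proof -
    have "card (\<Union>\<T>) = (\<Sum>B\<in>\<T>. card B)"
    proof (rule card_Union_disjoint)
      show "pairwise disjnt \<T>" using T(2) by (simp add: pairwise_def disjnt_def)
      show "finite B" if "B \<in> \<T>" for B using T(1) that finV' finite_subset by blast
    qed
    also have "\<dots> = card \<T> * f" using T(1) by simp
    finally have "card \<T> * f \<le> card V'" using T(1) card_mono[OF finV', of "\<Union>\<T>"] by auto
    then have "card \<T> * f \<le> n" using n'n by (simp add: n'_def)
    then have "real (card \<T>) * f \<le> n" by (simp flip: of_nat_mult)
    then show ?thesis using f0 by (simp add: field_simps)
  qed
  obtain ts where ts: "set ts = \<T>" "distinct ts" using finite_distinct_list[OF finT] by blast
  have lts: "length ts = card \<T>" using ts distinct_card by metis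
  \<comment> \<open>The single vertices \<open>x\<close> and \<open>y\<close> count as trivial
    paths. Placed first and last, they make the joined path run from \<open>x\<close> to
    \<open>y\<close>, as \<open>lpath_close\<close> requires.\<close>
  define js where "js = {x} # A # ts @ [{y}]"
  have xy: "x \<noteq> y" "x \<in> V" "y \<in> V" "x \<in> B" "y \<in> B" "x \<notin> A" "y \<notin> A" using ef by (auto simp: B_def)
  have setjs: "set js = {{x}, A, {y}} \<union> \<T>" using ts by (auto simp: js_def)
  have TB: "I \<inter> B = {}" "I \<inter> R = {}" "I \<subseteq> V" if "I \<in> \<T>" for I using T(1) that by (auto simp: V'_def)
  have Ane: "xA \<in> A" "yA \<in> A" using lpath_ends[OF lA] by auto
  have AB: "A \<subseteq> B" by (auto simp: B_def)
  have notT: "{x} \<notin> \<T>" "{y} \<notin> \<T>" "A \<notin> \<T>"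
    using TB(1)[of "{x}"] TB(1)[of "{y}"] TB(1)[of A] xy(4,5) AB Ane(1) by auto
  have djs: "distinct js" using ts notT xy(1,6,7) by (auto simp: js_def)
  have dis: "I \<inter> J = {}" if IJ: "I \<in> set js" "J \<in> set js" "I \<noteq> J" for I J
  proof -
    have 1: "I \<inter> J = {}" if "I \<in> \<T>" "J \<in> {{x}, A, {y}}" for I J using TB(1)[OF that(1)] that(2) xy AB by auto
    have 2: "I \<inter> J = {}" if "I \<in> {{x}, A, {y}}" "J \<in> {{x}, A, {y}}" "I \<noteq> J" for I J using that xy by auto
    have m: "I \<in> {{x}, A, {y}}" if "I \<notin> \<T>" "I \<in> set js" for I using that unfolding setjs by simp
    show ?thesis
    proof (cases "I \<in> \<T>"; cases "J \<in> \<T>")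
      assume "I \<in> \<T>" "J \<in> \<T>" then show ?thesis using T(2) IJ(3) by simp
    next
      assume "I \<in> \<T>" "J \<notin> \<T>" then show ?thesis using 1[of I J] m[of J] IJ(2) by simp
    next
      assume "I \<notin> \<T>" "J \<in> \<T>" then show ?thesis using 1[of J I] m[of I] IJ(1) by (simp add: Int_commute)
    next
      assume "I \<notin> \<T>" "J \<notin> \<T>" then show ?thesis using 2[of I J] m[of I] m[of J] IJ by simp
    qed
  qed
  \<comment> \<open>The ends of \<open>A\<close> are pinned to \<open>xA\<close> and
    \<open>yA\<close>, the ends that absorption preserves; for a tile any ends will do.\<close>
  have "\<forall>I\<in>set js. \<exists>p. lpath k E (fst p) I (snd p) \<and> (I = A \<longrightarrow> p = (xA, yA))"
  proof
    fix I assume "I \<in> set js"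
    then consider "I = A" | "I = {x}" "I \<noteq> A" | "I = {y}" "I \<noteq> A" | "I \<in> \<T>" "I \<noteq> A" unfolding setjs by blast
    then show "\<exists>p. lpath k E (fst p) I (snd p) \<and> (I = A \<longrightarrow> p = (xA, yA))"
    proof cases
      case 1 then show ?thesis using lA by (intro exI[of _ "(xA, yA)"]) simp
    next
      case 2 then show ?thesis using lpath_nil[of k E x] by (intro exI[of _ "(x, x)"]) simp
    next
      case 3 then show ?thesis using lpath_nil[of k E y] by (intro exI[of _ "(y, y)"]) simp
    next
      case 4
      then obtain a b where "lpath k E' a I b" using T(1) by blast
      then have "lpath k E a I b" by (rule lpath_mono) (auto simp: E'_def)
      then show ?thesis using 4 by (intro exI[of _ "(a, b)"]) simp
    qed
  qed
  then obtain g where g: "\<forall>I\<in>set js. lpath k E (fst (g I)) I (snd (g I)) \<and> (I = A \<longrightarrow> g I = (xA, yA))" by metis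
  define X where "X I = fst (g I)" for I
  define Y where "Y I = snd (g I)" for I
  have XY: "lpath k E (X I) I (Y I)" "X I \<in> I" "Y I \<in> I" if "I \<in> set js" for I
    using g that lpath_ends[of k E "X I" I "Y I"] by (auto simp: X_def Y_def)
  have XA: "X A = xA" "Y A = yA" using g by (auto simp: X_def Y_def setjs)
  define Z where "Z = X ` set js \<union> Y ` set js"
  have ljs: "length js = card \<T> + 3" by (simp add: js_def lts)
  have finZ: "finite Z" by (simp add: Z_def)
  have cZ: "card Z \<le> 2 * length js"
    using card_Un_le[of "X ` set js" "Y ` set js"] card_image_le[of "set js" X] card_image_le[of "set js" Y]
      card_length[of js] unfolding Z_def by simp
  \<comment> \<open>At most two ends per segment and \<open>3 * k\<close> connector vertices per
    segment have to be avoided.\<close>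
  define z where "z = card Z + 3 * k * length js"
  have zt: "real (z + 4 * k) \<le> d * M / 16"
  proof -
    have "z \<le> (3 * k + 2) * (card \<T> + 3)" using cZ unfolding z_def ljs by (simp add: algebra_simps)
    then have "real z \<le> real ((3 * k + 2) * (card \<T> + 3))" by (simp only: of_nat_le_iff)
    also have "\<dots> = (3 * real k + 2) * (real (card \<T>) + 3)" by (simp add: algebra_simps)
    also have "\<dots> \<le> (3 * real k + 2) * (real n / f + 3)" using cT by (intro mult_left_mono) auto
    finally show ?thesis using con by simp
  qed
  have conR: "connects k V E R z"
  proof (rule connectsI[OF k kg, where t = "z + 4 * k"])
    show "R \<subseteq> V" using R(1) by blast
    show 1: "z + 4 * k \<le> card (neighbourhood V E T \<inter> R)" if "T \<subseteq> V" "card T = k - 1" for T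
    proof -
      have "real (z + 4 * k) \<le> card (neighbourhood V E T \<inter> R)" using R(3) that zt by (meson order_trans)
      then show ?thesis by (simp only: of_nat_le_iff)
    qed
    obtain T where "T \<subseteq> V" "card T = k - 1"
      using obtain_subset_with_card_n[of "k - 1" V] kn n by (metis diff_le_self le_trans)
    then have "z + 4 * k \<le> card (neighbourhood V E T \<inter> R)" by (rule 1)
    also have "\<dots> \<le> card R" using finR by (intro card_mono) auto
    finally show "z + 4 * k \<le> card R" .
  qed simp
  have "\<exists>C. C \<subseteq> R \<and> C \<inter> Z = {} \<and> card C \<le> 3 * k * length js \<and>
    (\<forall>P. (\<forall>I\<in>set js. lpath k E (X I) (P I) (Y I) \<and> P I \<inter> C = {}) \<longrightarrow>
         (\<forall>I\<in>set js. \<forall>J\<in>set js. I \<noteq> J \<longrightarrow> P I \<inter> P J = {}) \<longrightarrow>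
         lpath k E (X (hd js)) (C \<union> (\<Union>I\<in>set js. P I)) (Y (last js)))"
  proof (rule join_segments[OF conR _ djs _ _ finZ _ finR])
    show "js \<noteq> []" by (simp add: js_def)
    fix I assume I: "I \<in> set js"
    have "I \<subseteq> V" using I A(1) xy(2,3) TB(3) unfolding setjs by blast
    then show "X I \<in> V \<and> Y I \<in> V \<and> X I \<in> Z \<and> Y I \<in> Z" using XY[OF I] I by (auto simp: Z_def)
  next
    fix I J assume "I \<in> set js" "J \<in> set js" "I \<noteq> J"
    then show "Y I \<noteq> X J" using dis[of I J] XY(3)[of I] XY(2)[of J] by (metis disjoint_iff)
  next
    show "card Z + 3 * k * length js \<le> z" by (simp add: z_def)
  qed
  then obtain C where C: "C \<subseteq> R"
    and CP: "\<forall>P. (\<forall>I\<in>set js. lpath k E (X I) (P I) (Y I) \<and> P I \<inter> C = {}) \<longrightarrow>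
         (\<forall>I\<in>set js. \<forall>J\<in>set js. I \<noteq> J \<longrightarrow> P I \<inter> P J = {}) \<longrightarrow>
         lpath k E (X (hd js)) (C \<union> (\<Union>I\<in>set js. P I)) (Y (last js))" by (elim exE conjE)
  have ends: "X (hd js) = x" "Y (last js) = y"
    using XY(2)[of "{x}"] XY(3)[of "{y}"] by (auto simp: js_def)
  have jsR: "I \<inter> R = {}" if "I \<in> set js" for I
    using that TB(2) R(1) xy(4,5) AB unfolding setjs by blast
  \<comment> \<open>The path before absorption serves to compute the leftover count modulo
    \<open>k - 1\<close>.\<close>
  define Q where "Q = C \<union> \<Union>(set js)"
  have lQ: "lpath k E x Q y"
  proof -
    have "lpath k E (X (hd js)) (C \<union> (\<Union>I\<in>set js. I)) (Y (last js))"
    proof (rule CP[rule_format])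
      show "lpath k E (X I) I (Y I) \<and> I \<inter> C = {}" if "I \<in> set js" for I
        using XY(1)[OF that] jsR[OF that] C by blast
      show "I \<inter> J = {}" if "I \<in> set js" "J \<in> set js" "I \<noteq> J" for I J using dis[OF that] .
    qed
    then show ?thesis by (simp add: Q_def ends)
  qed
  \<comment> \<open>Left over are the vertices missed by the tiling and the unspent part of the
    reservoir.\<close>
  define W where "W = (V' - \<Union>\<T>) \<union> (R - C)"
  have WV: "W \<subseteq> V - B" using R(1) by (auto simp: W_def V'_def)
  have WQ: "W \<inter> I = {}" if "I \<in> set js" for I
    using that jsR[OF that] xy(4,5) AB WV unfolding setjs by (auto simp: W_def V'_def)
  have WC: "W \<inter> C = {}" using C by (auto simp: W_def V'_def)
  have cW: "real (card W) \<le> \<gamma> * N / 8"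
  proof -
    have "card W \<le> card (V' - \<Union>\<T>) + card (R - C)" unfolding W_def by (rule card_Un_le)
    moreover have "card (R - C) \<le> M" using R(2) card_mono[OF finR, of "R - C"] by simp
    moreover have "\<epsilon> * n' \<le> \<epsilon> * n" using n'n \<epsilon>(1) by (intro mult_left_mono) auto
    ultimately show ?thesis using T(3) \<epsilon>(2) by linarith
  qed
  have Vdec: "Q \<union> W = V - (e \<union> f0) \<union> {x, y}"
  proof -
    have "Q = C \<union> A \<union> \<Union>\<T> \<union> {x, y}" unfolding Q_def setjs by auto
    moreover have "\<Union>\<T> \<subseteq> V'" using T(1) by blast
    then have "W \<union> \<Union>\<T> \<union> C = V' \<union> R" using C by (auto simp: W_def)
    moreover have "V' \<union> R = V - B" using R(1) by (auto simp: V'_def)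
    moreover have "V - B \<union> A = V - (e \<union> f0)" using A(1) ef(3,4) by (auto simp: B_def)
    ultimately show ?thesis by blast
  qed
  have QW: "Q \<inter> W = {}" using WQ WC by (auto simp: Q_def)
  have "k - 1 dvd card W"
  proof -
    have finW: "finite W" using WV finV finite_subset by blast
    have finQ: "finite Q" using lpath_finite[OF lQ] k by simp
    obtain q1 where q1: "card Q = q1 * (k - 1) + 1" using lpath_card[OF lQ] k by auto
    have "card (e \<union> f0) + s = 2 * k" using card_Un_Int[OF finef] ef(5-7) by simp
    moreover have "card (V - (e \<union> f0)) = n - card (e \<union> f0)"
      using finef ef(3,4) n by (intro card_Diff_subset[THEN trans]) auto
    moreover have "card (e \<union> f0) \<le> n" using ef(3,4) n finV by (auto intro: card_mono)
    moreover have "card (V - (e \<union> f0) \<union> {x, y}) = card (V - (e \<union> f0)) + 2"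
      using finV ef(8,9) xy(1) by (subst card_Un_disjoint) auto
    moreover have "card Q + card W = card (V - (e \<union> f0) \<union> {x, y})"
      using Vdec QW finQ finW by (metis card_Un_disjoint)
    \<comment> \<open>\<open>card Q + card W = n - (2 * k - s) + 2\<close> and
      \<open>card Q = q1 * (k - 1) + 1\<close>.\<close>
    ultimately have "n + s - 1 = card W + (q1 * (k - 1) + 2 * (k - 1))" using q1 k s(1) by linarith
    then have "n + s - 1 = card W + (q1 + 2) * (k - 1)" by (simp only: distrib_right)
    then have "k - 1 dvd card W + (q1 + 2) * (k - 1)" using s(3) by (simp only:)
    then show ?thesis by (metis dvd_add_left_iff dvd_triv_right)
  qed
  then obtain t where t: "card W = t * (k - 1)" by (metis dvd_def mult.commute)
  have "t * 1 \<le> t * (k - 1)" using k by (intro mult_le_mono2) simp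
  then have "t \<le> card W" using t by simp
  then have "real t \<le> \<gamma> * N / 8" using cW by linarith
  then have lAW: "lpath k E xA (A \<union> W) yA" using A(3) t WV AB by blast
  \<comment> \<open>The connectors \<open>C\<close> are reused as they are; only the segment
    \<open>A\<close> grows to \<open>A \<union> W\<close>.\<close>
  define P where "P I = (if I = A then A \<union> W else I)" for I
  have "lpath k E (X (hd js)) (C \<union> (\<Union>I\<in>set js. P I)) (Y (last js))"
  proof (rule CP[rule_format])
    fix I assume I: "I \<in> set js"
    show "lpath k E (X I) (P I) (Y I) \<and> P I \<inter> C = {}"
      using I XY(1)[OF I] jsR[OF I] C lAW WC by (auto simp: P_def XA)
  next
    fix I J assume IJ: "I \<in> set js" "J \<in> set js" "I \<noteq> J"
    show "P I \<inter> P J = {}" using dis[OF IJ] WQ[OF IJ(1)] WQ[OF IJ(2)] IJ(3) by (auto simp: P_def)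
  qed
  moreover have "C \<union> (\<Union>I\<in>set js. P I) = Q \<union> W"
  proof -
    have "A \<in> set js" by (simp add: setjs)
    then show ?thesis by (auto simp: P_def Q_def split: if_splits)
  qed
  ultimately have final: "lpath k E x (Q \<union> W) y" by (simp add: ends)
  have "card V \<ge> 4 * k" using big(1) dn n by linarith
  moreover have "e \<inter> f0 \<noteq> {}" using ef(7) s(1) by auto
  ultimately show ?thesis
    using lpath_close[OF k finV _ ef(2,6) _ ef(1,5) _ _ ef(8,9) final Vdec] ef(3,4) by blast
qed

section \<open>Asymptotics and the choice of the constants\<close>

lemma eventually_le_mult:
  fixes a b :: real
  assumes "a > 0" shows "\<forall>\<^sub>F n in sequentially. b \<le> a * real n"
proof (rule eventually_sequentiallyI)
  fix n assume "nat \<lceil>b / a\<rceil> \<le> n"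
  then have "b / a \<le> real n" by linarith
  then show "b \<le> a * real n" using assms by (simp add: field_simps)
qed

text \<open>Exponential decay beats the polynomial; rounding down changes the exponent by less than
  \<open>a\<close>, a constant factor \<open>exp a\<close>.\<close>

lemma eventually_power_exp_less:
  fixes a b :: real
  assumes a: "a > 0" and b: "b > 0"
  shows "\<forall>\<^sub>F n in sequentially. real n ^ r * exp (- (a * real (nat \<lfloor>b * real n\<rfloor>))) < 1/2"
proof -
  define c where "c = a * b"
  have c: "c > 0" using a b by (simp add: c_def)
  have "filterlim (\<lambda>n. c * real n) at_top sequentially"
    by (rule filterlim_tendsto_pos_mult_at_top[OF tendsto_const c filterlim_real_sequentially])
  then have "(\<lambda>n. (c * real n) ^ r / exp (c * real n)) \<longlonglongrightarrow> 0"
    by (rule filterlim_compose[OF tendsto_power_div_exp_0])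
  moreover have "c ^ r * exp (- a) / 2 > 0" using c by simp
  ultimately have "\<forall>\<^sub>F n in sequentially. (c * real n) ^ r / exp (c * real n) < c ^ r * exp (- a) / 2"
    by (rule order_tendstoD(2))
  then show ?thesis
  proof eventually_elim
    case (elim n)
    have "b * n - 1 \<le> real (nat \<lfloor>b * real n\<rfloor>)" by linarith
    then have "a * (b * n - 1) \<le> a * real (nat \<lfloor>b * real n\<rfloor>)" using a by (intro mult_left_mono) auto
    then have "exp (- (a * real (nat \<lfloor>b * real n\<rfloor>))) \<le> exp (a - c * n)" by (simp add: c_def algebra_simps)
    then have "real n ^ r * exp (- (a * real (nat \<lfloor>b * real n\<rfloor>))) \<le> real n ^ r * exp (a - c * n)"
      by (intro mult_left_mono) auto
    also have "\<dots> = ((c * real n) ^ r / exp (c * real n)) * (exp a / c ^ r)"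
      using c by (simp add: exp_diff power_mult_distrib)
    also have "\<dots> < (c ^ r * exp (- a) / 2) * (exp a / c ^ r)"
      using elim c by (intro mult_strict_right_mono) auto
    also have "\<dots> = 1/2" using c by (simp add: exp_minus)
    finally show ?case .
  qed
qed

text \<open>The constants are fixed in the order \<gamma>, \<beta>, \<epsilon>, \<rho>,
  \<open>l\<close>, \<open>f\<close>, \<open>c\<close>, \<open>u\<close>, each from earlier ones
  only. \<open>N\<close> and \<open>M\<close> are \<open>\<beta> * n\<close> and
  \<open>\<rho> * n\<close> rounded down, and every remaining condition holds for large
  \<open>n\<close>.\<close>

lemma eventually_loose_hamilton_cycle:
  fixes h d :: real
  assumes k: "k \<ge> 3" and h: "h > 0" "h \<le> 1/4" and d: "d = 1 / (2 * (real k - 1)) + h"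
  shows "\<forall>\<^sub>F n in sequentially. \<forall>(V :: 'a set) E. k_graph k V E \<longrightarrow> card V = n \<longrightarrow>
    (\<forall>T. T \<subseteq> V \<longrightarrow> card T = k - 1 \<longrightarrow> d * n \<le> card (neighbourhood V E T)) \<longrightarrow>
    (\<exists>C. loose_hamilton_cycle k V E V C)"
proof -
  have k0: "real k \<ge> 3" using k by simp
  have d0: "d > h" using k0 by (simp add: d)
  define \<gamma> where "\<gamma> = (d / 2) ^ (3 * k - 1) / 2"
  have g0: "\<gamma> > 0" using d0 h by (simp add: \<gamma>_def)
  \<comment> \<open>The first bound keeps conflicts between random absorbers rare, the second keeps
    the absorbing path short compared with \<open>h * n\<close>.\<close>
  define \<beta> where "\<beta> = min (\<gamma> / (128 * (real k)\<^sup>2)) (h / (128 * real k))"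
  have b0: "\<beta> > 0" using g0 h k0 by (simp add: \<beta>_def)
  have b1: "\<beta> * (4 * (real k)\<^sup>2) \<le> \<gamma> / 32"
  proof -
    have "\<beta> \<le> \<gamma> / (128 * (real k)\<^sup>2)" by (simp add: \<beta>_def)
    then have "\<beta> * (4 * (real k)\<^sup>2) \<le> \<gamma> / (128 * (real k)\<^sup>2) * (4 * (real k)\<^sup>2)" by (rule mult_right_mono) simp
    also have "\<dots> = \<gamma> / 32" using k0 by (simp add: field_simps)
    finally show ?thesis .
  qed
  have b2: "8 * real k * \<beta> \<le> h / 16"
  proof -
    have "\<beta> \<le> h / (128 * real k)" by (simp add: \<beta>_def)
    then have "8 * real k * \<beta> \<le> 8 * real k * (h / (128 * real k))" by (rule mult_left_mono) simp
    also have "\<dots> = h / 16" using k0 by (simp add: field_simps)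
    finally show ?thesis .
  qed
  \<comment> \<open>As \<open>N \<ge> \<beta> * n / 2\<close>, the capacity
    \<open>\<gamma> * N / 8\<close> is at least \<open>4 * \<epsilon> * n\<close>, which covers
    \<open>\<epsilon> * n\<close> uncovered vertices and as many from the reservoir.\<close>
  define \<epsilon> where "\<epsilon> = \<gamma> * \<beta> / 64"
  have e0: "\<epsilon> > 0" using g0 b0 by (simp add: \<epsilon>_def)
  define \<rho> where "\<rho> = min (d / 64) (min (h / 8) \<epsilon>)"
  have r0: "\<rho> > 0" using d0 h e0 by (simp add: \<rho>_def)
  have r1: "\<rho> \<le> d / 64" "\<rho> \<le> h / 8" "\<rho> \<le> \<epsilon>" by (simp_all add: \<rho>_def)
  \<comment> \<open>Paths so long that the connectors of \<open>n / f\<close> of them use at most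
    half of \<open>d * M / 16\<close>, where \<open>M \<ge> \<rho> * n / 2\<close>.\<close>
  obtain l :: nat where l: "64 * (3 * real k + 2) / (d * \<rho>) \<le> l" using real_arch_simple by blast
  define f where "f = 2 * l * (k - 1) + 1"
  have lf: "real l \<le> f"
  proof -
    have "l * 1 \<le> l * (2 * (k - 1))" using k by (intro mult_le_mono2) simp
    moreover have "f = l * (2 * (k - 1)) + 1" by (simp add: f_def)
    ultimately have "l \<le> f" by linarith
    then show ?thesis by simp
  qed
  have "f > 0" by (simp add: f_def)
  then have f0: "real f > 0" by simp
  have fr: "(3 * real k + 2) / f \<le> d * \<rho> / 64"
  proof -
    have dr: "d * \<rho> > 0" using d0 h r0 by simp
    have "64 * (3 * real k + 2) / (d * \<rho>) \<le> f" using l lf by linarith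
    then have "64 * (3 * real k + 2) \<le> f * (d * \<rho>)" using dr by (simp add: pos_divide_le_eq)
    then show ?thesis using f0 by (simp add: field_simps)
  qed
  \<comment> \<open>Enough blocks for their joint surplus to pay for an additional path; the surplus
    in the tiling is \<open>h / 2\<close>.\<close>
  obtain c :: nat where "2 / h \<le> c" using real_arch_simple by blast
  then have c: "1 \<le> h / 2 * c" using h by (simp add: field_simps)
  define \<theta> where "\<theta> = (h / 2 / 4 / 2 / 2 ^ f) ^ c"
  have t0: "\<theta> > 0" using h by (simp add: \<theta>_def)
  obtain u :: nat where "real (2 * (c * f + (c + 1) * f + 2 * l * k + k) + 1) / \<theta> < u" using reals_Archimedean2 by blast
  then have u: "real (2 * (c * f + (c + 1) * f + 2 * l * k + k) + 1) < \<theta> * u"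
    using t0 by (simp add: pos_divide_less_eq mult.commute)
  have dk: "(d / 2) ^ k > 0" using d0 h by simp
  have hf: "h / (16 * f) > 0" using h f0 by simp
  have dr: "d * \<rho> / 64 > 0" using d0 h r0 by simp
  have "\<forall>\<^sub>F n in sequentially. real n ^ (k - 1) * exp (- (\<gamma> / 4 * real (nat \<lfloor>\<beta> * real n\<rfloor>))) < 1/2"
    using g0 b0 by (intro eventually_power_exp_less) auto
  moreover have "\<forall>\<^sub>F n in sequentially. real n ^ (k - 1) * exp (- (d / 8 * real (nat \<lfloor>\<rho> * real n\<rfloor>))) < 1/2"
    using d0 h r0 by (intro eventually_power_exp_less) auto
  moreover have "\<forall>\<^sub>F n in sequentially. 96 * real k \<le> h * real n" by (rule eventually_le_mult[OF h(1)])
  moreover have "\<forall>\<^sub>F n in sequentially. 2 \<le> (d / 2) ^ k * real n" by (rule eventually_le_mult[OF dk])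
  moreover have "\<forall>\<^sub>F n in sequentially. 2 \<le> \<beta> * real n" by (rule eventually_le_mult[OF b0])
  moreover have "\<forall>\<^sub>F n in sequentially. 2 \<le> \<rho> * real n" by (rule eventually_le_mult[OF r0])
  moreover have "\<forall>\<^sub>F n in sequentially. 2 * real (u * (k - 1)) \<le> \<epsilon> * real n" by (rule eventually_le_mult[OF e0])
  moreover have "\<forall>\<^sub>F n in sequentially. 8 * real f \<le> h * real n" by (rule eventually_le_mult[OF h(1)])
  moreover have "\<forall>\<^sub>F n in sequentially. 2 * real c + h / 8 \<le> h / (16 * f) * real n" by (rule eventually_le_mult[OF hf])
  moreover have "\<forall>\<^sub>F n in sequentially. (3 * real k + 2) * 3 + 4 * k \<le> d * \<rho> / 64 * real n" by (rule eventually_le_mult[OF dr])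
  ultimately show ?thesis
  proof eventually_elim
    case (elim n)
    define N where "N = nat \<lfloor>\<beta> * real n\<rfloor>"
    define M where "M = nat \<lfloor>\<rho> * real n\<rfloor>"
    have N: "real N \<le> \<beta> * n" "\<beta> * n / 2 \<le> N" "N > 0" using elim(5) unfolding N_def by linarith+
    have M: "real M \<le> \<rho> * n" "\<rho> * n / 2 \<le> M" "M > 0" using elim(6) unfolding M_def by linarith+
    show ?case
    proof (intro allI impI)
      fix V :: "'a set" and E
      assume kg: "k_graph k V E" and n: "card V = n"
        and deg: "\<forall>T. T \<subseteq> V \<longrightarrow> card T = k - 1 \<longrightarrow> d * n \<le> card (neighbourhood V E T)"
      show "\<exists>C. loose_hamilton_cycle k V E V C"
      proof (rule loose_hamilton_cycle_fixed[OF k kg n[symmetric] _ h d \<gamma>_def _ elim(4) _ _ N(3) _ _ _ M(3) _ f_def c u[unfolded \<theta>_def] _ _ _ _ e0])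
        show "d * n \<le> card (neighbourhood V E T)" if "T \<subseteq> V" "card T = k - 1" for T using deg that by blast
        have "h * n \<le> d * n" using d0 by (intro mult_right_mono) auto
        then show "8 * real k \<le> d * n" using elim(3) k0 by linarith
        have "real N * (4 * (real k)\<^sup>2) \<le> \<beta> * n * (4 * (real k)\<^sup>2)" using N(1) by (rule mult_right_mono) simp
        also have "\<dots> = \<beta> * (4 * (real k)\<^sup>2) * n" by simp
        also have "\<dots> \<le> \<gamma> / 32 * n" using b1 by (rule mult_right_mono) simp
        finally show "real N * real (4 * k\<^sup>2) \<le> \<gamma> / 32 * n" by simp
        show "real n ^ (k - 1) * exp (- (\<gamma> * N / 4)) < 1/2" using elim(1) by (simp add: N_def)
        have "8 * real k * N \<le> 8 * real k * (\<beta> * n)" using N(1) by (rule mult_left_mono) simp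
        also have "\<dots> = 8 * real k * \<beta> * n" by simp
        also have "\<dots> \<le> h / 16 * n" using b2 by (rule mult_right_mono) simp
        finally show "real (8 * k * N + 6 * k) \<le> h * n / 8" using elim(3) by simp
        have "\<rho> * n \<le> d / 64 * n" using r1(1) by (rule mult_right_mono) simp
        then show "real M \<le> d / 64 * n" using M(1) by linarith
        show "real n ^ (k - 1) * exp (- (d / 2 * M / 4)) < 1/2" using elim(2) by (simp add: M_def)
        have "\<rho> * n \<le> h / 8 * n" using r1(2) by (rule mult_right_mono) simp
        then show "real M \<le> h * n / 8" using M(1) by simp
        show "real (u * (k - 1)) \<le> \<epsilon> * n / 2" using elim(7) by linarith
        show "real f \<le> h * n / 8" using elim(8) by linarith
        have "h / 2 / 4 * (real n / 2 / f - 1) = h / (16 * f) * n - h / 8" by (simp add: field_simps)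
        then show "2 * real c \<le> h / 2 / 4 * (real n / 2 / f - 1)" using elim(9) by linarith
        have "(3 * real k + 2) * (real n / f) = (3 * real k + 2) / f * n" by simp
        also have "\<dots> \<le> d * \<rho> / 64 * n" using fr by (rule mult_right_mono) simp
        finally have "(3 * real k + 2) * (real n / f + 3) + 4 * k \<le> d * \<rho> / 64 * n + d * \<rho> / 64 * n"
          using elim(10) by (simp only: distrib_left)
        also have "\<dots> = d * (\<rho> * n / 2) / 16" by simp
        also have "\<dots> \<le> d * M / 16"
        proof -
          have "d * (\<rho> * n / 2) \<le> d * M" using M(2) d0 h by (intro mult_left_mono) auto
          then show ?thesis by linarith
        qed
        finally show "(3 * real k + 2) * (real n / f + 3) + 4 * real k \<le> d * M / 16" by simp
        have "\<rho> * n \<le> \<epsilon> * n" using r1(3) by (rule mult_right_mono) simp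
        then have "real M + \<epsilon> * n \<le> 2 * (\<epsilon> * n)" using M(1) by linarith
        also have "\<dots> \<le> \<gamma> * (\<beta> * n / 2) / 8" using g0 b0 by (simp add: \<epsilon>_def)
        also have "\<dots> \<le> \<gamma> * N / 8" using N(2) g0 by (intro divide_right_mono mult_left_mono) auto
        finally show "real M + \<epsilon> * n \<le> \<gamma> * N / 8" .
      qed
    qed
  qed
qed

theorem theorem1p1:
  fixes k :: nat and \<eta> :: real
  assumes "k \<ge> 3" and "\<eta> > 0"
  shows "\<exists>n0::nat. \<forall>n>n0. \<forall>(V::'a set) (E::'a set set).
           k_graph k V E \<longrightarrow> card V = n \<longrightarrow>
           real (min_degree k V E) > (1 / (2 * (real k - 1)) + \<eta>) * real n \<longrightarrow>
           (\<exists>V' E'. loose_hamilton_cycle k V E V' E')"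
proof -
  \<comment> \<open>Capping the surplus keeps \<open>d \<le> 1/2\<close>, because
    \<open>1 / (2 * (k - 1)) \<le> 1/4\<close>; a smaller surplus only weakens the degree
    condition.\<close>
  define h where "h = min \<eta> (1/4)"
  define d where "d = 1 / (2 * (real k - 1)) + h"
  have h: "h > 0" "h \<le> 1/4" "h \<le> \<eta>" using assms by (auto simp: h_def)
  obtain n0 where n0: "\<And>n (V :: 'a set) E. n \<ge> n0 \<Longrightarrow> k_graph k V E \<Longrightarrow> card V = n \<Longrightarrow>
    (\<And>T. T \<subseteq> V \<Longrightarrow> card T = k - 1 \<Longrightarrow> d * n \<le> card (neighbourhood V E T)) \<Longrightarrow>
    \<exists>C. loose_hamilton_cycle k V E V C"
    using eventually_loose_hamilton_cycle[OF assms(1) h(1,2) d_def, where 'a = 'a]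
    unfolding eventually_sequentially by blast
  show ?thesis
  proof (intro exI[of _ n0] allI impI)
    fix n and V :: "'a set" and E
    assume n: "n0 < n" and kg: "k_graph k V E" and V: "card V = n"
      and deg: "real (min_degree k V E) > (1 / (2 * (real k - 1)) + \<eta>) * real n"
    have "\<exists>C. loose_hamilton_cycle k V E V C"
    proof (rule n0[OF _ kg V])
      show "n0 \<le> n" using n by simp
      fix T assume T: "T \<subseteq> V" "card T = k - 1"
      have "finite {T. T \<subseteq> V \<and> card T = k - 1}" using kg by (simp add: k_graph_def)
      then have "min_degree k V E \<le> degree V E T"
        unfolding min_degree_def using T by (intro Min_le) auto
      moreover have "d * n \<le> (1 / (2 * (real k - 1)) + \<eta>) * n"
        unfolding d_def using h(3) by (intro mult_right_mono) auto
      ultimately show "d * n \<le> card (neighbourhood V E T)" using deg by (simp add: degree_def)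
    qed
    then show "\<exists>V' E'. loose_hamilton_cycle k V E V' E'" by blast
  qed
qed

end
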